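(* Let $\mathbf G=(G,\Sigma)$ be a ribbon graph with edge set $E$, let $\vec G$ be a reference orientation of $E$, and let $h$ be a half-edge of $G$. Let $p\in\Sigma\setminus(G\cup G^* )$ be the point located at distance $\epsilon/2$ from the midpoint of $h$ in the direction of $h^*$ ($\epsilon>0$ small). Then the Bernardi map $\beta_h'(-,\vec G)$ and the map $\beta_p(-,\vec G)$, both from the set of bases of $\mathbf G$ to $\{\pm\frac12\}^E$, are identical.
   Context: Ribbon graphs. A ribbon graph $\mathbf G=(G,\Sigma)$ is a finite graph $G=(V,E)$ with a cellular embedding in a connected closed oriented surface $\Sigma$ (complement a disjoint union of open disks). The dual graph $G^*=(V^*,E^* )$, embedded in $\Sigma$, has one vertex (covertex) in each component of $\Sigma\setminus G$, and for each $e\in E$ an edge (coedge) $e^*$ crossing $e$ exactly once, at a point $v_e$, and meeting no other edge of $G$. Put $(e^* )^*=e$ and $X^*=\{x^*:x\in X\}$. A transversal is a subset of $E\cup E^*$ of size $|E|$ containing no pair $\{e,e^*\}$; subtransversals are subsets of transversals. A basis of $\mathbf G$ is a transversal $B$ with $\Sigma\setminus B$ connected; a circuit is a minimal subtransversal $C$ with $\Sigma\setminus C$ disconnected. For a basis $B$ and $e\notin B$, $\mathrm{FC}(B,e)$ is the unique circuit contained in $B\triangle\{e,e^*\}$. A set $Q\subseteq E$ is a spanning quasi-tree if a small $\epsilon$-neighborhood of $(V,Q)$ has exactly one boundary component; this holds if and only if $Q\cup(E\setminus Q)^*$ is a basis. Orientations. $\Sigma$ carries the counter-clockwise orientation; for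 a subsurface $\Sigma'$, the induced orientation on $\partial\Sigma'$ is the direction of travel with $\Sigma'$ on the left. Given a reference orientation $\vec G$ of $E$, each coedge $e^*$ is oriented so that it crosses $e$ from right to left. For a circuit $C$ and a component $\Sigma'$ of $\Sigma\setminus C$ (there are two, each with boundary $C$), the signed ribbon cycle oriented by $\Sigma'$ is the vector $\mathbf C\in\{0,\pm1\}^{E\cup E^*}$ with support $C$ such that for $e\in C$, $\mathbf C(e)=+1$ if the reference orientation of $e$ agrees with the induced orientation on $\partial\Sigma'$, and $-1$ otherwise. The map $\beta_p$. For $p\in\Sigma\setminus(G\cup G^* )$, let $\sigma_p$ contain, for each circuit $C$, the signed ribbon cycle with support $C$ oriented by the component of $\Sigma\setminus C$ containing $p$. For a basis $B$ and $e\in E$ let $e'$ be the unique element of $\{e,e^*\}\setminus B$ and $\mathbf C\in\sigma_p$ the element with support $\mathrm{FC}(B,e')$; then $\beta_p(B,\vec G)(e)=\frac12\mathbf C(e')$. The Bernardi map. The point $v_e$ divides $e$ (resp. $e^*$) into two half-edges (resp. half-coedges). For a half-edge $h$ of $e$, $h^*$ denotes the half-coedge of $e^*$ immediately following $h$ in the counter-clockwise order of the four half-(co)edges at $v_e$; also $(h^* )^*:=h$. (So the point $p$ lies near $h$, in the corner at $v_e$ between $h$ and $h^*$.) Let $Q$ be a spanning quasi-tree with small $\epsilon$-neighborhood $N_\epsilon$. The curve $\partial N_\epsilon$, with its induced orientation, crosses each of the $2|E|$ half-(co)edges of the elements of $Q^*\cup(E\setminus Q)$ exactly once, and no others, giving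 a cyclic ordering $Q^\circ$ of these. Cutting it to a linear order $h_0<h_1<\dots<h_{2|E|-1}$ with $h_0$ whichever of $h,h^*$ appears in $Q^\circ$, define the orientation $\gamma_h(Q)$ of $G$: writing $(a,b)$ for the directed edge with tail half-edge $a$ and head half-edge $b$, if $e\in Q$ and $h_i<h_j$ are the two half-coedges of $e^*$ in $Q^\circ$, then $\vec e=(h_i^*,h_j^* )$; if $e\notin Q$ and $h_i<h_j$ are the two half-edges of $e$ in $Q^\circ$, then $\vec e=(h_j,h_i)$. For a basis $B$, $\beta_h'(B,\vec G)(e)=+\frac12$ if the directions of $e$ in $\vec G$ and in $\gamma_h(E\cap B)$ agree, and $-\frac12$ otherwise. *)

theory Defs
  imports "HOL-Complex_Analysis.Complex_Analysis"
begin

section \<open>Closed oriented surfaces\<close>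

text \<open>
  A surface is (the whole of) a Hausdorff type, oriented by an atlas of charts into the
  complex plane. A continuous injection between open subsets of the plane preserves the
  counter-clockwise orientation iff it maps every small circle around a point to a loop
  with winding number 1 around the image point.
\<close>

definition orientation_preserving :: "complex set \<Rightarrow> (complex \<Rightarrow> complex) \<Rightarrow> bool" where
  "orientation_preserving S f \<longleftrightarrow>
     (\<forall>z r. 0 < r \<and> cball z r \<subseteq> S \<longrightarrow> winding_number (f \<circ> circlepath z r) (f z) = 1)"

definition positive_chart ::
    "('a::t2_space set \<times> ('a \<Rightarrow> complex)) set \<Rightarrow> 'a set \<Rightarrow> ('a \<Rightarrow> complex) \<Rightarrow> bool" where
  "positive_chart A U \<phi> \<longleftrightarrow>
     open U \<and> open (\<phi> ` U) \<and> (\<exists>\<psi>. homeomorphism U (\<phi> ` U) \<phi> \<psi>) \<and>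
     (\<forall>(W, \<kappa>) \<in> A. orientation_preserving (\<kappa> ` (U \<inter> W)) (\<phi> \<circ> inv_into W \<kappa>))"

definition closed_oriented_surface :: "('a::t2_space set \<times> ('a \<Rightarrow> complex)) set \<Rightarrow> bool" where
  "closed_oriented_surface A \<longleftrightarrow>
     compact (UNIV :: 'a set) \<and> connected (UNIV :: 'a set) \<and>
     (\<Union>(U, \<phi>) \<in> A. U) = UNIV \<and> (\<forall>(U, \<phi>) \<in> A. positive_chart A U \<phi>)"

section \<open>Curves on the surface: left, right and crossings\<close>

text \<open>
  \<open>flat_disc A c t D \<zeta>\<close>: the open set \<open>D\<close> is identified by the positive chart \<open>\<zeta>\<close> with the
  open unit disc in such a way that the part of the curve \<open>c\<close> inside \<open>D\<close> is the real diameter,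
  traversed from left to right and passing through the centre at time \<open>t\<close>. As \<open>\<zeta>\<close> is positive,
  the points of \<open>D\<close> on the left of \<open>c\<close> are those with \<open>Im (\<zeta> y) > 0\<close>.
\<close>

definition flat_disc ::
    "('a::t2_space set \<times> ('a \<Rightarrow> complex)) set \<Rightarrow> (real \<Rightarrow> 'a) \<Rightarrow> real \<Rightarrow> 'a set \<Rightarrow> ('a \<Rightarrow> complex) \<Rightarrow> bool"
  where
  "flat_disc A c t D \<zeta> \<longleftrightarrow>
     positive_chart A D \<zeta> \<and> \<zeta> ` D = ball 0 1 \<and> c t \<in> D \<and>
     D \<inter> path_image c = {y \<in> D. Im (\<zeta> y) = 0} \<and>
     (\<forall>s \<in> {0..1}. c s \<in> D \<longrightarrow> sgn (Re (\<zeta> (c s))) = sgn (s - t))"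

definition lies_left ::
    "('a::t2_space set \<times> ('a \<Rightarrow> complex)) set \<Rightarrow> 'a set \<Rightarrow> (real \<Rightarrow> 'a) \<Rightarrow> bool" where
  "lies_left A S c \<longleftrightarrow>
     (\<forall>t \<in> {0<..<1}. \<exists>D \<zeta>. flat_disc A c t D \<zeta> \<and> {y \<in> D. Im (\<zeta> y) > 0} \<subseteq> S)"

text \<open>
  At \<open>c t = b s\<close> the curve \<open>b\<close> crosses \<open>c\<close> from the right of \<open>c\<close> to its left: in a common chart,
  \<open>c\<close> is the real diameter and \<open>b\<close> the imaginary diameter traversed upwards (multiplication by
  \<open>- \<i>\<close> turns the latter into the real diameter traversed from left to right).
\<close>

definition crosses_right_to_left ::
    "('a::t2_space set \<times> ('a \<Rightarrow> complex)) set \<Rightarrow> (real \<Rightarrow> 'a) \<Rightarrow> real \<Rightarrow> (real \<Rightarrow> 'a) \<Rightarrow> real \<Rightarrow> bool"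
  where
  "crosses_right_to_left A b s c t \<longleftrightarrow>
     (\<exists>D \<zeta>. flat_disc A c t D \<zeta> \<and> flat_disc A b s D (\<lambda>y. - \<i> * \<zeta> y))"

definition crosses ::
    "('a::t2_space set \<times> ('a \<Rightarrow> complex)) set \<Rightarrow> (real \<Rightarrow> 'a) \<Rightarrow> real \<Rightarrow> (real \<Rightarrow> 'a) \<Rightarrow> real \<Rightarrow> bool"
  where
  "crosses A b s c t \<longleftrightarrow>
     crosses_right_to_left A b s c t \<or> crosses_right_to_left A (reversepath b) (1 - s) c t"

section \<open>Ribbon graphs\<close>

text \<open>The elements of \<open>E \<union> E\<^sup>*\<close>, and the half-edges and half-coedges.\<close>

datatype 'e elt = Edge 'e | Coedge 'e

datatype 'e half = Tail "'e elt" | Head "'e elt"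

fun underlying :: "'e elt \<Rightarrow> 'e" where
  "underlying (Edge e) = e"
| "underlying (Coedge e) = e"

fun dual :: "'e elt \<Rightarrow> 'e elt" where
  "dual (Edge e) = Coedge e"
| "dual (Coedge e) = Edge e"

fun elt_of :: "'e half \<Rightarrow> 'e elt" where
  "elt_of (Tail x) = x"
| "elt_of (Head x) = x"

text \<open>
  \<open>curve G x\<close> parametrises the edge or coedge \<open>x\<close> over \<open>[0, 1]\<close>. The parametrisation is
  only a presentation of \<open>x\<close>; reference orientations are introduced separately below.
\<close>

record ('a, 'e) ribbon =
  atlas :: "('a set \<times> ('a \<Rightarrow> complex)) set"
  verts :: "'a set"
  coverts :: "'a set"
  edges :: "'e set"
  curve :: "'e elt \<Rightarrow> real \<Rightarrow> 'a"

text \<open>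
  A finite graph (loops and multiple edges allowed) embedded in the surface. As usual for
  embeddings of graphs in surfaces, edges are locally flat; for topological arcs in a surface
  this holds automatically by the Schoenflies theorem.
\<close>

definition embedded_graph ::
    "('a::t2_space set \<times> ('a \<Rightarrow> complex)) set \<Rightarrow> 'a set \<Rightarrow> 'e set \<Rightarrow> ('e \<Rightarrow> real \<Rightarrow> 'a) \<Rightarrow> bool" where
  "embedded_graph A V E \<gamma> \<longleftrightarrow>
     finite V \<and> finite E \<and>
     (\<forall>e \<in> E. simple_path (\<gamma> e) \<and> \<gamma> e 0 \<in> V \<and> \<gamma> e 1 \<in> V \<and>
        \<gamma> e ` {0<..<1} \<inter> V = {} \<and>
        (\<forall>t \<in> {0<..<1}. \<exists>D \<zeta>. flat_disc A (\<gamma> e) t D \<zeta>)) \<and>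
     (\<forall>e \<in> E. \<forall>e' \<in> E. e \<noteq> e' \<longrightarrow> \<gamma> e ` {0<..<1} \<inter> \<gamma> e' ` {0<..<1} = {})"

definition elts :: "('a, 'e) ribbon \<Rightarrow> 'e elt set" where
  "elts G = Edge ` edges G \<union> Coedge ` edges G"

text \<open>The closed subset of the surface covered by a set of edges and coedges.\<close>

definition points :: "('a::t2_space, 'e) ribbon \<Rightarrow> 'e elt set \<Rightarrow> 'a set" where
  "points G X = (\<Union>x \<in> X. path_image (curve G x))"

definition graph_points :: "('a::t2_space, 'e) ribbon \<Rightarrow> 'a set" where
  "graph_points G = verts G \<union> points G (Edge ` edges G)"

definition dual_graph_points :: "('a::t2_space, 'e) ribbon \<Rightarrow> 'a set" where
  "dual_graph_points G = coverts G \<union> points G (Coedge ` edges G)"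

text \<open>
  A ribbon graph together with its dual graph. Each curve is parametrised so that the crossing
  point \<open>v_e\<close> is at time 1/2, and each coedge so that it crosses its edge from right to left
  relative to the two parametrisations.
\<close>

definition ribbon_graph :: "('a::t2_space, 'e) ribbon \<Rightarrow> bool" where
  "ribbon_graph G \<longleftrightarrow>
     closed_oriented_surface (atlas G) \<and>
     embedded_graph (atlas G) (verts G) (edges G) (\<lambda>e. curve G (Edge e)) \<and>
     (\<forall>F \<in> components (- graph_points G). F homeomorphic ball (0::complex) 1) \<and>
     embedded_graph (atlas G) (coverts G) (edges G) (\<lambda>e. curve G (Coedge e)) \<and>
     coverts G \<inter> graph_points G = {} \<and>
     (\<forall>F \<in> components (- graph_points G). \<exists>!f. f \<in> coverts G \<inter> F) \<and>
     (\<forall>e \<in> edges G. \<forall>e' \<in> edges G.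
        path_image (curve G (Coedge e)) \<inter> path_image (curve G (Edge e')) =
          (if e = e' then {curve G (Edge e) (1/2)} else {})) \<and>
     (\<forall>e \<in> edges G.
        crosses_right_to_left (atlas G) (curve G (Coedge e)) (1/2) (curve G (Edge e)) (1/2))"

section \<open>Bases and circuits\<close>

definition transversal :: "('a, 'e) ribbon \<Rightarrow> 'e elt set \<Rightarrow> bool" where
  "transversal G T \<longleftrightarrow>
     T \<subseteq> elts G \<and> card T = card (edges G) \<and> (\<forall>e. \<not> {Edge e, Coedge e} \<subseteq> T)"

definition subtransversal :: "('a, 'e) ribbon \<Rightarrow> 'e elt set \<Rightarrow> bool" where
  "subtransversal G S \<longleftrightarrow> (\<exists>T. transversal G T \<and> S \<subseteq> T)"

definition basis :: "('a::t2_space, 'e) ribbon \<Rightarrow> 'e elt set \<Rightarrow> bool" where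
  "basis G B \<longleftrightarrow> transversal G B \<and> connected (- points G B)"

definition circuit :: "('a::t2_space, 'e) ribbon \<Rightarrow> 'e elt set \<Rightarrow> bool" where
  "circuit G C \<longleftrightarrow>
     subtransversal G C \<and> \<not> connected (- points G C) \<and>
     (\<forall>C'. C' \<subset> C \<longrightarrow> \<not> (subtransversal G C' \<and> \<not> connected (- points G C')))"

definition FC :: "('a::t2_space, 'e) ribbon \<Rightarrow> 'e elt set \<Rightarrow> 'e elt \<Rightarrow> 'e elt set" where
  "FC G B x = (THE C. circuit G C \<and> C \<subseteq> sym_diff B {x, dual x})"

section \<open>Reference orientations and the map \<open>\<beta>\<^sub>p\<close>\<close>

text \<open>
  A reference orientation is encoded as \<open>r :: 'e \<Rightarrow> bool\<close>: \<open>r e\<close> says whether \<open>e\<close> is oriented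
  along or against \<open>curve G (Edge e)\<close>. Reversing an edge swaps its right and left, so the coedge,
  which has to cross from right to left, is reversed simultaneously.
\<close>

definition ref_curve :: "('a::t2_space, 'e) ribbon \<Rightarrow> ('e \<Rightarrow> bool) \<Rightarrow> 'e elt \<Rightarrow> real \<Rightarrow> 'a" where
  "ref_curve G r x =
     (if r (underlying x) then curve G x else reversepath (curve G x))"

definition signed_ribbon_cycle ::
    "('a::t2_space, 'e) ribbon \<Rightarrow> ('e \<Rightarrow> bool) \<Rightarrow> 'e elt set \<Rightarrow> 'a set \<Rightarrow> 'e elt \<Rightarrow> real" where
  "signed_ribbon_cycle G r C S x =
     (if x \<notin> C then 0 else if lies_left (atlas G) S (ref_curve G r x) then 1 else - 1)"

definition sigma :: "('a::t2_space, 'e) ribbon \<Rightarrow> ('e \<Rightarrow> bool) \<Rightarrow> 'a \<Rightarrow> ('e elt \<Rightarrow> real) set" where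
  "sigma G r p =
     {signed_ribbon_cycle G r C (connected_component_set (- points G C) p) |C. circuit G C}"

definition beta_p :: "('a::t2_space, 'e) ribbon \<Rightarrow> ('e \<Rightarrow> bool) \<Rightarrow> 'a \<Rightarrow> 'e elt set \<Rightarrow> 'e \<Rightarrow> real" where
  "beta_p G r p B e =
     (let e' = (THE x. x \<in> {Edge e, Coedge e} - B);
          C = (THE C. C \<in> sigma G r p \<and> {x. C x \<noteq> 0} = FC G B e')
      in 1/2 * C e')"

section \<open>Half-edges\<close>

definition half_points :: "('a, 'e) ribbon \<Rightarrow> 'e half \<Rightarrow> 'a set" where
  "half_points G h = (case h of
      Tail x \<Rightarrow> curve G x ` {0<..<1/2}
    | Head x \<Rightarrow> curve G x ` {1/2<..<1})"

definition half_midpoint :: "'e half \<Rightarrow> real" where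
  "half_midpoint h = (case h of Tail x \<Rightarrow> 1/4 | Head x \<Rightarrow> 3/4)"

text \<open>
  In a chart at \<open>v_e\<close> witnessing that the coedge crosses the edge from right to left, the four
  half-(co)edges of \<open>e\<close> are the four half-axes, in the following directions.
\<close>

fun half_ray :: "'e half \<Rightarrow> complex" where
  "half_ray (Tail (Edge e)) = - 1"
| "half_ray (Head (Edge e)) = 1"
| "half_ray (Tail (Coedge e)) = - \<i>"
| "half_ray (Head (Coedge e)) = \<i>"

fun dual_half :: "'e half \<Rightarrow> 'e half" where
  "dual_half (Tail x) = Tail (dual x)"
| "dual_half (Head x) = Head (dual x)"

lemma dual_half_follows_ccw:
  "elt_of h = Edge e \<Longrightarrow> half_ray (dual_half h) = \<i> * half_ray h"
  by (cases h) auto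

lemma dual_half_dual_half: "dual_half (dual_half h) = h"
proof -
  have "dual (dual x) = x" for x :: "'e elt" by (cases x) auto
  then show ?thesis by (cases h) auto
qed

text \<open>
  The point \<open>p\<close> lies very close to the midpoint of the half-edge \<open>h\<close>, off \<open>h\<close> in the direction
  of \<open>dual_half h\<close>: it is in a disc around the midpoint which meets no part of the graph and its
  dual other than the edge, on the side of the edge to which \<open>dual_half h\<close> points.
\<close>

definition near_half :: "('a::t2_space, 'e) ribbon \<Rightarrow> 'e half \<Rightarrow> 'a \<Rightarrow> bool" where
  "near_half G h p \<longleftrightarrow>
     (\<exists>D \<zeta>. flat_disc (atlas G) (curve G (elt_of h)) (half_midpoint h) D \<zeta> \<and>
        D \<inter> (graph_points G \<union> dual_graph_points G) \<subseteq> path_image (curve G (elt_of h)) \<and>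
        p \<in> D \<and> sgn (Im (\<zeta> p)) = Im (half_ray (dual_half h)))"

section \<open>The Bernardi map\<close>

definition edges_of :: "('a, 'e) ribbon \<Rightarrow> 'e elt set \<Rightarrow> 'e set" where
  "edges_of G B = {e \<in> edges G. Edge e \<in> B}"

text \<open>The half-(co)edges of the elements of \<open>Q\<^sup>* \<union> (E - Q)\<close>.\<close>

definition toured_halves :: "('a, 'e) ribbon \<Rightarrow> 'e set \<Rightarrow> 'e half set" where
  "toured_halves G Q = {g. elt_of g \<in> Coedge ` Q \<union> Edge ` (edges G - Q)}"

text \<open>
  A small closed neighborhood \<open>N\<close> of \<open>(V, Q)\<close>: it stays away from the covertices and from the
  coedges of edges outside \<open>Q\<close>, and its boundary meets each half-(co)edge of
  \<open>Q\<^sup>* \<union> (E - Q)\<close> exactly once.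
\<close>

definition small_neighborhood :: "('a::t2_space, 'e) ribbon \<Rightarrow> 'e set \<Rightarrow> 'a set \<Rightarrow> bool" where
  "small_neighborhood G Q N \<longleftrightarrow>
     closed N \<and>
     verts G \<union> points G (Edge ` Q) \<subseteq> interior N \<and>
     N \<inter> (coverts G \<union> points G (Coedge ` (edges G - Q))) = {} \<and>
     (\<forall>g \<in> toured_halves G Q. \<exists>!y. y \<in> half_points G g \<inter> frontier N)"

text \<open>The time at which a curve \<open>c\<close>, defined on \<open>[0, 1]\<close>, passes through a half-(co)edge.\<close>

definition crossing_time :: "('a, 'e) ribbon \<Rightarrow> (real \<Rightarrow> 'a) \<Rightarrow> 'e half \<Rightarrow> real" where
  "crossing_time G c g = (THE t. t \<in> {0..1} \<and> c t \<in> half_points G g)"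

text \<open>
  The closed curve \<open>c\<close> goes once around the boundary of the small neighborhood \<open>N\<close> of \<open>(V, Q)\<close>,
  which thus has exactly one component, with the induced orientation, and crosses the
  half-(co)edges transversally. Its starting point cuts the cyclic ordering of the
  half-(co)edges immediately before the one of \<open>h\<close> and \<open>dual_half h\<close> that occurs in it.
\<close>

definition boundary_tour ::
    "('a::t2_space, 'e) ribbon \<Rightarrow> 'e half \<Rightarrow> 'e set \<Rightarrow> 'a set \<Rightarrow> (real \<Rightarrow> 'a) \<Rightarrow> bool" where
  "boundary_tour G h Q N c \<longleftrightarrow>
     small_neighborhood G Q N \<and>
     simple_path c \<and> pathfinish c = pathstart c \<and> path_image c = frontier N \<and>
     lies_left (atlas G) N c \<and>
     pathstart c \<notin> graph_points G \<union> dual_graph_points G \<and>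
     (\<forall>x \<in> Coedge ` Q \<union> Edge ` (edges G - Q). \<forall>s \<in> {0..1}. \<forall>t \<in> {0..1}.
        curve G x s = c t \<longrightarrow> crosses (atlas G) (curve G x) s c t) \<and>
     (\<forall>h\<^sub>0 \<in> {h, dual_half h} \<inter> toured_halves G Q. \<forall>g \<in> toured_halves G Q.
        crossing_time G c h\<^sub>0 \<le> crossing_time G c g)"

text \<open>Orientations of edges as pairs (tail half-edge, head half-edge).\<close>

definition ref_direction :: "('e \<Rightarrow> bool) \<Rightarrow> 'e \<Rightarrow> 'e half \<times> 'e half" where
  "ref_direction r e =
     (if r e then (Tail (Edge e), Head (Edge e)) else (Head (Edge e), Tail (Edge e)))"

definition tour_orientation ::
    "('a, 'e) ribbon \<Rightarrow> (real \<Rightarrow> 'a) \<Rightarrow> 'e set \<Rightarrow> 'e \<Rightarrow> 'e half \<times> 'e half" where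
  "tour_orientation G c Q e =
     (let x = (if e \<in> Q then Coedge e else Edge e);
          (h\<^sub>i, h\<^sub>j) = (if crossing_time G c (Tail x) < crossing_time G c (Head x)
                     then (Tail x, Head x) else (Head x, Tail x))
      in if e \<in> Q then (dual_half h\<^sub>i, dual_half h\<^sub>j) else (h\<^sub>j, h\<^sub>i))"

definition bernardi ::
    "('a, 'e) ribbon \<Rightarrow> ('e \<Rightarrow> bool) \<Rightarrow> (real \<Rightarrow> 'a) \<Rightarrow> 'e elt set \<Rightarrow> 'e \<Rightarrow> real" where
  "bernardi G r c B e =
     (if ref_direction r e = tour_orientation G c (edges_of G B) e then 1/2 else - 1/2)"

end

(*
  Let W be the complement of the graph and its dual. The tour c avoids B and the (co)vertices and
  crosses every half of the 2|E| half-(co)edges outside B once, so it consists of 2|E| arcs in W.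
  Every component of W lies along some half-(co)edge, hence (turning around v_e) along one that c
  crosses, hence meets c. Conversely W has at least 2|E| components: cutting the faces, which are
  discs, along the half-coedges one after another, each new half-coedge ending at a covertex already
  reached closes up a Jordan curve. So arcs and components correspond bijectively.

  For x outside B, the two crossings of x with c split c into an inner and an outer part, and
  accordingly W into two regions. As c runs with N on its left, it crosses the two halves of x in
  opposite directions, so each side of x belongs wholly to one region. No other element outside
  T = B - x* + x separates the regions, so the elements of T that lie on both of them form the
  unique circuit in T. The point p lies on the arc before the first crossing, thus in the outer
  region, and both maps record on which side of x that region lies.
*)

theory Submission
  imports Defs
begin

section \<open>Sides of a curve on an oriented surface\<close>

text \<open>Edges are locally flat at inner points only; nothing is known about how they approach a
  vertex or covertex. So everything is read off in flat discs at inner points, and the finitely many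
  (co)vertices are handled by one principle: two disjoint open sets with dense union cannot touch in
  an open set at finitely many points only. "The left of a curve at time t" must not depend on the
  flat disc that exhibits it. This is where the orientation enters: two discs that disagree would
  differ by a reflection, which has winding number -1. On the surface itself neither Euler
  characteristic nor a Jordan theorem is used. The Jordan curve theorem is applied in the plane
  only, to one face compactified by a point. Global information comes from two counts that squeeze
  each other: at most 2|E| arcs, at least 2|E| regions. \<open>N\<close> is not treated as a surface
  with boundary. Only its frontier, its lying left of the tour, and the position of vertices,
  covertices and \<open>B\<close> relative to it enter.\<close>

text \<open>The straight segment from \<open>a * w\<close> to \<open>w\<close> with \<open>w\<close>
  nonzero passes through 0 only if \<open>a\<close> is a nonpositive real, so the linear homotopy
  avoids 0.\<close>

lemma winding_number_mult_not_nonpos: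
  assumes "path \<gamma>" "pathfinish \<gamma> = pathstart \<gamma>" "0 \<notin> path_image \<gamma>" "a \<notin> \<real>\<^sub>\<le>\<^sub>0"
  shows "winding_number (\<lambda>t. a * \<gamma> t) 0 = winding_number \<gamma> 0"
proof (rule winding_number_homotopic_loops, rule homotopic_loops_linear)
  show "path (\<lambda>t. a * \<gamma> t)" "path \<gamma>"
    using assms by (auto simp: path_def intro!: continuous_intros)
  show "pathfinish (\<lambda>t. a * \<gamma> t) = pathstart (\<lambda>t. a * \<gamma> t)" "pathfinish \<gamma> = pathstart \<gamma>"
    using assms by (auto simp: pathfinish_def pathstart_def)
  fix t :: real assume t: "t \<in> {0..1}"
  then have nz: "\<gamma> t \<noteq> 0" using assms(3) by (auto simp: path_image_def)
  show "closed_segment (a * \<gamma> t) (\<gamma> t) \<subseteq> - {0}"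
  proof
    fix w assume "w \<in> closed_segment (a * \<gamma> t) (\<gamma> t)"
    then obtain u where u: "0 \<le> u" "u \<le> 1" and w: "w = (1 - u) *\<^sub>R (a * \<gamma> t) + u *\<^sub>R \<gamma> t"
      by (auto simp: in_segment)
    have weq: "w = ((1 - u) * a + u) * \<gamma> t" using w by (simp add: scaleR_conv_of_real algebra_simps)
    have "(1 - u) * a + u \<noteq> 0"
    proof
      assume z: "(1 - u) * a + u = 0"
      have "u \<noteq> 1" using z by auto
      then have "a = complex_of_real (- (u / (1 - u)))"
        using z by (simp add: field_simps eq_neg_iff_add_eq_0)
      moreover have "- (u / (1 - u)) \<le> 0" using u by simp
      ultimately show False using assms(4) by (simp add: complex_nonpos_Reals_iff)
    qed
    then show "w \<in> - {0}" using weq nz by simp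
  qed
qed

text \<open>Every nonzero \<open>a\<close> is the square of its principal root, which is never a
  nonpositive real. Multiplying twice by the root removes the restriction on the factor in the
  preceding lemma.\<close>

lemma winding_number_mult:
  assumes "path \<gamma>" "pathfinish \<gamma> = pathstart \<gamma>" "z \<notin> path_image \<gamma>" "a \<noteq> 0"
  shows "winding_number (\<lambda>t. a * (\<gamma> t - b)) (a * (z - b)) = winding_number \<gamma> z"
proof -
  define c where "c = csqrt a"
  have cc: "c * c = a" by (simp add: c_def power2_eq_square[symmetric] del: csqrt.simps)
  then have "c \<noteq> 0" using assms(4) by auto
  then have c: "c * c = a" "c \<notin> \<real>\<^sub>\<le>\<^sub>0"
    using csqrt_principal[of a] cc
    by (auto simp: c_def complex_nonpos_Reals_iff complex_eq_iff simp del: csqrt.simps)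
  let ?g = "\<lambda>t. \<gamma> t - z"
  have g: "path ?g" "pathfinish ?g = pathstart ?g" "0 \<notin> path_image ?g"
    using assms by (auto simp: path_def pathfinish_def pathstart_def path_image_def intro!: continuous_intros)
  have cg: "path (\<lambda>t. c * ?g t)" "pathfinish (\<lambda>t. c * ?g t) = pathstart (\<lambda>t. c * ?g t)"
     "0 \<notin> path_image (\<lambda>t. c * ?g t)"
    using g c assms(4) by (auto simp: path_def pathfinish_def pathstart_def path_image_def intro!: continuous_intros)
  have "winding_number (\<lambda>t. a * (\<gamma> t - b)) (a * (z - b)) = winding_number (\<lambda>t. c * (c * ?g t)) 0"
    by (subst winding_number_offset) (simp add: c(1)[symmetric] algebra_simps)
  also have "\<dots> = winding_number \<gamma> z"
    using winding_number_mult_not_nonpos[OF cg c(2)] winding_number_mult_not_nonpos[OF g c(2)]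
     winding_number_offset[of \<gamma> z] by simp
  finally show ?thesis .
qed

lemma positive_chart_transition:
  assumes "positive_chart A W \<kappa>" "positive_chart A' U \<phi>"
  shows "continuous_on (\<kappa> ` (U \<inter> W)) (\<phi> \<circ> inv_into W \<kappa>)" "inj_on (\<phi> \<circ> inv_into W \<kappa>) (\<kappa> ` (U \<inter> W))"
    "\<And>y. y \<in> W \<Longrightarrow> inv_into W \<kappa> (\<kappa> y) = y" "open (\<kappa> ` (U \<inter> W))"
proof -
  obtain \<psi> where \<psi>: "homeomorphism W (\<kappa> ` W) \<kappa> \<psi>" and oW: "open W" "open (\<kappa> ` W)"
    using assms(1) by (auto simp: positive_chart_def)
  obtain \<psi>' where \<psi>': "homeomorphism U (\<phi> ` U) \<phi> \<psi>'" and oU: "open U"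
    using assms(2) by (auto simp: positive_chart_def)
  have injW: "inj_on \<kappa> W" and injU: "inj_on \<phi> U"
    using \<psi> \<psi>' by (metis homeomorphism_apply1 inj_onI)+
  show inv: "inv_into W \<kappa> (\<kappa> y) = y" if "y \<in> W" for y using injW that by simp
  have eq: "inv_into W \<kappa> w = \<psi> w" if "w \<in> \<kappa> ` W" for w
    using that inv \<psi> by (auto simp: homeomorphism_apply1)
  have c1: "continuous_on (\<kappa> ` (U \<inter> W)) (inv_into W \<kappa>)"
    using homeomorphism_cont2[OF \<psi>] eq
    by (metis (no_types, lifting) Int_lower2 continuous_on_cong continuous_on_subset image_mono)
  have im: "inv_into W \<kappa> ` \<kappa> ` (U \<inter> W) \<subseteq> U" using inv by auto
  show "continuous_on (\<kappa> ` (U \<inter> W)) (\<phi> \<circ> inv_into W \<kappa>)"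
    using c1 im homeomorphism_cont1[OF \<psi>'] by (meson continuous_on_compose continuous_on_subset)
  show "inj_on (\<phi> \<circ> inv_into W \<kappa>) (\<kappa> ` (U \<inter> W))"
    using injU inv by (auto simp: inj_on_def)
  have "openin (top_of_set (\<kappa> ` W)) (\<kappa> ` (U \<inter> W))"
    using homeomorphism_imp_open_map[OF \<psi>] oU by (metis inf_commute openin_open_Int)
  then show "open (\<kappa> ` (U \<inter> W))" using oW(2) openin_open_eq by blast
qed

lemma positive_chart_winding:
  assumes "positive_chart A U \<phi>" "(W, \<kappa>) \<in> A" "0 < r" "cball z r \<subseteq> \<kappa> ` (U \<inter> W)"
  shows "winding_number (\<phi> \<circ> inv_into W \<kappa> \<circ> circlepath z r) ((\<phi> \<circ> inv_into W \<kappa>) z) = 1"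
  using assms unfolding positive_chart_def orientation_preserving_def by blast

text \<open>Complex affine maps preserve winding numbers. This licenses all later changes of chart:
  shrinking and recentring a disc, and the half turn (\<open>a = -1\<close>) that accompanies the
  reversal of a curve.\<close>

lemma positive_chart_affine:
  assumes A: "closed_oriented_surface A" and c: "positive_chart A U \<phi>"
    and U': "open U'" "U' \<subseteq> U" and a: "a \<noteq> 0"
  shows "positive_chart A U' (\<lambda>y. a * (\<phi> y - b))"
proof -
  obtain \<psi> where \<psi>: "homeomorphism U (\<phi> ` U) \<phi> \<psi>" and o: "open U" "open (\<phi> ` U)"
    using c by (auto simp: positive_chart_def)
  let ?m = "\<lambda>w. a * (w - b)" and ?m' = "\<lambda>w. w / a + b"
  have h1: "homeomorphism U' (\<phi> ` U') \<phi> \<psi>"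
    using homeomorphism_of_subsets[OF \<psi> U'(2)] by blast
  have h2: "homeomorphism (\<phi> ` U') (?m ` \<phi> ` U') ?m ?m'"
    unfolding homeomorphism_def using a by (auto intro!: continuous_intros simp: image_image)
  have h: "homeomorphism U' ((\<lambda>y. a * (\<phi> y - b)) ` U') (\<lambda>y. a * (\<phi> y - b)) (\<psi> \<circ> ?m')"
    using homeomorphism_compose[OF h1 h2] by (simp add: o_def image_image)
  have "openin (top_of_set (\<phi> ` U)) (\<phi> ` U')"
    using homeomorphism_imp_open_map[OF \<psi>] U' by (metis inf.absorb2 openin_open_Int)
  then have oi: "open (\<phi> ` U')" using o(2) openin_open_eq by blast
  have "open (?m ` \<phi> ` U')"
  proof -
    have "?m ` \<phi> ` U' = ?m' -` \<phi> ` U'" using a by (auto simp: image_iff field_simps)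
    moreover have "open (?m' -` \<phi> ` U')" using oi a by (intro open_vimage) (auto intro!: continuous_intros)
    ultimately show ?thesis by simp
  qed
  then have oim: "open ((\<lambda>y. a * (\<phi> y - b)) ` U')" by (simp add: image_image)
  have "orientation_preserving (\<kappa> ` (U' \<inter> W)) ((\<lambda>y. a * (\<phi> y - b)) \<circ> inv_into W \<kappa>)"
    if W: "(W, \<kappa>) \<in> A" for W \<kappa>
    unfolding orientation_preserving_def
  proof (intro allI impI)
    fix z r assume zr: "0 < r \<and> cball z r \<subseteq> \<kappa> ` (U' \<inter> W)"
    have pc: "positive_chart A W \<kappa>" using A W by (auto simp: closed_oriented_surface_def)
    note tr = positive_chart_transition[OF pc c]
    let ?f = "\<phi> \<circ> inv_into W \<kappa>"
    have sub: "cball z r \<subseteq> \<kappa> ` (U \<inter> W)" using zr U' by blast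
    have pim: "path_image (circlepath z r) \<subseteq> cball z r" using zr by auto
    have "winding_number (?f \<circ> circlepath z r) (?f z) = 1"
      using c W zr sub unfolding positive_chart_def orientation_preserving_def by blast
    moreover have "path (?f \<circ> circlepath z r)"
      using tr(1) pim sub by (intro path_continuous_image) (auto intro: continuous_on_subset)
    moreover have "pathfinish (?f \<circ> circlepath z r) = pathstart (?f \<circ> circlepath z r)"
      by (simp add: pathfinish_compose pathstart_compose)
    moreover have "?f z \<notin> path_image (?f \<circ> circlepath z r)"
    proof
      assume "?f z \<in> path_image (?f \<circ> circlepath z r)"
      then obtain w where w: "w \<in> path_image (circlepath z r)" "?f z = ?f w"
        by (auto simp: path_image_compose)
      then have "z = w" using tr(2) sub pim zr
        by (metis centre_in_cball inj_onD less_eq_real_def subsetD)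
      then show False using w zr by auto
    qed
    ultimately have "winding_number (\<lambda>t. a * ((?f \<circ> circlepath z r) t - b)) (a * (?f z - b)) = 1"
      using winding_number_mult a by metis
    then show "winding_number (((\<lambda>y. a * (\<phi> y - b)) \<circ> inv_into W \<kappa>) \<circ> circlepath z r) (((\<lambda>y. a * (\<phi> y - b)) \<circ> inv_into W \<kappa>) z) = 1"
      by (simp add: o_def)
  qed
  then show ?thesis unfolding positive_chart_def using U'(1) oim h by auto
qed

text \<open>Two conjugate positive charts would have transition map of degree \<open>- 1\<close>.\<close>

lemma positive_charts_not_reflected:
  assumes A: "closed_oriented_surface A" and c: "positive_chart A U \<phi>" "positive_chart A U' \<phi>'"
    and p: "p \<in> U" "p \<in> U'" "\<phi> p = 0" "\<phi>' p = 0" and O: "open O'" "p \<in> O'" "O' \<subseteq> U \<inter> U'"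
    and refl: "\<And>y. y \<in> O' - {p} \<Longrightarrow> 0 \<notin> closed_segment (\<phi>' y) (cnj (\<phi> y))"
  shows False
proof -
  obtain W \<kappa> where W: "(W, \<kappa>) \<in> A" "p \<in> W"
    using A unfolding closed_oriented_surface_def by blast
  have pc: "positive_chart A W \<kappa>" using A W by (auto simp: closed_oriented_surface_def)
  then obtain \<psi> where \<psi>: "homeomorphism W (\<kappa> ` W) \<kappa> \<psi>" "open (\<kappa> ` W)"
    by (auto simp: positive_chart_def)
  note tr = positive_chart_transition[OF pc c(1)] and tr' = positive_chart_transition[OF pc c(2)]
  have "openin (top_of_set (\<kappa> ` W)) (\<kappa> ` (W \<inter> O'))"
    using homeomorphism_imp_open_map[OF \<psi>(1)] O by (metis openin_open_Int)
  then have "open (\<kappa> ` (W \<inter> O'))" using \<psi>(2) openin_open_eq by blast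
  moreover have "\<kappa> p \<in> \<kappa> ` (W \<inter> O')" using W O by auto
  ultimately obtain r where r: "r > 0" "cball (\<kappa> p) r \<subseteq> \<kappa> ` (W \<inter> O')"
    by (meson open_contains_cball)
  let ?C = "circlepath (\<kappa> p) r" and ?f = "\<phi> \<circ> inv_into W \<kappa>" and ?f' = "\<phi>' \<circ> inv_into W \<kappa>"
  have f0: "?f (\<kappa> p) = 0" "?f' (\<kappa> p) = 0" using p tr(3) W by auto
  have sub: "cball (\<kappa> p) r \<subseteq> \<kappa> ` (U \<inter> W)" "cball (\<kappa> p) r \<subseteq> \<kappa> ` (U' \<inter> W)" using r O by blast+
  have wn: "winding_number (?f \<circ> ?C) 0 = 1" "winding_number (?f' \<circ> ?C) 0 = 1"
    using positive_chart_winding[OF c(1) W(1) r(1) sub(1)] positive_chart_winding[OF c(2) W(1) r(1) sub(2)] f0 by simp_all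
  have pim: "path_image ?C \<subseteq> cball (\<kappa> p) r" using r by auto
  have pth: "path (?f \<circ> ?C)" "path (?f' \<circ> ?C)"
    using tr(1) tr'(1) pim sub by (intro path_continuous_image; force intro: continuous_on_subset)+
  have pt: "\<exists>y \<in> O' - {p}. ?C t = \<kappa> y \<and> (?f \<circ> ?C) t = \<phi> y \<and> (?f' \<circ> ?C) t = \<phi>' y" if "t \<in> {0..1}" for t
  proof -
    have "?C t \<in> path_image ?C" using that by (auto simp: path_image_def)
    then have "?C t \<in> \<kappa> ` (W \<inter> O')" "?C t \<noteq> \<kappa> p" using r pim by auto
    then obtain y where "y \<in> W" "y \<in> O'" "?C t = \<kappa> y" "y \<noteq> p" by auto
    then show ?thesis using tr(3) by (intro bexI[of _ y]) auto
  qed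
  have nz: "0 \<notin> path_image (?f \<circ> ?C)"
  proof
    assume "0 \<in> path_image (?f \<circ> ?C)"
    then obtain t where "t \<in> {0..1}" "(?f \<circ> ?C) t = 0" by (auto simp: path_image_def)
    then obtain y where y: "y \<in> O' - {p}" "\<phi> y = 0" using pt by metis
    then show False using refl[of y] by auto
  qed
  \<comment> \<open>By \<open>refl\<close> the linear homotopy from one chart to the conjugate of
    the other never meets 0, so \<phi>' inherits the winding number -1 of the conjugate.\<close>
  have "winding_number (?f' \<circ> ?C) 0 = winding_number (cnj \<circ> (?f \<circ> ?C)) 0"
  proof (rule winding_number_homotopic_loops, rule homotopic_loops_linear)
    show "path (?f' \<circ> ?C)" by fact
    show "path (cnj \<circ> (?f \<circ> ?C))" by (rule path_continuous_image[OF pth(1)]) (intro continuous_intros)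
    show "pathfinish (?f' \<circ> ?C) = pathstart (?f' \<circ> ?C)" "pathfinish (cnj \<circ> (?f \<circ> ?C)) = pathstart (cnj \<circ> (?f \<circ> ?C))"
      by (simp_all add: pathfinish_compose pathstart_compose)
    fix t :: real assume "t \<in> {0..1}"
    from pt[OF this] refl show "closed_segment ((?f' \<circ> ?C) t) ((cnj \<circ> (?f \<circ> ?C)) t) \<subseteq> - {0}"
      by (metis comp_apply subset_Compl_singleton)
  qed
  also have "\<dots> = - 1"
    using winding_number_cnj[OF pth(1) nz] wn by simp
  finally show False using wn by simp
qed

section \<open>Flat discs: recentring, shrinking and moving along the curve\<close>

lemma flat_disc_on_path: "flat_disc A c t D \<zeta> \<Longrightarrow> y \<in> D \<Longrightarrow> y \<in> path_image c \<longleftrightarrow> Im (\<zeta> y) = 0"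
  by (auto simp: flat_disc_def)

lemma flat_disc_sgn:
  "flat_disc A c t D \<zeta> \<Longrightarrow> s \<in> {0..1} \<Longrightarrow> c s \<in> D \<Longrightarrow> sgn (Re (\<zeta> (c s))) = sgn (s - t)"
  by (simp add: flat_disc_def)

lemma flat_disc_centre:
  assumes "flat_disc A c t D \<zeta>" "t \<in> {0..1}"
  shows "\<zeta> (c t) = 0" "c t \<in> D"
proof -
  have "c t \<in> D \<inter> path_image c" using assms by (auto simp: flat_disc_def path_image_def)
  then have "Im (\<zeta> (c t)) = 0" using assms(1) unfolding flat_disc_def by blast
  moreover have "sgn (Re (\<zeta> (c t))) = sgn (t - t)" using assms unfolding flat_disc_def by blast
  then have "sgn (Re (\<zeta> (c t))) = 0" by simp
  ultimately show "\<zeta> (c t) = 0" by (simp add: complex_eq_iff sgn_zero_iff)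
  show "c t \<in> D" using assms by (simp add: flat_disc_def)
qed

lemma flat_disc_homeo:
  assumes "flat_disc A c t D \<zeta>"
  obtains \<psi> where "homeomorphism D (ball 0 1) \<zeta> \<psi>" "open D" "inj_on \<zeta> D"
proof -
  from assms obtain \<psi> where h: "homeomorphism D (ball 0 1) \<zeta> \<psi>" "open D"
    by (auto simp: flat_disc_def positive_chart_def)
  then have "inj_on \<zeta> D" by (metis homeomorphism_apply1 inj_onI)
  then show ?thesis using that h by blast
qed

lemma flat_disc_ball_subset:
  assumes f: "flat_disc A c t D \<zeta>" and "open O'" "y \<in> D" "y \<in> O'"
  obtains \<rho> where "\<rho> > 0" "ball (\<zeta> y) \<rho> \<subseteq> ball 0 1" "{z \<in> D. \<zeta> z \<in> ball (\<zeta> y) \<rho>} \<subseteq> O'"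
proof -
  obtain \<psi> where h: "homeomorphism D (ball 0 1) \<zeta> \<psi>" "open D" "inj_on \<zeta> D" using flat_disc_homeo f by blast
  have "openin (top_of_set (ball 0 1)) (\<zeta> ` (D \<inter> O'))"
    using homeomorphism_imp_open_map[OF h(1)] assms(2) by (metis openin_open_Int)
  then have "open (\<zeta> ` (D \<inter> O'))" using openin_open_eq[OF open_ball] by blast
  moreover have "\<zeta> y \<in> \<zeta> ` (D \<inter> O')" using assms by blast
  ultimately obtain \<rho> where r: "\<rho> > 0" "ball (\<zeta> y) \<rho> \<subseteq> \<zeta> ` (D \<inter> O')"
    using open_contains_ball by blast
  have "\<zeta> ` (D \<inter> O') \<subseteq> ball 0 1" using homeomorphism_image1[OF h(1)] by blast
  moreover have "{z \<in> D. \<zeta> z \<in> ball (\<zeta> y) \<rho>} \<subseteq> O'"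
  proof
    fix z assume z: "z \<in> {z \<in> D. \<zeta> z \<in> ball (\<zeta> y) \<rho>}"
    then obtain z' where "z' \<in> D \<inter> O'" "\<zeta> z = \<zeta> z'" using r(2) by blast
    then show "z \<in> O'" using inj_onD[OF h(3), of z z'] z by blast
  qed
  ultimately show ?thesis using that r by blast
qed

text \<open>The real diameter of the old chart contains the real diameter of any smaller ball
  centred on the curve. Only the direction of travel relative to the new centre needs a hypothesis,
  namely \<open>sg\<close>.\<close>

lemma flat_disc_subball:
  assumes A: "closed_oriented_surface A" and f: "flat_disc A c t D \<zeta>"
    and u: "u \<in> {0..1}" "c u \<in> D" and r: "\<rho> > 0" "ball (\<zeta> (c u)) \<rho> \<subseteq> ball 0 1"
    and sg: "\<And>s. s \<in> {0..1} \<Longrightarrow> c s \<in> D \<Longrightarrow> \<zeta> (c s) \<in> ball (\<zeta> (c u)) \<rho> \<Longrightarrow> sgn (Re (\<zeta> (c s)) - Re (\<zeta> (c u))) = sgn (s - u)"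
  shows "flat_disc A c u {z \<in> D. \<zeta> z \<in> ball (\<zeta> (c u)) \<rho>} (\<lambda>y. of_real (1 / \<rho>) * (\<zeta> y - \<zeta> (c u)))"
proof -
  let ?D = "{z \<in> D. \<zeta> z \<in> ball (\<zeta> (c u)) \<rho>}" and ?z = "\<lambda>y. complex_of_real (1 / \<rho>) * (\<zeta> y - \<zeta> (c u))"
  obtain \<psi> where h: "homeomorphism D (ball 0 1) \<zeta> \<psi>" "open D" "inj_on \<zeta> D" using flat_disc_homeo f by blast
  have pc: "positive_chart A D \<zeta>" and im: "D \<inter> path_image c = {y \<in> D. Im (\<zeta> y) = 0}"
    using f by (auto simp: flat_disc_def)
  have i0: "Im (\<zeta> (c u)) = 0" using im u by (auto simp: path_image_def)
  have "?D = D \<inter> \<zeta> -` ball (\<zeta> (c u)) \<rho>" by auto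
  moreover have "open (D \<inter> \<zeta> -` ball (\<zeta> (c u)) \<rho>)"
    using continuous_on_open_vimage[OF h(2)] homeomorphism_cont1[OF h(1)] by (metis inf_commute open_ball)
  ultimately have oD: "open ?D" by simp
  have 1: "positive_chart A ?D ?z"
    using positive_chart_affine[OF A pc oD, of "of_real (1/\<rho>)" "\<zeta> (c u)"] r by auto
  have 2: "?z ` ?D = ball 0 1"
  proof
    show "?z ` ?D \<subseteq> ball 0 1"
      using r by (auto simp: dist_norm norm_mult norm_divide divide_simps norm_minus_commute)
    show "ball 0 1 \<subseteq> ?z ` ?D"
    proof
      fix w :: complex assume w: "w \<in> ball 0 1"
      let ?v = "of_real \<rho> * w + \<zeta> (c u)"
      have v: "?v \<in> ball (\<zeta> (c u)) \<rho>" using w r by (simp add: dist_norm norm_mult)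
      then have "?v \<in> \<zeta> ` D" using r homeomorphism_image1[OF h(1)] by blast
      then obtain y where "y \<in> D" "\<zeta> y = ?v" by auto
      then show "w \<in> ?z ` ?D" using v r by (intro image_eqI[of _ _ y]) auto
    qed
  qed
  have 3: "c u \<in> ?D" using u r by simp
  have 4: "?D \<inter> path_image c = {y \<in> ?D. Im (?z y) = 0}" using im i0 r by auto
  have 5: "sgn (Re (?z (c s))) = sgn (s - u)" if "s \<in> {0..1}" "c s \<in> ?D" for s
    using sg[of s] that r by (simp add: sgn_mult)
  show ?thesis unfolding flat_disc_def using 1 2 3 4 5 by blast
qed

lemma flat_disc_shrink:
  assumes A: "closed_oriented_surface A" and f: "flat_disc A c t D \<zeta>" and t: "t \<in> {0..1}"
    and r: "0 < \<rho>" "\<rho> \<le> 1"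
  shows "flat_disc A c t {z \<in> D. norm (\<zeta> z) < \<rho>} (\<lambda>y. of_real (1 / \<rho>) * \<zeta> y)"
proof -
  have "flat_disc A c t {z \<in> D. \<zeta> z \<in> ball (\<zeta> (c t)) \<rho>} (\<lambda>y. of_real (1 / \<rho>) * (\<zeta> y - \<zeta> (c t)))"
    using f t r flat_disc_centre[OF f t] by (intro flat_disc_subball[OF A f]) (auto simp: flat_disc_def)
  then show ?thesis using flat_disc_centre[OF f t] by simp
qed

lemma flat_disc_shrink_into:
  assumes A: "closed_oriented_surface A" and f: "flat_disc A c t D \<zeta>" and t: "t \<in> {0..1}"
    and O: "open O'" "c t \<in> O'"
  obtains \<rho> where "0 < \<rho>" "\<rho> \<le> 1" "{z \<in> D. norm (\<zeta> z) < \<rho>} \<subseteq> O'"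
proof -
  obtain \<rho> where r: "\<rho> > 0" "{z \<in> D. \<zeta> z \<in> ball (\<zeta> (c t)) \<rho>} \<subseteq> O'"
    using flat_disc_ball_subset[OF f O(1) flat_disc_centre(2)[OF f t] O(2)] by metis
  show ?thesis using that[of "min \<rho> 1"] r flat_disc_centre[OF f t] by auto
qed

lemma simple_path_inner_unique:
  assumes "simple_path \<gamma>" "0 < t" "t < 1" "s \<in> {0..1}" "\<gamma> s = \<gamma> t"
  shows "s = t"
  using assms unfolding simple_path_def loop_free_def by force

text \<open>One flat disc at \<open>t\<close> supplies arbitrarily small flat discs at all nearby
  times, with charts that differ from \<zeta> by a translation and a positive factor. Hence a point
  is above the diameter in the new chart iff it is in the old one, which makes sides locally
  constant.\<close>

lemma flat_disc_move:
  assumes A: "closed_oriented_surface A" and sp: "simple_path \<gamma>" and t: "0 < t" "t < 1"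
    and f: "flat_disc A \<gamma> t D \<zeta>"
  shows "\<exists>\<delta>>0. \<forall>u. \<bar>u - t\<bar> < \<delta> \<longrightarrow> 0 < u \<and> u < 1 \<and> \<gamma> u \<in> D \<and> Im (\<zeta> (\<gamma> u)) = 0 \<and>
    (\<forall>O'. open O' \<longrightarrow> \<gamma> u \<in> O' \<longrightarrow>
      (\<exists>\<rho>>0. flat_disc A \<gamma> u {z \<in> D. \<zeta> z \<in> ball (\<zeta> (\<gamma> u)) \<rho>} (\<lambda>y. of_real (1 / \<rho>) * (\<zeta> y - \<zeta> (\<gamma> u))) \<and>
        {z \<in> D. \<zeta> z \<in> ball (\<zeta> (\<gamma> u)) \<rho>} \<subseteq> O'))"
proof -
  obtain \<psi> where h: "homeomorphism D (ball 0 1) \<zeta> \<psi>" "open D" "inj_on \<zeta> D" using flat_disc_homeo f by blast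
  have im: "D \<inter> path_image \<gamma> = {y \<in> D. Im (\<zeta> y) = 0}"
    and sg: "\<And>s. s \<in> {0..1} \<Longrightarrow> \<gamma> s \<in> D \<Longrightarrow> sgn (Re (\<zeta> (\<gamma> s))) = sgn (s - t)"
    and tD: "\<gamma> t \<in> D"
    using f by (auto simp: flat_disc_def)
  have cont: "continuous_on {0..1} \<gamma>" using sp by (simp add: simple_path_def path_def)
  have "continuous_on {0<..<1} \<gamma>" using cont by (rule continuous_on_subset) auto
  then have "open (\<gamma> -` D \<inter> {0<..<1})" using h(2) by (simp add: continuous_on_open_vimage)
  then have "open ({0<..<1} \<inter> \<gamma> -` D)" by (simp add: Int_commute)
  moreover have "t \<in> {0<..<1} \<inter> \<gamma> -` D" using t tD by auto
  ultimately obtain e where e: "e > 0" "cball t e \<subseteq> {0<..<1} \<inter> \<gamma> -` D"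
    by (meson open_contains_cball)
  define J where "J = {t - e..t + e}"
  have J: "J \<subseteq> {0<..<1}" "\<And>u. u \<in> J \<Longrightarrow> \<gamma> u \<in> D"
    using e by (auto simp: J_def cball_eq_atLeastAtMost)
  define f' where "f' = (\<lambda>u. Re (\<zeta> (\<gamma> u)))"
  have imJ: "Im (\<zeta> (\<gamma> u)) = 0" if "u \<in> J" for u
    using im J that by (force simp: path_image_def)
  have J01: "J \<subseteq> {0..1}" using J(1) by force
  have "continuous_on J (\<zeta> \<circ> \<gamma>)"
  proof (rule continuous_on_compose)
    show "continuous_on J \<gamma>" using cont J01 continuous_on_subset by blast
    show "continuous_on (\<gamma> ` J) \<zeta>" using homeomorphism_cont1[OF h(1)] J(2) by (metis continuous_on_subset image_subsetI)
  qed
  then have contf: "continuous_on J f'" unfolding f'_def by (auto intro!: continuous_intros simp: o_def)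
  have injf: "inj_on f' J"
  proof (rule inj_onI)
    fix u v assume uv: "u \<in> J" "v \<in> J" "f' u = f' v"
    then have "\<zeta> (\<gamma> u) = \<zeta> (\<gamma> v)" using imJ by (simp add: complex_eq_iff f'_def)
    then have "\<gamma> u = \<gamma> v" using h(3) J(2) uv by (meson inj_onD)
    then show "u = v" using simple_path_inner_unique[OF sp, of v u] uv J(1) J01 by force
  qed
  have "f' t = 0" using sg[of t] t tD by (simp add: f'_def sgn_zero_iff)
  moreover have "f' (t + e) > 0"
    using sg[of "t + e"] J J01 e by (auto simp: f'_def J_def sgn_if split: if_splits)
  moreover have "t \<in> J" "t + e \<in> J" using e by (auto simp: J_def)
  moreover have "is_interval J" by (simp add: J_def is_interval_cc)
  ultimately have f0: "f' t = 0" "f' (t + e) > 0" "t \<in> J" "t + e \<in> J" and iJ: "is_interval J" by auto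
  \<comment> \<open>An injective continuous real function on an interval is strictly monotone;
    comparing \<open>t\<close> with \<open>t + e\<close> then fixes the direction.\<close>
  have "strict_mono_on J f' \<or> strict_antimono_on J f'"
    using injective_eq_monotone_map[OF iJ contf] injf by blast
  moreover have "\<not> strict_antimono_on J f'"
  proof
    assume "strict_antimono_on J f'"
    then have "f' (t + e) < f' t" using f0(3,4) e(1) by (auto dest: monotone_onD[where x = t and y = "t + e"])
    then show False using f0 by simp
  qed
  ultimately have mono: "strict_mono_on J f'" by blast
  show ?thesis
  proof (rule exI[of _ e], intro conjI allI impI)
    show "e > 0" by fact
    show "0 < u" "u < 1" "\<gamma> u \<in> D" "Im (\<zeta> (\<gamma> u)) = 0" if "\<bar>u - t\<bar> < e" for u
    proof -
      have "u \<in> J" using that by (auto simp: J_def)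
      then show "0 < u" "u < 1" "\<gamma> u \<in> D" "Im (\<zeta> (\<gamma> u)) = 0" using J imJ by auto
    qed
  next
    fix u O' assume u: "\<bar>u - t\<bar> < e" and O: "open O'" "\<gamma> u \<in> O'"
    have uJ: "u \<in> J" using u by (auto simp: J_def)
    \<comment> \<open>Monotonicity is known for times close to \<open>t\<close> only. The rest of
      the curve is compact and misses \<gamma> \<open>u\<close>, so the ball can be chosen to avoid
      it.\<close>
    let ?K = "\<gamma> ` ({0..1} - {t - e<..<t + e})"
    have "compact ({0..1} - {t - e<..<t + e})" by (intro compact_diff) auto
    then have "closed ?K"
      using cont by (intro compact_imp_closed compact_continuous_image) (auto intro: continuous_on_subset)
    moreover have "\<gamma> u \<notin> ?K"
    proof
      assume "\<gamma> u \<in> ?K"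
      then obtain s where s: "s \<in> {0..1}" "s \<notin> {t - e<..<t + e}" "\<gamma> s = \<gamma> u" by auto
      then have "s = u" using simple_path_inner_unique[OF sp, of u s] uJ J(1) by force
      then show False using s u by auto
    qed
    ultimately have oK: "open (O' - ?K)" "\<gamma> u \<in> O' - ?K" using O by auto
    obtain \<rho> where r: "\<rho> > 0" "ball (\<zeta> (\<gamma> u)) \<rho> \<subseteq> ball 0 1" "{z \<in> D. \<zeta> z \<in> ball (\<zeta> (\<gamma> u)) \<rho>} \<subseteq> O' - ?K"
      by (rule flat_disc_ball_subset[OF f oK(1) J(2)[OF uJ] oK(2)])
    have "flat_disc A \<gamma> u {z \<in> D. \<zeta> z \<in> ball (\<zeta> (\<gamma> u)) \<rho>} (\<lambda>y. of_real (1 / \<rho>) * (\<zeta> y - \<zeta> (\<gamma> u)))"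
    proof (rule flat_disc_subball[OF A f _ _ r(1,2)])
      show "u \<in> {0..1}" "\<gamma> u \<in> D" using uJ J J01 by auto
      fix s assume s: "s \<in> {0..1}" "\<gamma> s \<in> D" "\<zeta> (\<gamma> s) \<in> ball (\<zeta> (\<gamma> u)) \<rho>"
      then have "\<gamma> s \<notin> ?K" using r(3) by blast
      then have "s \<in> {t - e<..<t + e}" using s(1) by blast
      then have sJ: "s \<in> J" by (simp add: J_def)
      have "sgn (f' s - f' u) = sgn (s - u)"
        using strict_mono_onD[OF mono sJ uJ] strict_mono_onD[OF mono uJ sJ]
        by (cases s u rule: linorder_cases) (auto simp: sgn_if)
      then show "sgn (Re (\<zeta> (\<gamma> s)) - Re (\<zeta> (\<gamma> u))) = sgn (s - u)" by (simp add: f'_def)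
    qed
    then show "\<exists>\<rho>>0. flat_disc A \<gamma> u {z \<in> D. \<zeta> z \<in> ball (\<zeta> (\<gamma> u)) \<rho>} (\<lambda>y. of_real (1 / \<rho>) * (\<zeta> y - \<zeta> (\<gamma> u))) \<and>
        {z \<in> D. \<zeta> z \<in> ball (\<zeta> (\<gamma> u)) \<rho>} \<subseteq> O'" using r by blast
  qed
qed

lemma flat_disc_half_connected:
  assumes "flat_disc A c t D \<zeta>"
  shows "connected {y \<in> D. 0 < \<sigma> * Im (\<zeta> y)}"
proof -
  obtain \<psi> where h: "homeomorphism D (ball 0 1) \<zeta> \<psi>" using flat_disc_homeo assms by blast
  have "{y \<in> D. 0 < \<sigma> * Im (\<zeta> y)} = \<psi> ` (ball 0 1 \<inter> {w. 0 < \<sigma> * Im w})" (is "_ = \<psi> ` ?S")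
  proof (intro set_eqI iffI)
    fix y assume y: "y \<in> {y \<in> D. 0 < \<sigma> * Im (\<zeta> y)}"
    then have "\<zeta> y \<in> ?S" using homeomorphism_image1[OF h] by auto
    moreover have "\<psi> (\<zeta> y) = y" using homeomorphism_apply1[OF h] y by simp
    ultimately show "y \<in> \<psi> ` ?S" by force
  next
    fix y assume "y \<in> \<psi> ` ?S"
    then obtain w where w: "w \<in> ?S" "y = \<psi> w" by auto
    then have "\<zeta> y = w" "y \<in> D" using homeomorphism_apply2[OF h] homeomorphism_image2[OF h] by auto
    then show "y \<in> {y \<in> D. 0 < \<sigma> * Im (\<zeta> y)}" using w by simp
  qed
  moreover have "convex ?S"
  proof -
    have "{w. 0 < \<sigma> * Im w} = {w. inner (of_real \<sigma> * \<i>) w > 0}"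
      by (auto simp: inner_complex_def)
    then show ?thesis by (simp add: convex_Int convex_halfspace_gt)
  qed
  moreover have "continuous_on ?S \<psi>"
    using homeomorphism_cont2[OF h] continuous_on_subset by blast
  ultimately show ?thesis by (simp add: connected_continuous_image convex_connected)
qed

section \<open>Left and right sides of a curve\<close>

text \<open>\<open>\<sigma> = 1\<close> is the left side of \<open>c\<close>, \<open>\<sigma> = - 1\<close> the right side.\<close>

definition side :: "('a::t2_space set \<times> ('a \<Rightarrow> complex)) set \<Rightarrow> (real \<Rightarrow> 'a) \<Rightarrow> real \<Rightarrow> real \<Rightarrow> 'a set \<Rightarrow> bool" where
  "side A c t \<sigma> S \<longleftrightarrow> (\<exists>D \<zeta>. flat_disc A c t D \<zeta> \<and> {y \<in> D. 0 < \<sigma> * Im (\<zeta> y)} \<subseteq> S)"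

lemma lies_left_side: "lies_left A S c \<longleftrightarrow> (\<forall>t \<in> {0<..<1}. side A c t 1 S)"
  by (simp add: lies_left_def side_def)

lemma side_mono: "side A c t \<sigma> S \<Longrightarrow> S \<subseteq> S' \<Longrightarrow> side A c t \<sigma> S'"
  unfolding side_def by blast

lemma flat_disc_reverse:
  assumes A: "closed_oriented_surface A" and f: "flat_disc A c t D \<zeta>"
  shows "flat_disc A (reversepath c) (1 - t) D (\<lambda>y. - \<zeta> y)"
proof -
  have pc: "positive_chart A D \<zeta>" and o: "open D" using f by (auto simp: flat_disc_def positive_chart_def)
  have "positive_chart A D (\<lambda>y. - \<zeta> y)" using positive_chart_affine[OF A pc o, of "-1" 0] by simp
  moreover have "(\<lambda>y. - \<zeta> y) ` D = ball 0 1"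
  proof -
    have "(\<lambda>y. - \<zeta> y) ` D = uminus ` ball 0 1" using f by (auto simp: flat_disc_def image_image[symmetric])
    moreover have "uminus ` ball 0 1 = ball (0 :: complex) 1"
    proof (intro set_eqI iffI)
      fix w :: complex assume "w \<in> ball 0 1"
      then show "w \<in> uminus ` ball 0 1" by (intro image_eqI[of _ _ "- w"]) auto
    qed auto
    ultimately show ?thesis by simp
  qed
  moreover have "sgn (Re (- \<zeta> (reversepath c s))) = sgn (s - (1 - t))" if "s \<in> {0..1}" "reversepath c s \<in> D" for s
  proof -
    have "sgn (Re (\<zeta> (c (1 - s)))) = sgn (1 - s - t)" using flat_disc_sgn[OF f, of "1 - s"] that by (auto simp: reversepath_def)
    then show ?thesis by (auto simp: sgn_if reversepath_def split: if_splits)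
  qed
  moreover have "D \<inter> path_image (reversepath c) = {y \<in> D. Im (- \<zeta> y) = 0}"
    using flat_disc_on_path[OF f] by auto
  moreover have "reversepath c (1 - t) \<in> D" using f by (simp add: flat_disc_def reversepath_def)
  ultimately show ?thesis unfolding flat_disc_def by blast
qed

lemma side_reverse:
  assumes A: "closed_oriented_surface A" and "side A c t \<sigma> S"
  shows "side A (reversepath c) (1 - t) (- \<sigma>) S"
  using assms flat_disc_reverse[OF A] unfolding side_def by fastforce

text \<open>This is the test for the segment hypothesis of
  \<open>positive_charts_not_reflected\<close>: both points lie in the same open half-plane, or on
  the same open half of the real axis.\<close>

lemma not_in_closed_segment_0:
  fixes a b :: complex
  assumes "\<sigma> * Im a > 0 \<and> \<sigma> * Im b > 0 \<or> Im a = 0 \<and> Im b = 0 \<and> sgn (Re a) = sgn (Re b) \<and> Re a \<noteq> 0"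
  shows "0 \<notin> closed_segment a b"
proof
  assume "0 \<in> closed_segment a b"
  then obtain u where u: "0 \<le> u" "u \<le> 1" "0 = (1 - u) *\<^sub>R a + u *\<^sub>R b" by (auto simp: in_segment)
  have pos: "(1 - u) * x + u * y > 0" if "x > 0" "y > 0" for x y :: real
  proof (cases "u = 1")
    case False
    then have "(1 - u) * x > 0" "u * y \<ge> 0" using that u by auto
    then show ?thesis by linarith
  qed (use that in simp)
  from u have e: "(1 - u) * Im a + u * Im b = 0" "(1 - u) * Re a + u * Re b = 0"
    by (metis plus_complex.simps scaleR_complex.simps zero_complex.simps)+
  have "(1 - u) * (\<sigma> * Im a) + u * (\<sigma> * Im b) = \<sigma> * ((1 - u) * Im a + u * Im b)"
    "(1 - u) * (- Re a) + u * (- Re b) = - ((1 - u) * Re a + u * Re b)"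
    by (simp_all add: algebra_simps)
  then have e': "(1 - u) * (\<sigma> * Im a) + u * (\<sigma> * Im b) = 0" "(1 - u) * (- Re a) + u * (- Re b) = 0"
    using e by simp_all
  show False using assms pos[of "\<sigma> * Im a" "\<sigma> * Im b"] pos[of "Re a" "Re b"] pos[of "- Re a" "- Re b"] e e'
    by (auto simp: sgn_if split: if_splits)
qed

text \<open>The left side is intrinsic. If two flat discs disagreed about it, the transition map
  would send the upper half-disc to the lower half-plane while keeping the direction of the curve,
  and orientation or openness is violated.\<close>

lemma side_left_meet:
  assumes A: "closed_oriented_surface A" and t: "t \<in> {0..1}"
    and s: "side A c t 1 S" "side A c t 1 S'"
  shows "S \<inter> S' \<noteq> {}"
proof
  assume dis: "S \<inter> S' = {}"
  obtain D \<zeta> where f: "flat_disc A c t D \<zeta>" and S: "{y \<in> D. 0 < Im (\<zeta> y)} \<subseteq> S"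
    using s(1) by (auto simp: side_def)
  obtain D' \<zeta>' where f': "flat_disc A c t D' \<zeta>'" and S': "{y \<in> D'. 0 < Im (\<zeta>' y)} \<subseteq> S'"
    using s(2) by (auto simp: side_def)
  have o': "open D'" using f' flat_disc_homeo by blast
  obtain \<rho> where r: "0 < \<rho>" "\<rho> \<le> 1" "{z \<in> D. norm (\<zeta> z) < \<rho>} \<subseteq> D'"
    using flat_disc_shrink_into[OF A f t o' flat_disc_centre(2)[OF f' t]] by blast
  define D1 where "D1 = {z \<in> D. norm (\<zeta> z) < \<rho>}"
  define z1 where "z1 = (\<lambda>y. of_real (1 / \<rho>) * \<zeta> y)"
  have f1: "flat_disc A c t D1 z1" unfolding D1_def z1_def by (rule flat_disc_shrink[OF A f t r(1,2)])
  have S1: "{y \<in> D1. 0 < Im (z1 y)} \<subseteq> S" using S r by (auto simp: D1_def z1_def zero_less_divide_iff)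
  have D1: "D1 \<subseteq> D'" using r by (simp add: D1_def)
  obtain \<psi> where h: "homeomorphism D1 (ball 0 1) z1 \<psi>" "open D1" "inj_on z1 D1" using flat_disc_homeo f1 by blast
  obtain \<psi>' where h': "homeomorphism D' (ball 0 1) \<zeta>' \<psi>'" "inj_on \<zeta>' D'" using flat_disc_homeo f' by blast
  have Im0: "Im (\<zeta>' y) = 0 \<longleftrightarrow> Im (z1 y) = 0" if "y \<in> D1" for y
    using flat_disc_on_path[OF f1 that] flat_disc_on_path[OF f', of y] that D1 by blast
  have signconst: "(\<forall>y \<in> D1. 0 < \<sigma> * Im (z1 y) \<longrightarrow> Im (\<zeta>' y) > 0) \<or> (\<forall>y \<in> D1. 0 < \<sigma> * Im (z1 y) \<longrightarrow> Im (\<zeta>' y) < 0)" for \<sigma> :: real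
  proof -
    let ?H = "{y \<in> D1. 0 < \<sigma> * Im (z1 y)}"
    have "connected ((\<lambda>y. Im (\<zeta>' y)) ` ?H)"
    proof (rule connected_continuous_image[OF _ flat_disc_half_connected[OF f1]])
      have "continuous_on ?H \<zeta>'" using homeomorphism_cont1[OF h'(1)] D1 by (rule_tac continuous_on_subset) auto
      then show "continuous_on ?H (\<lambda>y. Im (\<zeta>' y))" by (intro continuous_intros)
    qed
    moreover have "0 \<notin> (\<lambda>y. Im (\<zeta>' y)) ` ?H" using Im0 by fastforce
    ultimately have cn: "connected ((\<lambda>y. Im (\<zeta>' y)) ` ?H)" "0 \<notin> (\<lambda>y. Im (\<zeta>' y)) ` ?H" by auto
    have same: "\<not> (a < 0 \<and> 0 < b)" if "a \<in> (\<lambda>y. Im (\<zeta>' y)) ` ?H" "b \<in> (\<lambda>y. Im (\<zeta>' y)) ` ?H" for a b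
      using connectedD_interval[OF cn(1) that, of 0] cn(2) by linarith
    show ?thesis
    proof (rule ccontr)
      assume "\<not> ?thesis"
      then obtain a b where ab: "a \<in> ?H" "b \<in> ?H" "\<not> Im (\<zeta>' a) > 0" "\<not> Im (\<zeta>' b) < 0" by auto
      moreover have "Im (\<zeta>' a) \<noteq> 0" "Im (\<zeta>' b) \<noteq> 0" using ab(1,2) Im0 by auto
      ultimately have "Im (\<zeta>' a) < 0" "Im (\<zeta>' b) > 0" by auto
      then show False using same[of "Im (\<zeta>' a)" "Im (\<zeta>' b)"] ab(1,2) by blast
    qed
  qed
  obtain y0 where y0: "y0 \<in> D1" "z1 y0 = \<i> / 2"
  proof -
    have "\<i> / 2 \<in> ball (0 :: complex) 1" by (simp add: norm_divide)
    then have "\<i> / 2 \<in> z1 ` D1" using homeomorphism_image1[OF h(1)] by simp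
    then show ?thesis using that by auto
  qed
  have "Im (z1 y0) > 0" by (subst y0(2)) simp
  have "\<not> Im (\<zeta>' y0) > 0" using \<open>Im (z1 y0) > 0\<close> S1 S' dis D1 y0(1) by blast
  then have up: "Im (\<zeta>' y) < 0" if "y \<in> D1" "Im (z1 y) > 0" for y
    using signconst[of 1] y0(1) \<open>Im (z1 y0) > 0\<close> that by auto
  \<comment> \<open>If the lower half goes up, the two charts are conjugate up to a linear homotopy
    and the winding numbers clash. If it goes down as well, the image of \<open>D1\<close> lies in
    the closed lower half-plane although it is an open set containing 0.\<close>
  show False
  proof (cases "\<forall>y \<in> D1. Im (z1 y) < 0 \<longrightarrow> Im (\<zeta>' y) > 0")
    case True
    show False
    proof (rule positive_charts_not_reflected[OF A, of D1 z1 D' \<zeta>' "c t" D1])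
      show "positive_chart A D1 z1" "positive_chart A D' \<zeta>'" using f1 f' by (auto simp: flat_disc_def)
      show "c t \<in> D1" "c t \<in> D'" "z1 (c t) = 0" "\<zeta>' (c t) = 0" "c t \<in> D1"
        using flat_disc_centre[OF f1 t] flat_disc_centre[OF f' t] by auto
      show "open D1" "D1 \<subseteq> D1 \<inter> D'" using h D1 by auto
      fix y assume y: "y \<in> D1 - {c t}"
      consider "Im (z1 y) > 0" | "Im (z1 y) < 0" | "Im (z1 y) = 0" by linarith
      then show "0 \<notin> closed_segment (\<zeta>' y) (cnj (z1 y))"
      proof cases
        case 1 then show ?thesis using up y by (intro not_in_closed_segment_0[of "-1"]) auto
      next
        case 2 then show ?thesis using True y by (intro not_in_closed_segment_0[of "1"]) auto
      next
        case 3
        then have "y \<in> path_image c" using flat_disc_on_path[OF f1] y by blast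
        then obtain s where s: "s \<in> {0..1}" "y = c s" by (auto simp: path_image_def)
        have "sgn (Re (z1 y)) = sgn (s - t)" "sgn (Re (\<zeta>' y)) = sgn (s - t)"
          using flat_disc_sgn[OF f1 s(1)] flat_disc_sgn[OF f' s(1)] s y D1 by auto
        moreover from this have "Re (\<zeta>' y) \<noteq> 0" using s y by (auto simp: sgn_zero_iff)
        ultimately show ?thesis using 3 Im0[of y] y
          by (intro not_in_closed_segment_0[of 0]) auto
      qed
    qed
  next
    case False
    then have down: "Im (\<zeta>' y) < 0" if "y \<in> D1" "Im (z1 y) < 0" for y
      using signconst[of "-1"] that by auto
    have le: "Im w \<le> 0" if "w \<in> \<zeta>' ` D1" for w
    proof -
      from that obtain y where y: "y \<in> D1" "w = \<zeta>' y" by auto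
      consider "Im (z1 y) > 0" | "Im (z1 y) < 0" | "Im (z1 y) = 0" by linarith
      then show ?thesis using up[OF y(1)] down[OF y(1)] Im0[OF y(1)] y(2) by cases auto
    qed
    have "openin (top_of_set (ball 0 1)) (\<zeta>' ` D1)"
      using homeomorphism_imp_open_map[OF h'(1)] D1 h(2) by (metis inf.absorb2 openin_open_Int)
    then have "open (\<zeta>' ` D1)" using openin_open_eq[OF open_ball] by blast
    moreover have "0 \<in> \<zeta>' ` D1" using flat_disc_centre[OF f1 t] flat_disc_centre[OF f' t] by (metis image_eqI)
    ultimately obtain e where e: "e > 0" "ball 0 e \<subseteq> \<zeta>' ` D1" by (meson open_contains_ball)
    have "\<i> * of_real (e / 2) \<in> ball 0 e" using e by (simp add: norm_mult)
    then have "Im (\<i> * of_real (e / 2)) \<le> 0" using e le by blast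
    then show False using e by simp
  qed
qed

lemma side_meet:
  assumes A: "closed_oriented_surface A" and t: "t \<in> {0..1}" and \<sigma>: "\<sigma> \<in> {1, -1}"
    and s: "side A c t \<sigma> S" "side A c t \<sigma> S'"
  shows "S \<inter> S' \<noteq> {}"
proof (cases "\<sigma> = 1")
  case True then show ?thesis using side_left_meet[OF A t] s by blast
next
  case False
  then have "\<sigma> = -1" using \<sigma> by simp
  then show ?thesis using side_reverse[OF A s(1)] side_reverse[OF A s(2)] t
     side_left_meet[OF A, of "1 - t" "reversepath c"] by auto
qed

lemma side_small:
  assumes A: "closed_oriented_surface A" and t: "t \<in> {0..1}" and s: "side A c t \<sigma> S"
    and O: "open O'" "c t \<in> O'"
  shows "side A c t \<sigma> (S \<inter> O')"
proof -
  obtain D \<zeta> where f: "flat_disc A c t D \<zeta>" and S: "{y \<in> D. 0 < \<sigma> * Im (\<zeta> y)} \<subseteq> S"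
    using s(1) by (auto simp: side_def)
  obtain \<rho> where r: "0 < \<rho>" "\<rho> \<le> 1" "{z \<in> D. norm (\<zeta> z) < \<rho>} \<subseteq> O'"
    using flat_disc_shrink_into[OF A f t O] by blast
  have "flat_disc A c t {z \<in> D. norm (\<zeta> z) < \<rho>} (\<lambda>y. of_real (1 / \<rho>) * \<zeta> y)"
    using flat_disc_shrink[OF A f t r(1,2)] .
  moreover have "{y \<in> {z \<in> D. norm (\<zeta> z) < \<rho>}. 0 < \<sigma> * Im (of_real (1 / \<rho>) * \<zeta> y)} \<subseteq> S \<inter> O'"
    using S r by (auto simp: zero_less_divide_iff)
  ultimately show ?thesis unfolding side_def by blast
qed

lemma side_open:
  assumes A: "closed_oriented_surface A" and sp: "simple_path c" and t: "0 < t" "t < 1" and s: "side A c t \<sigma> S"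
  shows "\<exists>\<delta>>0. \<forall>u. \<bar>u - t\<bar> < \<delta> \<longrightarrow> side A c u \<sigma> S"
proof -
  obtain D \<zeta> where f: "flat_disc A c t D \<zeta>" and S: "{y \<in> D. 0 < \<sigma> * Im (\<zeta> y)} \<subseteq> S"
    using s(1) by (auto simp: side_def)
  have "side A c u \<sigma> S" if i: "Im (\<zeta> (c u)) = 0" and
    u: "\<forall>O'. open O' \<longrightarrow> c u \<in> O' \<longrightarrow>
      (\<exists>\<rho>>0. flat_disc A c u {z \<in> D. \<zeta> z \<in> ball (\<zeta> (c u)) \<rho>} (\<lambda>y. of_real (1 / \<rho>) * (\<zeta> y - \<zeta> (c u))) \<and>
        {z \<in> D. \<zeta> z \<in> ball (\<zeta> (c u)) \<rho>} \<subseteq> O')" for u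
  proof -
    obtain \<rho> where "\<rho> > 0" and f': "flat_disc A c u {z \<in> D. \<zeta> z \<in> ball (\<zeta> (c u)) \<rho>} (\<lambda>y. of_real (1 / \<rho>) * (\<zeta> y - \<zeta> (c u)))"
      using u open_UNIV by blast
    moreover have "{y \<in> {z \<in> D. \<zeta> z \<in> ball (\<zeta> (c u)) \<rho>}. 0 < \<sigma> * Im (of_real (1 / \<rho>) * (\<zeta> y - \<zeta> (c u)))} \<subseteq> S"
      using S i \<open>\<rho> > 0\<close> by (auto simp: zero_less_divide_iff)
    ultimately show ?thesis unfolding side_def by blast
  qed
  then show ?thesis using flat_disc_move[OF A sp t f] by meson
qed

text \<open>The times at which the side lies in \<open>S\<close> and those at which it lies in
  \<open>S'\<close> form open sets by \<open>side_open\<close>, and these are disjoint by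
  \<open>side_meet\<close>. The connected set \<open>J\<close> cannot meet both.\<close>

lemma side_const:
  assumes A: "closed_oriented_surface A" and sp: "simple_path c" and J: "connected J" "J \<subseteq> {0<..<1}" and \<sigma>: "\<sigma> \<in> {1, -1}"
    and d: "S \<inter> S' = {}" and all: "\<And>t. t \<in> J \<Longrightarrow> side A c t \<sigma> S \<or> side A c t \<sigma> S'"
    and t: "t \<in> J" "side A c t \<sigma> S" and u: "u \<in> J"
  shows "side A c u \<sigma> S"
proof (rule ccontr)
  assume n: "\<not> side A c u \<sigma> S"
  have op: "open {t \<in> {0<..<1}. side A c t \<sigma> T}" for T
    unfolding open_dist
  proof
    fix x assume "x \<in> {t \<in> {0<..<1}. side A c t \<sigma> T}"
    then have x: "0 < x" "x < 1" "side A c x \<sigma> T" by auto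
    obtain \<delta> where "\<delta> > 0" "\<forall>u. \<bar>u - x\<bar> < \<delta> \<longrightarrow> side A c u \<sigma> T" using side_open[OF A sp x] by blast
    then show "\<exists>e>0. \<forall>y. dist y x < e \<longrightarrow> y \<in> {t \<in> {0<..<1}. side A c t \<sigma> T}"
      using x by (intro exI[of _ "min \<delta> (min x (1 - x))"]) (auto simp: dist_real_def)
  qed
  let ?P = "{t \<in> {0<..<1}. side A c t \<sigma> S}" and ?P' = "{t \<in> {0<..<1}. side A c t \<sigma> S'}"
  have "?P \<inter> ?P' \<inter> J = {}"
    using side_meet[OF A _ \<sigma>, of _ c S S'] d by fastforce
  moreover have "J \<subseteq> ?P \<union> ?P'" using all J by auto
  moreover have "t \<in> ?P \<inter> J" "u \<in> ?P' \<inter> J"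
    using t u n all[OF u] subsetD[OF J(2) t(1)] subsetD[OF J(2) u] by auto
  ultimately show False using connectedD[OF J(1) op[of S] op[of S']] by blast
qed

section \<open>Regions along curves and at crossings\<close>

lemma surface_disc:
  fixes A :: "('a::t2_space set \<times> ('a \<Rightarrow> complex)) set" and p :: 'a
  assumes A: "closed_oriented_surface A" and O: "open O'" "p \<in> O'"
  obtains D and \<theta> :: "'a \<Rightarrow> complex" and \<psi> \<rho> where "open D" "p \<in> D" "D \<subseteq> O'" "\<rho> > 0" "homeomorphism D (ball (\<theta> p) \<rho>) \<theta> \<psi>"
proof -
  obtain W \<kappa> where W: "(W, \<kappa>) \<in> A" "p \<in> W"
    using A unfolding closed_oriented_surface_def by blast
  have "positive_chart A W \<kappa>" using A W by (auto simp: closed_oriented_surface_def)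
  then obtain \<psi> where h: "homeomorphism W (\<kappa> ` W) \<kappa> \<psi>" "open (\<kappa> ` W)" "open W"
    by (auto simp: positive_chart_def)
  have "openin (top_of_set (\<kappa> ` W)) (\<kappa> ` (W \<inter> O'))"
    using homeomorphism_imp_open_map[OF h(1)] O by (metis openin_open_Int)
  then have "open (\<kappa> ` (W \<inter> O'))" using openin_open_eq[OF h(2)] by blast
  moreover have "\<kappa> p \<in> \<kappa> ` (W \<inter> O')" using W O by blast
  ultimately obtain \<rho> where r: "\<rho> > 0" "ball (\<kappa> p) \<rho> \<subseteq> \<kappa> ` (W \<inter> O')"
    using open_contains_ball by blast
  let ?D = "\<psi> ` ball (\<kappa> p) \<rho>"
  have DW: "?D \<subseteq> W \<inter> O'"
    using r(2) homeomorphism_apply1[OF h(1)] by fastforce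
  have hs: "homeomorphism ?D (ball (\<kappa> p) \<rho>) \<kappa> \<psi>"
  proof -
    have "homeomorphism (ball (\<kappa> p) \<rho>) ?D \<psi> \<kappa>"
      using homeomorphism_of_subsets[OF homeomorphism_symD[OF h(1)], of "ball (\<kappa> p) \<rho>" "{}" ?D] r(2) by blast
    then show ?thesis by (rule homeomorphism_symD)
  qed
  have "openin (top_of_set (\<kappa> ` W)) (ball (\<kappa> p) \<rho>)"
    by (rule open_openin_trans[OF h(2) open_ball]) (use r(2) in blast)
  then have "openin (top_of_set W) ?D"
    by (rule homeomorphism_imp_open_map[OF homeomorphism_symD[OF h(1)]])
  then have "open ?D" using openin_open_eq[OF h(3)] by blast
  moreover have "p \<in> ?D" using homeomorphism_apply1[OF h(1) W(2)] r(1) by (intro image_eqI[of _ _ "\<kappa> p"]) auto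
  moreover have "?D \<subseteq> O'" using DW by blast
  ultimately show ?thesis by (rule that[OF _ _ _ r(1) hs])
qed

lemma surface_disc_connected:
  fixes A :: "('a::t2_space set \<times> ('a \<Rightarrow> complex)) set" and p :: 'a
  assumes A: "closed_oriented_surface A" and O: "open O'" "p \<in> O'"
  obtains D where "open D" "p \<in> D" "D \<subseteq> O'" "connected D" "connected (D - {p})" "infinite D"
proof -
  obtain D and \<theta> :: "'a \<Rightarrow> complex" and \<psi> \<rho> where D: "open D" "p \<in> D" "D \<subseteq> O'" "\<rho> > 0"
    and h: "homeomorphism D (ball (\<theta> p) \<rho>) \<theta> \<psi>"
    by (rule surface_disc[OF A O])
  have im: "\<psi> ` ball (\<theta> p) \<rho> = D" "\<theta> ` D = ball (\<theta> p) \<rho>" using homeomorphism_image2[OF h] homeomorphism_image1[OF h] by auto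
  have c: "continuous_on (ball (\<theta> p) \<rho>) \<psi>" using homeomorphism_cont2[OF h] .
  have "connected D" using connected_continuous_image[OF c connected_ball] im by simp
  moreover have "\<psi> ` (ball (\<theta> p) \<rho> - {\<theta> p}) = D - {p}"
  proof -
    have "inj_on \<psi> (ball (\<theta> p) \<rho>)" using homeomorphism_apply2[OF h] by (intro inj_on_inverseI[where g = \<theta>]) auto
    then have "\<psi> ` (ball (\<theta> p) \<rho> - {\<theta> p}) = \<psi> ` ball (\<theta> p) \<rho> - \<psi> ` {\<theta> p}"
      using inj_on_image_set_diff[of \<psi> "ball (\<theta> p) \<rho>"] D(4) by auto
    then show ?thesis using im homeomorphism_apply1[OF h D(2)] by simp
  qed
  moreover have "connected (\<psi> ` (ball (\<theta> p) \<rho> - {\<theta> p}))"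
    by (rule connected_continuous_image[OF continuous_on_subset[OF c]])
      (auto intro: connected_punctured_ball)
  moreover have "infinite D"
  proof
    assume "finite D"
    then have "finite (ball (\<theta> p) \<rho>)" using im(2) by (metis finite_imageI)
    then show False using D(4) finite_imp_not_open[OF _ open_ball, of "\<theta> p" \<rho>] by simp
  qed
  ultimately show ?thesis using that[OF D(1-3)] by simp
qed

lemma surface_component_open:
  fixes A :: "('a::t2_space set \<times> ('a \<Rightarrow> complex)) set" and U :: "'a set"
  assumes A: "closed_oriented_surface A" and "open U" "K \<in> components U"
  shows "open K"
proof (subst open_subopen, intro ballI)
  fix p assume p: "p \<in> K"
  then have "p \<in> U" using in_components_subset assms by blast
  then obtain D where D: "open D" "p \<in> D" "D \<subseteq> U" "connected D"
    by (rule surface_disc_connected[OF A assms(2)]) (rule that)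
  then have "D \<subseteq> K" using components_maximal[OF assms(3)] p by blast
  then show "\<exists>T. open T \<and> p \<in> T \<and> T \<subseteq> K" using D by blast
qed

lemma surface_infinite_open:
  fixes A :: "('a::t2_space set \<times> ('a \<Rightarrow> complex)) set" and O' :: "'a set"
  assumes A: "closed_oriented_surface A" and "open O'" "O' \<noteq> {}"
  shows "infinite O'"
proof -
  obtain p where "p \<in> O'" using assms by blast
  then obtain D where "infinite D" "D \<subseteq> O'"
    by (rule surface_disc_connected[OF A assms(2)]) (rule that)
  then show ?thesis using finite_subset by blast
qed

text \<open>Deleting a point does not disconnect a small disc, so two regions cannot touch in isolated points only.\<close>

lemma finite_touch:
  fixes A :: "('a::t2_space set \<times> ('a \<Rightarrow> complex)) set" and M :: "'a set"
  assumes A: "closed_oriented_surface A" and M: "open M" "open M'" "M \<inter> M' = {}"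
    and dense: "closure (M \<union> M') = UNIV" and Y: "open Y" and fin: "finite (closure M \<inter> closure M' \<inter> Y)"
  shows "closure M \<inter> closure M' \<inter> Y = {}"
proof (rule ccontr)
  let ?Z = "closure M \<inter> closure M' \<inter> Y"
  assume "?Z \<noteq> {}"
  then obtain z where z: "z \<in> ?Z" by blast
  \<comment> \<open>Finiteness is used here: the other touching points can be kept out of the disc,
    so that in \<open>D\<close> the closures meet at \<open>z\<close> alone.\<close>
  have "closed (?Z - {z})" using fin by (intro finite_imp_closed) auto
  then have "open (Y - (?Z - {z}))" using Y by blast
  moreover have "z \<in> Y - (?Z - {z})" using z by blast
  ultimately obtain D where D: "open D" "z \<in> D" "D \<subseteq> Y - (?Z - {z})" "connected (D - {z})"
    by (rule surface_disc_connected[OF A]) (rule that)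
  have cov: "D - {z} \<subseteq> closure M \<union> closure M'" using dense by (metis closure_Un subset_UNIV)
  have dis: "closure M \<inter> closure M' \<inter> (D - {z}) = {}" using D by blast
  have zM: "z \<notin> M" "z \<notin> M'" using z M open_Int_closure_eq_empty[of M M'] open_Int_closure_eq_empty[of M' M] by blast+
  have "closure M \<inter> (D - {z}) = {} \<or> closure M' \<inter> (D - {z}) = {}"
    using D(4) cov dis connected_closed[of "D - {z}"] closed_closure by blast
  moreover have "M \<inter> (D - {z}) \<noteq> {}" "M' \<inter> (D - {z}) \<noteq> {}"
    using z D(1,2) zM open_Int_closure_eq_empty[OF D(1)] by blast+
  ultimately show False using closure_subset by blast
qed

text \<open>An open set with finite frontier touches the exterior of its closure in finitely many
  points, hence nowhere by \<open>finite_touch\<close>. Its closure is then clopen, so it is the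
  whole surface and the complement is just the frontier.\<close>

lemma surface_cofinite_frontier:
  fixes A :: "('a::t2_space set \<times> ('a \<Rightarrow> complex)) set" and K :: "'a set"
  assumes A: "closed_oriented_surface A" and "open K" "K \<noteq> {}" "finite (frontier K)"
  shows "finite (- K)"
proof -
  let ?M' = "- closure K"
  have cM: "closure ?M' = - interior (closure K)" by (simp add: closure_complement)
  then have "closure K \<inter> closure ?M' \<subseteq> frontier K"
    using assms(2) interior_mono[OF closure_subset[of K]] by (auto simp: frontier_def interior_open)
  then have fin: "finite (closure K \<inter> closure ?M' \<inter> UNIV)" using assms(4) by (metis finite_subset inf_top_right)
  have d: "closure (K \<union> ?M') = UNIV"
    using interior_subset[of "closure K"] by (auto simp: closure_Un cM)
  have "closure K \<inter> closure ?M' \<inter> UNIV = {}"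
    by (rule finite_touch[OF A assms(2) _ _ d open_UNIV fin]) (use closure_subset in auto)
  then have "closure K \<subseteq> interior (closure K)" using cM by blast
  then have "open (closure K)" by (metis interior_subset open_interior subset_antisym)
  moreover have "connected (UNIV :: 'a set)" using A by (simp add: closed_oriented_surface_def)
  moreover have "closure K \<noteq> {}" using assms(3) closure_subset[of K] by blast
  ultimately have "closure K = UNIV"
    unfolding connected_clopen using closed_closure[of K] by auto
  then have "- K = frontier K" using assms(2) by (simp add: frontier_def interior_open Compl_eq_Diff_UNIV)
  then show ?thesis using assms(4) by simp
qed

section \<open>Components of an open set along a curve and at a crossing\<close>

lemma flat_disc_half_nonempty:
  assumes "flat_disc A c t D \<zeta>" "\<sigma> \<noteq> 0"
  shows "{y \<in> D. 0 < \<sigma> * Im (\<zeta> y)} \<noteq> {}"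
proof -
  define w where "w = \<i> * of_real (sgn \<sigma> / 2)"
  have "w \<in> ball 0 1" using assms by (simp add: w_def norm_mult sgn_if)
  moreover have "\<zeta> ` D = ball 0 1" using assms by (simp add: flat_disc_def)
  ultimately obtain y where y: "y \<in> D" "\<zeta> y = w" by (metis imageE)
  have "0 < \<sigma> * Im w" using assms(2) by (auto simp: w_def sgn_if)
  then show ?thesis using y by blast
qed

lemma flat_disc_into:
  assumes A: "closed_oriented_surface A" and f: "flat_disc A c t D \<zeta>" and t: "t \<in> {0..1}"
    and O: "open O'" "c t \<in> O'"
  obtains D' \<zeta>' where "flat_disc A c t D' \<zeta>'" "D' \<subseteq> O'" "open D'" "D' \<subseteq> D"
proof -
  obtain \<rho> where r: "0 < \<rho>" "\<rho> \<le> 1" "{z \<in> D. norm (\<zeta> z) < \<rho>} \<subseteq> O'" by (rule flat_disc_shrink_into[OF A f t O])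
  have f': "flat_disc A c t {z \<in> D. norm (\<zeta> z) < \<rho>} (\<lambda>y. of_real (1 / \<rho>) * \<zeta> y)"
    by (rule flat_disc_shrink[OF A f t r(1,2)])
  have "open {z \<in> D. norm (\<zeta> z) < \<rho>}" using flat_disc_homeo[OF f'] by blast
  then show ?thesis using that[OF f' r(3)] by blast
qed

lemma side_component:
  assumes A: "closed_oriented_surface A" and f: "flat_disc A c t D \<zeta>" and t: "t \<in> {0..1}" and \<sigma>: "\<sigma> \<noteq> 0"
    and O: "open O'" "c t \<in> O'" "O' - path_image c \<subseteq> U"
  obtains K where "K \<in> components U" "side A c t \<sigma> K"
proof -
  obtain D' \<zeta>' where f': "flat_disc A c t D' \<zeta>'" and D: "D' \<subseteq> O'" by (rule flat_disc_into[OF A f t O(1,2)])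
  let ?H = "{y \<in> D'. 0 < \<sigma> * Im (\<zeta>' y)}"
  have "?H \<subseteq> U" using D O(3) flat_disc_on_path[OF f'] by fastforce
  moreover have "?H \<noteq> {}" "connected ?H" using flat_disc_half_nonempty[OF f' \<sigma>] flat_disc_half_connected[OF f'] by auto
  ultimately obtain K where "K \<in> components U" "?H \<subseteq> K" using exists_component_superset[of ?H U] by blast
  then show ?thesis using that f' unfolding side_def by blast
qed

text \<open>Each side of \<open>c\<close> lies in a single component, so the dichotomy needed by
  \<open>side_const\<close> holds for \<open>K\<close> against the union of all other
  components.\<close>

lemma side_component_const:
  assumes A: "closed_oriented_surface A" and sp: "simple_path c" and J: "connected J" "J \<subseteq> {0<..<1}" and \<sigma>: "\<sigma> \<in> {1, -1}"
    and fl: "\<And>t. t \<in> J \<Longrightarrow> \<exists>D \<zeta>. flat_disc A c t D \<zeta>"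
    and O: "\<And>t. t \<in> J \<Longrightarrow> \<exists>O'. open O' \<and> c t \<in> O' \<and> O' - path_image c \<subseteq> U"
    and K: "K \<in> components U" and t: "t \<in> J" "side A c t \<sigma> K" and u: "u \<in> J"
  shows "side A c u \<sigma> K"
proof (rule side_const[OF A sp J \<sigma> _ _ t u])
  show "K \<inter> (U - K) = {}" by blast
  fix v assume v: "v \<in> J"
  obtain O' where O': "open O'" "c v \<in> O'" "O' - path_image c \<subseteq> U" using O[OF v] by blast
  obtain D \<zeta> where f: "flat_disc A c v D \<zeta>" using fl[OF v] by blast
  have v01: "v \<in> {0..1}" using J(2) v by force
  have s0: "\<sigma> \<noteq> 0" using \<sigma> by auto
  obtain K' where K': "K' \<in> components U" "side A c v \<sigma> K'" by (rule side_component[OF A f v01 s0 O'])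
  show "side A c v \<sigma> K \<or> side A c v \<sigma> (U - K)"
  proof (cases "K' = K")
    case False
    then have "K' \<subseteq> U - K" using components_nonoverlap[OF K'(1) K] in_components_subset[OF K'(1)] by blast
    then show ?thesis using side_mono[OF K'(2)] by blast
  qed (use K' in simp)
qed

text \<open>A set that is a union of components and accumulates at \<open>c t\<close> contains a
  point of an arbitrarily small disc off the curve. The half-disc of that point is connected, so its
  whole component belongs to the set.\<close>

lemma touch_side:
  assumes A: "closed_oriented_surface A" and f: "flat_disc A c t D \<zeta>" and t: "t \<in> {0..1}"
    and O: "open O'" "c t \<in> O'" "O' - path_image c \<subseteq> U" and Uc: "U \<inter> path_image c = {}"
    and S: "S \<subseteq> U" "\<And>K. K \<in> components U \<Longrightarrow> K \<inter> S \<noteq> {} \<Longrightarrow> K \<subseteq> S" and cl: "c t \<in> closure S"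
  shows "\<exists>\<sigma> \<in> {1, -1}. \<exists>K \<in> components U. K \<subseteq> S \<and> side A c t \<sigma> K"
proof -
  obtain D' \<zeta>' where f': "flat_disc A c t D' \<zeta>'" and D: "D' \<subseteq> O'" "open D'" by (rule flat_disc_into[OF A f t O(1,2)])
  have "c t \<in> D'" using flat_disc_centre[OF f' t] by simp
  then obtain y where y: "y \<in> D'" "y \<in> S" using cl D(2) open_Int_closure_eq_empty by blast
  then have "y \<notin> path_image c" using S Uc by blast
  then have nz: "Im (\<zeta>' y) \<noteq> 0" using flat_disc_on_path[OF f' y(1)] by simp
  define \<sigma> where "\<sigma> = sgn (Im (\<zeta>' y))"
  let ?H = "{y \<in> D'. 0 < \<sigma> * Im (\<zeta>' y)}"
  have s: "\<sigma> \<in> {1, -1}" and yH: "y \<in> ?H" using nz y by (auto simp: \<sigma>_def sgn_if)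
  have "?H \<subseteq> U" using D O(3) flat_disc_on_path[OF f'] by fastforce
  then obtain K where K: "K \<in> components U" "?H \<subseteq> K"
    using exists_component_superset[of ?H U] flat_disc_half_connected[OF f'] yH by blast
  then have "K \<subseteq> S" using S(2) yH y by blast
  then show ?thesis using K s f' unfolding side_def by blast
qed

text \<open>Used at a crossing point, where four regions meet: \<tau> selects the times after or
  before \<open>t\<close>, and for such times the side can be found inside one quadrant of the disc
  at \<open>t\<close>.\<close>

lemma half_side:
  assumes A: "closed_oriented_surface A" and sp: "simple_path c" and t: "0 < t" "t < 1"
    and f: "flat_disc A c t D \<zeta>" and \<tau>: "\<tau> \<in> {1, -1}"
  shows "\<exists>\<delta>>0. \<forall>u. 0 < \<tau> * (u - t) \<and> \<tau> * (u - t) < \<delta> \<longrightarrow> side A c u \<sigma> {y \<in> D. 0 < \<tau> * Re (\<zeta> y) \<and> 0 < \<sigma> * Im (\<zeta> y)}"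
proof -
  have oD: "open D" and cont: "continuous_on D \<zeta>"
    using flat_disc_homeo[OF f] homeomorphism_cont1 by metis+
  have "open (D \<inter> (\<lambda>y. \<tau> * Re (\<zeta> y)) -` {0<..})"
    by (intro continuous_open_preimage continuous_intros cont oD)
  moreover have "D \<inter> (\<lambda>y. \<tau> * Re (\<zeta> y)) -` {0<..} = {y \<in> D. 0 < \<tau> * Re (\<zeta> y)}" by auto
  ultimately have oO: "open {y \<in> D. 0 < \<tau> * Re (\<zeta> y)}" by simp
  have key: "side A c u \<sigma> {y \<in> D. 0 < \<tau> * Re (\<zeta> y) \<and> 0 < \<sigma> * Im (\<zeta> y)}"
    if u: "0 < \<tau> * (u - t)" "0 < u" "u < 1" "c u \<in> D" and i: "Im (\<zeta> (c u)) = 0" and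
    all: "\<forall>O'. open O' \<longrightarrow> c u \<in> O' \<longrightarrow>
      (\<exists>\<rho>>0. flat_disc A c u {z \<in> D. \<zeta> z \<in> ball (\<zeta> (c u)) \<rho>} (\<lambda>y. of_real (1 / \<rho>) * (\<zeta> y - \<zeta> (c u))) \<and>
        {z \<in> D. \<zeta> z \<in> ball (\<zeta> (c u)) \<rho>} \<subseteq> O')" for u
  proof -
    have "sgn (Re (\<zeta> (c u))) = sgn (u - t)" using flat_disc_sgn[OF f, of u] u by auto
    then have "c u \<in> {y \<in> D. 0 < \<tau> * Re (\<zeta> y)}" using u \<tau> by (auto simp: sgn_if split: if_splits)
    then obtain \<rho> where r: "\<rho> > 0" "flat_disc A c u {z \<in> D. \<zeta> z \<in> ball (\<zeta> (c u)) \<rho>} (\<lambda>y. of_real (1 / \<rho>) * (\<zeta> y - \<zeta> (c u)))"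
        "{z \<in> D. \<zeta> z \<in> ball (\<zeta> (c u)) \<rho>} \<subseteq> {y \<in> D. 0 < \<tau> * Re (\<zeta> y)}"
      using all oO by blast
    have "{y \<in> {z \<in> D. \<zeta> z \<in> ball (\<zeta> (c u)) \<rho>}. 0 < \<sigma> * Im (of_real (1 / \<rho>) * (\<zeta> y - \<zeta> (c u)))} \<subseteq> {y \<in> D. 0 < \<tau> * Re (\<zeta> y) \<and> 0 < \<sigma> * Im (\<zeta> y)}"
      using r(1,3) i by (auto simp: zero_less_divide_iff)
    then show ?thesis using r(2) unfolding side_def by blast
  qed
  obtain \<delta> where d: "\<delta> > 0" "\<forall>u. \<bar>u - t\<bar> < \<delta> \<longrightarrow> 0 < u \<and> u < 1 \<and> c u \<in> D \<and> Im (\<zeta> (c u)) = 0 \<and>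
    (\<forall>O'. open O' \<longrightarrow> c u \<in> O' \<longrightarrow>
      (\<exists>\<rho>>0. flat_disc A c u {z \<in> D. \<zeta> z \<in> ball (\<zeta> (c u)) \<rho>} (\<lambda>y. of_real (1 / \<rho>) * (\<zeta> y - \<zeta> (c u))) \<and>
        {z \<in> D. \<zeta> z \<in> ball (\<zeta> (c u)) \<rho>} \<subseteq> O'))"
    using flat_disc_move[OF A sp t f] by (elim exE conjE) (rule that)
  have ab: "\<bar>u - t\<bar> < \<delta>" if "0 < \<tau> * (u - t)" "\<tau> * (u - t) < \<delta>" for u
    using that \<tau> by auto
  show ?thesis
  proof (intro exI[of _ \<delta>] conjI allI impI d(1))
    fix u assume u: "0 < \<tau> * (u - t) \<and> \<tau> * (u - t) < \<delta>"
    with d(2) ab[of u] show "side A c u \<sigma> {y \<in> D. 0 < \<tau> * Re (\<zeta> y) \<and> 0 < \<sigma> * Im (\<zeta> y)}"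
      by (intro key) simp_all
  qed
qed

lemma flat_disc_pair_into:
  assumes A: "closed_oriented_surface A" and f: "flat_disc A c t D \<zeta>" "flat_disc A b s D (\<lambda>y. - \<i> * \<zeta> y)"
    and t: "t \<in> {0..1}" "s \<in> {0..1}" and O: "open O'" "c t \<in> O'"
  obtains D' \<zeta>' where "flat_disc A c t D' \<zeta>'" "flat_disc A b s D' (\<lambda>y. - \<i> * \<zeta>' y)" "D' \<subseteq> O'" "open D'" "D' \<subseteq> D"
proof -
  obtain \<rho> where r: "0 < \<rho>" "\<rho> \<le> 1" "{z \<in> D. norm (\<zeta> z) < \<rho>} \<subseteq> O'" by (rule flat_disc_shrink_into[OF A f(1) t(1) O])
  have f': "flat_disc A c t {z \<in> D. norm (\<zeta> z) < \<rho>} (\<lambda>y. of_real (1 / \<rho>) * \<zeta> y)"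
    by (rule flat_disc_shrink[OF A f(1) t(1) r(1,2)])
  have "flat_disc A b s {z \<in> D. norm (- \<i> * \<zeta> z) < \<rho>} (\<lambda>y. of_real (1 / \<rho>) * (- \<i> * \<zeta> y))"
    by (rule flat_disc_shrink[OF A f(2) t(2) r(1,2)])
  moreover have "(\<lambda>y. of_real (1 / \<rho>) * (- \<i> * \<zeta> y)) = (\<lambda>y. - \<i> * (of_real (1 / \<rho>) * \<zeta> y))" by auto
  ultimately have f'': "flat_disc A b s {z \<in> D. norm (\<zeta> z) < \<rho>} (\<lambda>y. - \<i> * (of_real (1 / \<rho>) * \<zeta> y))"
    by (simp add: norm_mult)
  have "open {z \<in> D. norm (\<zeta> z) < \<rho>}" using flat_disc_homeo[OF f'] by blast
  then show ?thesis using that[OF f' f'' r(3)] by blast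
qed

lemma flat_disc_pair_same_point:
  assumes "flat_disc A c t D \<zeta>" "flat_disc A b s D (\<lambda>y. - \<i> * \<zeta> y)" "t \<in> {0..1}" "s \<in> {0..1}"
  shows "c t = b s"
proof -
  obtain \<psi> where h: "homeomorphism D (ball 0 1) \<zeta> \<psi>" "open D" "inj_on \<zeta> D" by (rule flat_disc_homeo[OF assms(1)])
  show ?thesis using flat_disc_centre[OF assms(1,3)] flat_disc_centre[OF assms(2,4)] inj_onD[OF h(3)] by simp
qed

text \<open>In the common chart \<open>b\<close> runs upwards, so its left is the part with negative
  real part, which \<open>c\<close> visits before time \<open>t\<close>. This is why \<sigma> = 1
  goes with \<open>u < t\<close> and \<sigma> = -1 with \<open>u > t\<close>.\<close>

lemma crossing_after:
  assumes A: "closed_oriented_surface A" and cr: "crosses_right_to_left A b s c t"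
    and c: "path c" and t: "0 < t" "t < 1" "s \<in> {0..1}" and \<sigma>: "\<sigma> \<in> {1, -1}"
    and O: "open O'" "c t \<in> O'" "O' - path_image b \<subseteq> U"
  shows "\<exists>K \<in> components U. side A b s \<sigma> K \<and> (\<exists>\<delta>>0. \<forall>u. 0 < \<sigma> * (t - u) \<and> \<sigma> * (t - u) < \<delta> \<longrightarrow> c u \<in> K)"
proof -
  obtain D0 \<zeta>0 where f0: "flat_disc A c t D0 \<zeta>0" "flat_disc A b s D0 (\<lambda>y. - \<i> * \<zeta>0 y)"
    using cr unfolding crosses_right_to_left_def by blast
  have t01: "t \<in> {0..1}" using t by simp
  obtain D \<zeta> where f: "flat_disc A c t D \<zeta>" "flat_disc A b s D (\<lambda>y. - \<i> * \<zeta> y)" and D: "D \<subseteq> O'" "open D"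
    by (rule flat_disc_pair_into[OF A f0 t01 t(3) O(1,2)])
  let ?H = "{y \<in> D. 0 < \<sigma> * Im (- \<i> * \<zeta> y)}"
  have "?H \<subseteq> U"
  proof
    fix y assume "y \<in> ?H"
    then show "y \<in> U" using D O(3) flat_disc_on_path[OF f(2), of y] by fastforce
  qed
  moreover have "?H \<noteq> {}" "connected ?H"
    using \<sigma> by (intro flat_disc_half_nonempty[OF f(2)] flat_disc_half_connected[OF f(2)]; force)+
  ultimately obtain K where K: "K \<in> components U" "?H \<subseteq> K" using exists_component_superset[of ?H U] by blast
  have "side A b s \<sigma> K" using K f unfolding side_def by blast
  moreover have "\<exists>\<delta>>0. \<forall>u. 0 < \<sigma> * (t - u) \<and> \<sigma> * (t - u) < \<delta> \<longrightarrow> c u \<in> K"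
  proof -
    have "continuous_on {0<..<1} c" using c by (auto simp: path_def intro: continuous_on_subset)
    then have "open (c -` D \<inter> {0<..<1})" using D(2) by (simp add: continuous_on_open_vimage)
    moreover have "t \<in> c -` D \<inter> {0<..<1}" using flat_disc_centre[OF f(1) t01] t by simp
    ultimately obtain \<delta> where d: "\<delta> > 0" "ball t \<delta> \<subseteq> c -` D \<inter> {0<..<1}" using open_contains_ball by blast
    have "c u \<in> K" if u: "0 < \<sigma> * (t - u)" "\<sigma> * (t - u) < \<delta>" for u
    proof -
      have "u \<in> ball t \<delta>" using u \<sigma> by (auto simp: dist_real_def)
      then have cu: "c u \<in> D" "0 < u" "u < 1" using d(2) by auto
      then have "sgn (Re (\<zeta> (c u))) = sgn (u - t)" using flat_disc_sgn[OF f(1), of u] by auto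
      then have "0 < \<sigma> * Im (- \<i> * \<zeta> (c u))" using u \<sigma> by (auto simp: sgn_if split: if_splits)
      then show ?thesis using K cu by auto
    qed
    then show ?thesis using d(1) by blast
  qed
  ultimately show ?thesis using K by blast
qed

text \<open>Since \<open>c\<close> covers the frontier of \<open>N\<close>, each half-disc lies in
  \<open>N\<close> or misses it. The left half lies in \<open>N\<close>; if the right half did too,
  \<open>c t\<close> would be an interior point of \<open>N\<close>. So a curve crossing from right
  to left enters \<open>N\<close>.\<close>

lemma crossing_into:
  assumes A: "closed_oriented_surface A" and cr: "crosses_right_to_left A b s c t"
    and b: "path b" and t: "0 < t" "t < 1" "0 < s" "s < 1"
    and N: "closed N" "path_image c = frontier N" "side A c t 1 N"
  shows "\<exists>\<delta>>0. \<forall>u. (s - \<delta> < u \<and> u < s \<longrightarrow> b u \<notin> N) \<and> (s < u \<and> u < s + \<delta> \<longrightarrow> b u \<in> N)"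
proof -
  obtain D \<zeta> where f: "flat_disc A c t D \<zeta>" "flat_disc A b s D (\<lambda>y. - \<i> * \<zeta> y)"
    using cr unfolding crosses_right_to_left_def by blast
  have t01: "t \<in> {0..1}" "s \<in> {0..1}" using t by auto
  have oD: "open D" using flat_disc_homeo[OF f(1)] by blast
  let ?H = "\<lambda>\<sigma>. {y \<in> D. 0 < \<sigma> * Im (\<zeta> y)}"
  have dich: "?H \<sigma> \<subseteq> N" if "?H \<sigma> \<inter> N \<noteq> {}" for \<sigma>
  proof -
    have "?H \<sigma> \<inter> frontier N = {}" using flat_disc_on_path[OF f(1)] N(2) by fastforce
    then show ?thesis using connected_Int_frontier[OF flat_disc_half_connected[OF f(1)] that] by blast
  qed
  have "side A c t 1 (?H 1)" using f(1) unfolding side_def by blast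
  then have "?H 1 \<inter> N \<noteq> {}" using side_meet[OF A t01(1) _ _ N(3)] by blast
  then have up: "?H 1 \<subseteq> N" by (rule dich)
  have down: "?H (-1) \<inter> N = {}"
  proof (rule ccontr)
    assume "?H (-1) \<inter> N \<noteq> {}"
    then have "?H (-1) \<subseteq> N" by (rule dich)
    have "D \<subseteq> N"
    proof
      fix y assume y: "y \<in> D"
      consider "Im (\<zeta> y) > 0" | "Im (\<zeta> y) < 0" | "Im (\<zeta> y) = 0" by linarith
      then show "y \<in> N"
      proof cases
        case 3
        then have "y \<in> frontier N" using flat_disc_on_path[OF f(1) y] N by simp
        then show ?thesis using N(1) frontier_subset_closed by blast
      qed (use y up \<open>?H (-1) \<subseteq> N\<close> in auto)
    qed
    then have "c t \<in> interior N" using oD flat_disc_centre[OF f(1) t01(1)] interior_maximal by blast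
    moreover have "c t \<in> frontier N" using N(2) t01 by (metis imageI path_image_def)
    ultimately show False by (simp add: frontier_def)
  qed
  have "continuous_on {0<..<1} b" using b by (auto simp: path_def intro: continuous_on_subset)
  then have "open (b -` D \<inter> {0<..<1})" using oD by (simp add: continuous_on_open_vimage)
  moreover have "s \<in> b -` D \<inter> {0<..<1}" using flat_disc_centre[OF f(2) t01(2)] t by simp
  ultimately obtain \<delta> where d: "\<delta> > 0" "ball s \<delta> \<subseteq> b -` D \<inter> {0<..<1}" using open_contains_ball by blast
  have D': "b u \<in> D \<and> sgn (Im (\<zeta> (b u))) = sgn (u - s)" if u: "\<bar>u - s\<bar> < \<delta>" for u
  proof -
    have "u \<in> ball s \<delta>" using u by (auto simp: dist_real_def)
    then have bu: "b u \<in> D" "0 < u" "u < 1" using d(2) by auto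
    then have "sgn (Re (- \<i> * \<zeta> (b u))) = sgn (u - s)" using flat_disc_sgn[OF f(2), of u] by auto
    then show ?thesis using bu by simp
  qed
  have "b u \<notin> N" if u: "s - \<delta> < u" "u < s" for u
  proof -
    have "b u \<in> ?H (-1)" using D'[of u] u by (auto simp: sgn_if split: if_splits)
    then show ?thesis using down by blast
  qed
  moreover have "b u \<in> N" if u: "s < u" "u < s + \<delta>" for u
  proof -
    have "b u \<in> ?H 1" using D'[of u] u by (auto simp: sgn_if split: if_splits)
    then show ?thesis using up by blast
  qed
  ultimately show ?thesis using d(1) by blast
qed

section \<open>Cutting faces along half-coedges\<close>

text \<open>The face is a plane under \<theta>, and inversion at the auxiliary point
  \<open>y0\<close> moves infinity to 0. A ray that leaves the face at time 1 goes to infinity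
  there, so its image closes up at 0 to an arc.\<close>

lemma inverted_ray_arc:
  fixes g :: "real \<Rightarrow> 'a::t2_space" and \<theta> :: "'a \<Rightarrow> complex"
  assumes h: "homeomorphism F UNIV \<theta> \<psi>" and g: "path g" "g ` {0..<1} \<subseteq> F" "g 1 \<notin> F" "inj_on g {0..<1}"
    and y0: "y0 \<in> F - g ` {0..<1}"
    and m_def: "m = (\<lambda>y. inverse (\<theta> y - \<theta> y0))"
    and J_def: "J = (\<lambda>u. if u < 1 then m (g u) else 0)"
  shows "arc J" "path_image J = insert 0 (m ` g ` {0..<1})" "pathstart J = m (g 0)" "pathfinish J = 0"
proof -
  have inj\<theta>: "inj_on \<theta> F" using homeomorphism_apply1[OF h] by (intro inj_on_inverseI[where g = \<psi>]) auto
  have nz: "\<theta> (g u) - \<theta> y0 \<noteq> 0" if "u \<in> {0..<1}" for u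
  proof
    assume "\<theta> (g u) - \<theta> y0 = 0"
    moreover have "g u \<in> F" using g(2) that by blast
    ultimately have "g u = y0" using inj_onD[OF inj\<theta>, of "g u" y0] y0 by simp
    then show False using y0 that by auto
  qed
  have cg: "continuous_on {0..<1} g" using g(1) by (auto simp: path_def intro: continuous_on_subset)
  have "continuous_on {0..<1} (\<lambda>u. \<theta> (g u))"
    by (rule continuous_on_compose2[OF homeomorphism_cont1[OF h] cg g(2)])
  then have cm: "continuous_on {0..<1} (\<lambda>u. m (g u))"
    unfolding m_def using nz by (intro continuous_intros) auto
  have cJ: "continuous_on {0..<1} J"
    using cm by (rule continuous_on_eq) (auto simp: J_def)
  have "continuous (at u within {0..1}) J" if u: "u \<in> {0..1}" for u
  proof (cases "u < 1")
    case True
    have "at u within {0..1} = at u within {0..<1}"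
      by (rule at_within_nhd[of _ "{..<1}"]) (use True in auto)
    moreover have "continuous (at u within {0..<1}) J"
      using cJ True u by (simp add: continuous_on_eq_continuous_within)
    ultimately show ?thesis by simp
  next
    case False
    then have u1: "u = 1" using u by auto
    \<comment> \<open>\<open>norm (J v) < e\<close> says that \<theta> \<open>(g v)\<close> is
      farther than \<open>1 / e\<close> from \<theta> \<open>y0\<close>. The points violating this
      form a compact subset of \<open>F\<close>, closed in the surface, which misses
      \<open>g 1\<close>.\<close>
    have "\<exists>d>0. \<forall>v\<in>{0..1}. dist v 1 < d \<longrightarrow> norm (J v) < e" if e: "e > 0" for e
    proof -
      let ?C = "\<psi> ` cball (\<theta> y0) (1 / e)"
      have "compact ?C" by (rule compact_continuous_image[OF continuous_on_subset[OF homeomorphism_cont2[OF h]]]) auto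
      then have oC: "open (- ?C)" using compact_imp_closed by blast
      have "?C \<subseteq> F" using homeomorphism_image2[OF h] by blast
      then have "g 1 \<in> - ?C" using g(3) by blast
      moreover have "continuous (at 1 within {0..1}) g" using g(1) by (simp add: path_def continuous_on_eq_continuous_within)
      ultimately have "eventually (\<lambda>v. g v \<in> - ?C) (at 1 within {0..1})"
        using oC by (auto simp: continuous_within tendsto_def)
      then obtain d where d: "d > 0" "\<And>v. v \<in> {0..1} \<Longrightarrow> v \<noteq> 1 \<Longrightarrow> dist v 1 < d \<Longrightarrow> g v \<in> - ?C"
        unfolding eventually_at by blast
      have "norm (J v) < e" if v: "v \<in> {0..1}" "dist v 1 < d" for v
      proof (cases "v < 1")
        case True
        then have gv: "g v \<in> F" "g v \<notin> ?C" using d(2)[of v] v g(2) by auto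
        have "\<theta> (g v) \<notin> cball (\<theta> y0) (1 / e)"
        proof
          assume "\<theta> (g v) \<in> cball (\<theta> y0) (1 / e)"
          then have "\<psi> (\<theta> (g v)) \<in> ?C" by blast
          then show False using gv homeomorphism_apply1[OF h gv(1)] by simp
        qed
        then have "norm (\<theta> (g v) - \<theta> y0) > 1 / e" by (simp add: dist_norm norm_minus_commute)
        then have "inverse (norm (\<theta> (g v) - \<theta> y0)) < inverse (1 / e)"
          using e by (intro less_imp_inverse_less) auto
        then show ?thesis using True by (simp add: J_def m_def norm_inverse)
      next
        case False
        then show ?thesis using e by (simp add: J_def)
      qed
      then show ?thesis using d(1) by blast
    qed
    then show ?thesis unfolding u1 continuous_within_eps_delta by (simp add: J_def dist_norm)
  qed
  then have "path J" by (simp add: path_def continuous_on_eq_continuous_within)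
  moreover have "inj_on J {0..1}"
  proof (rule inj_onI)
    fix u v :: real assume uv: "u \<in> {0..1}" "v \<in> {0..1}" "J u = J v"
    show "u = v"
    proof (cases "u < 1 \<and> v < 1")
      case True
      then have "\<theta> (g u) = \<theta> (g v)" using uv(3) by (simp add: J_def m_def)
      moreover have "g u \<in> F" "g v \<in> F" using g(2) True uv by (auto simp: image_subset_iff)
      ultimately have "g u = g v" using inj_onD[OF inj\<theta>, of "g u" "g v"] by simp
      then show ?thesis using inj_onD[OF g(4), of u v] True uv by auto
    next
      case False
      then show ?thesis using uv nz[of u] nz[of v] by (auto simp: J_def m_def split: if_splits)
    qed
  qed
  ultimately show "arc J" by (simp add: arc_def)
  have "{0..1} = insert 1 {0..<1::real}" by auto
  then show "path_image J = insert 0 (m ` g ` {0..<1})"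
    unfolding path_image_def by (auto simp: J_def image_iff)
  show "pathstart J = m (g 0)" "pathfinish J = 0" by (auto simp: J_def pathstart_def pathfinish_def)
qed

text \<open>In the open disc \<open>F\<close>, compactified by one point, the two rays form a Jordan curve.\<close>

lemma two_rays_separate:
  fixes g g' :: "real \<Rightarrow> 'a::t2_space"
  assumes F: "F homeomorphic ball (0::complex) 1" "open F"
    and g: "path g" "g ` {0..<1} \<subseteq> F" "g 1 \<notin> F" "inj_on g {0..<1}"
    and g': "path g'" "g' ` {0..<1} \<subseteq> F" "g' 1 \<notin> F" "inj_on g' {0..<1}"
    and gg': "g 0 = g' 0" "g ` {0<..<1} \<inter> g' ` {0<..<1} = {}"
    and y0: "y0 \<in> F" "y0 \<notin> g ` {0..<1}" "y0 \<notin> g' ` {0..<1}"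
    and K: "open K" "K \<subseteq> F" "g ` {0<..<1} \<subseteq> K" "K \<inter> g' ` {0..<1} = {}" "open (K - g ` {0..<1})"
  shows "\<not> connected (K - g ` {0..<1})"
proof
  assume conn: "connected (K - g ` {0..<1})"
  have "F homeomorphic (UNIV :: complex set)" using F(1) homeomorphic_ball01_UNIV homeomorphic_trans by blast
  then obtain \<theta> \<psi> where h: "homeomorphism F (UNIV :: complex set) \<theta> \<psi>" by (auto simp: homeomorphic_def)
  have inj\<theta>: "inj_on \<theta> F" using homeomorphism_apply1[OF h] by (intro inj_on_inverseI[where g = \<psi>]) auto
  define m where "m = (\<lambda>y. inverse (\<theta> y - \<theta> y0))"
  define J1 where "J1 = (\<lambda>u. if u < 1 then m (g u) else 0)"
  define J2 where "J2 = (\<lambda>u. if u < 1 then m (g' u) else 0)"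
  have y0g: "y0 \<in> F - g ` {0..<1}" "y0 \<in> F - g' ` {0..<1}" using y0 by auto
  note J1 = inverted_ray_arc[OF h g y0g(1) m_def J1_def]
  note J2 = inverted_ray_arc[OF h g' y0g(2) m_def J2_def]
  have mF: "m y = m y' \<Longrightarrow> y \<in> F \<Longrightarrow> y' \<in> F \<Longrightarrow> y = y'" for y y'
    using inj_onD[OF inj\<theta>, of y y'] by (simp add: m_def)
  have m0: "m y \<noteq> 0" if "y \<in> F" "y \<noteq> y0" for y
    using inj_onD[OF inj\<theta>, of y y0] that y0 by (auto simp: m_def)
  define J where "J = J1 +++ reversepath J2"
  have spJ: "simple_path J" unfolding J_def
  proof (rule simple_path_join_loop)
    show "arc J1" "arc (reversepath J2)" using J1(1) J2(1) arc_reversepath by auto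
    show "pathfinish J1 = pathstart (reversepath J2)" "pathfinish (reversepath J2) = pathstart J1"
      using J1 J2 gg' by auto
    show "path_image J1 \<inter> path_image (reversepath J2) \<subseteq> {pathstart J1, pathstart (reversepath J2)}"
    proof
      fix w assume w: "w \<in> path_image J1 \<inter> path_image (reversepath J2)"
      show "w \<in> {pathstart J1, pathstart (reversepath J2)}"
      proof (cases "w = 0")
        case False
        then obtain u v where u: "u \<in> {0..<1}" "w = m (g u)" and v: "v \<in> {0..<1}" "w = m (g' v)"
          using w J1(2) J2(2) by auto
        moreover have "g u \<in> F" "g' v \<in> F" using u v g(2) g'(2) by blast+
        ultimately have e: "g u = g' v" using mF[of "g u" "g' v"] by simp
        have "u = 0"
        proof (rule ccontr)
          assume "u \<noteq> 0"
          with u have gu: "g u \<in> g ` {0<..<1}" using u by auto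
          have "v = 0"
          proof (rule ccontr)
            assume "v \<noteq> 0"
            then have "g' v \<in> g' ` {0<..<1}" using v by auto
            then show False using gu e gg'(2) by auto
          qed
          then have "g u = g 0" using e gg'(1) by simp
          then show False using inj_onD[OF g(4), of u 0] u \<open>u \<noteq> 0\<close> by auto
        qed
        then show ?thesis using u J1(3) by simp
      qed (use J2(4) in simp)
    qed
  qed
  have "pathfinish J = pathstart J" using J1 J2 gg' by (simp add: J_def)
  with spJ obtain inn out where io: "open inn" "open out" "inn \<inter> out = {}"
    "inn \<union> out = - path_image J" "frontier inn = path_image J" "frontier out = path_image J"
    by (rule Jordan_curve) (rule that)
  have pJ: "path_image J = insert 0 (m ` g ` {0..<1} \<union> m ` g' ` {0..<1})"
    unfolding J_def using J1 J2 gg' by (subst path_image_join) auto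
  \<comment> \<open>The point \<open>y0\<close> is the pole of \<open>m\<close> and may lie in
    \<open>K\<close>, so it is deleted before mapping.\<close>
  define K0 where "K0 = K - {y0}"
  define L where "L = K - g ` {0..<1} - {y0}"
  have K0F: "K0 \<subseteq> F" "y0 \<notin> K0" using K(2) by (auto simp: K0_def)
  have op\<theta>: "open (\<theta> ` S)" if "open S" "S \<subseteq> F" for S
  proof -
    have "openin (top_of_set F) S" using that F(2) by (simp add: openin_open_eq)
    then show ?thesis using homeomorphism_imp_open_map[OF h] by simp
  qed
  have cont_m: "continuous_on (F - {y0}) m"
    unfolding m_def using continuous_on_subset[OF homeomorphism_cont1[OF h]] inj_onD[OF inj\<theta>, of _ y0] y0
    by (intro continuous_intros) auto
  have om: "open (m ` K0)"
  proof -
    have "open (\<theta> ` K0)" using K(1) K0F by (intro op\<theta>) (auto simp: K0_def)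
    have "m ` K0 = {w. w \<noteq> 0 \<and> inverse w + \<theta> y0 \<in> \<theta> ` K0}"
    proof (intro set_eqI iffI)
      fix w assume "w \<in> m ` K0"
      then obtain y where y: "y \<in> K0" "w = m y" by blast
      moreover have "m y \<noteq> 0" using m0[of y] y K0F by auto
      ultimately show "w \<in> {w. w \<noteq> 0 \<and> inverse w + \<theta> y0 \<in> \<theta> ` K0}" by (simp add: m_def)
    next
      fix w assume w: "w \<in> {w. w \<noteq> 0 \<and> inverse w + \<theta> y0 \<in> \<theta> ` K0}"
      then obtain y where "y \<in> K0" "\<theta> y = inverse w + \<theta> y0" by auto
      then show "w \<in> m ` K0" by (intro image_eqI[of _ _ y]) (auto simp: m_def)
    qed
    also have "\<dots> = - {0} \<inter> (\<lambda>w. inverse w + \<theta> y0) -` (\<theta> ` K0)" by auto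
    also have "open \<dots>"
      by (intro continuous_open_preimage continuous_intros \<open>open (\<theta> ` K0)\<close>) auto
    finally show ?thesis .
  qed
  let ?w = "m (g (1/2))"
  have "g (1/2) \<in> K0" using K(3) y0(2) by (force simp: K0_def)
  then have w: "?w \<in> m ` K0" by blast
  have wJ: "?w \<in> path_image J" using pJ by auto
  have meet: "m ` L \<inter> S \<noteq> {}" if "frontier S = path_image J" "S \<subseteq> - path_image J" "open S" for S
  proof -
    have "?w \<in> closure S" using wJ that(1) by (auto simp: frontier_def)
    then obtain y where y: "y \<in> K0" "m y \<in> S" using om w open_Int_closure_eq_empty[OF om] by blast
    then have "y \<notin> g ` {0..<1}" using that(2) pJ by blast
    then have "y \<in> L" using y by (auto simp: L_def K0_def)
    then show ?thesis using y by blast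
  qed
  have mi: "m ` L \<inter> inn \<noteq> {}" "m ` L \<inter> out \<noteq> {}"
    by (rule meet; use io in blast)+
  have LF: "L \<subseteq> F - {y0}" using K(2) by (auto simp: L_def)
  have "m ` L \<subseteq> - path_image J"
  proof
    fix w assume "w \<in> m ` L"
    then obtain y where y: "y \<in> L" "w = m y" by blast
    have "y \<in> F" "y \<noteq> y0" using y LF by auto
    then have "w \<noteq> 0" using m0[of y] y(2) by simp
    moreover have "w \<notin> m ` g ` {0..<1}"
    proof
      assume "w \<in> m ` g ` {0..<1}"
      then obtain u where u: "u \<in> {0..<1}" "w = m (g u)" by blast
      moreover have "g u \<in> F" using g(2) u(1) by blast
      ultimately have "y = g u" using mF[of y "g u"] y(2) \<open>y \<in> F\<close> by simp
      then show False using y u by (auto simp: L_def)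
    qed
    moreover have "w \<notin> m ` g' ` {0..<1}"
    proof
      assume "w \<in> m ` g' ` {0..<1}"
      then obtain u where u: "u \<in> {0..<1}" "w = m (g' u)" by blast
      moreover have "g' u \<in> F" using g'(2) u(1) by blast
      ultimately have "y = g' u" using mF[of y "g' u"] y(2) \<open>y \<in> F\<close> by simp
      then show False using y u K(4) by (auto simp: L_def)
    qed
    ultimately show "w \<in> - path_image J" using pJ by blast
  qed
  moreover have "connected (m ` L)"
  proof (rule connected_continuous_image)
    show "continuous_on L m" using continuous_on_subset[OF cont_m LF] .
    \<comment> \<open>Connectedness has to survive the deletion of \<open>y0\<close>. This is shown
      for the open image in the plane and carried back by \<psi>.\<close>
    let ?M = "K - g ` {0..<1}"
    have "connected (\<theta> ` ?M)" using conn K(2)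
      by (intro connected_continuous_image continuous_on_subset[OF homeomorphism_cont1[OF h]]) auto
    moreover have "open (\<theta> ` ?M)" using K by (intro op\<theta>) auto
    ultimately have "connected (\<theta> ` ?M - {\<theta> y0})" by (intro connected_open_delete) auto
    moreover have "\<psi> ` (\<theta> ` ?M - {\<theta> y0}) = L"
    proof -
      have "\<theta> ` ?M - {\<theta> y0} = \<theta> ` L"
        using inj_onD[OF inj\<theta>, of _ y0] y0(1) K(2) by (auto simp: L_def)
      moreover have "\<psi> ` \<theta> ` L = L"
        using homeomorphism_apply1[OF h] LF by force
      ultimately show ?thesis by simp
    qed
    ultimately show "connected L"
      using connected_continuous_image[OF continuous_on_subset[OF homeomorphism_cont2[OF h] subset_UNIV]] by metis
  qed
  ultimately show False
    using connectedD[of "m ` L" inn out] io(1-4) mi by blast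
qed

text \<open>Sending each component to the smaller component of a chosen remaining point is
  injective, because the smaller one stays inside it.\<close>

lemma components_survive:
  assumes "U' \<subseteq> U" "\<And>K. K \<in> components U \<Longrightarrow> K \<inter> U' \<noteq> {}" "\<K> \<subseteq> components U" "finite \<K>"
  shows "\<exists>\<K>' \<subseteq> components U'. finite \<K>' \<and> card \<K>' = card \<K>"
proof -
  define \<kappa> where "\<kappa> = (\<lambda>K. connected_component_set U' (SOME y. y \<in> K \<inter> U'))"
  have \<kappa>: "\<kappa> K \<in> components U'" "\<kappa> K \<subseteq> K" "\<kappa> K \<noteq> {}" if "K \<in> \<K>" for K
  proof -
    have K: "K \<in> components U" using that assms by blast
    have y: "(SOME y. y \<in> K \<inter> U') \<in> K \<inter> U'" using assms(2)[OF K] some_in_eq by blast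
    then show k: "\<kappa> K \<in> components U'" unfolding \<kappa>_def by (intro componentsI) blast
    then show "\<kappa> K \<noteq> {}" using in_components_nonempty by blast
    have "(SOME y. y \<in> K \<inter> U') \<in> \<kappa> K" using y by (simp add: \<kappa>_def)
    then have "K \<inter> \<kappa> K \<noteq> {}" using y by blast
    then show "\<kappa> K \<subseteq> K" using components_maximal[OF K in_components_connected[OF k]] in_components_subset[OF k] assms(1) by blast
  qed
  have "inj_on \<kappa> \<K>"
  proof (rule inj_onI)
    fix K K' assume k: "K \<in> \<K>" "K' \<in> \<K>" "\<kappa> K = \<kappa> K'"
    then have "K \<inter> K' \<noteq> {}" using \<kappa>[OF k(1)] \<kappa>[OF k(2)] by blast
    then show "K = K'" using components_nonoverlap[of K U K'] k assms(3) by blast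
  qed
  then have "card (\<kappa> ` \<K>) = card \<K>" by (rule card_image)
  then show ?thesis using \<kappa>(1) assms(4) by (intro exI[of _ "\<kappa> ` \<K>"]) auto
qed

lemma components_split:
  assumes K: "K \<in> components U" "C \<inter> U \<subseteq> K" "\<not> connected (K - C)" and \<K>: "\<K> \<subseteq> components U" "finite \<K>"
  shows "\<exists>\<K>' \<subseteq> components (U - C). finite \<K>' \<and> card \<K> + 1 \<le> card \<K>'"
proof -
  obtain y1 y2 where y: "y1 \<in> K - C" "y2 \<in> K - C" "\<not> connected_component (K - C) y1 y2"
    using K(3) unfolding connected_iff_connected_component by blast
  let ?\<kappa> = "connected_component_set (U - C)"
  have KU: "K \<subseteq> U" using K(1) in_components_subset by blast
  have sub: "?\<kappa> y \<subseteq> K - C" if "y \<in> K - C" for y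
  proof -
    have "y \<in> K \<inter> ?\<kappa> y" using that KU by auto
    moreover have "?\<kappa> y \<subseteq> U - C" by (rule connected_component_subset)
    ultimately show ?thesis using components_maximal[OF K(1), of "?\<kappa> y"] by blast
  qed
  have comp: "?\<kappa> y1 \<in> components (U - C)" "?\<kappa> y2 \<in> components (U - C)"
    using y KU by (auto intro!: componentsI)
  have ne: "?\<kappa> y1 \<noteq> ?\<kappa> y2"
  proof
    assume e: "?\<kappa> y1 = ?\<kappa> y2"
    have "y1 \<in> ?\<kappa> y1" "y2 \<in> ?\<kappa> y2" using y KU by auto
    then have "y1 \<in> ?\<kappa> y1" "y2 \<in> ?\<kappa> y1" using e by auto
    then show False using y(3) sub[OF y(1)] connected_connected_component[of "U - C" y1]
      unfolding connected_component_def by blast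
  qed
  have rest: "K' \<in> components (U - C)" "K' \<inter> K = {}" if "K' \<in> \<K> - {K}" for K'
  proof -
    have K': "K' \<in> components U" using that \<K> by blast
    show "K' \<inter> K = {}" using components_nonoverlap[OF K' K(1)] that by blast
    then have "K' \<subseteq> U - C" using K(2) in_components_subset[OF K'] by blast
    then show "K' \<in> components (U - C)" using components_intermediate_subset[OF K'] by blast
  qed
  let ?\<K>' = "insert (?\<kappa> y1) (insert (?\<kappa> y2) (\<K> - {K}))"
  have nin: "?\<kappa> y1 \<notin> \<K> - {K}" "?\<kappa> y2 \<notin> \<K> - {K}"
    using rest(2) sub[OF y(1)] sub[OF y(2)] in_components_nonempty[OF comp(1)] in_components_nonempty[OF comp(2)] by blast+
  have "card ?\<K>' = card (\<K> - {K}) + 2" using nin ne \<K>(2) by simp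
  \<comment> \<open>Only an inequality, because the chosen family need not contain the component
    \<open>K\<close> that is split.\<close>
  moreover have "card \<K> \<le> card (\<K> - {K}) + 1" 
    by (cases "K \<in> \<K>") (simp_all add: card_Diff_singleton_if)
  ultimately show ?thesis using rest(1) comp \<K>(2) by (intro exI[of _ ?\<K>']) auto
qed

text \<open>Excludes isolated vertices when there are edges; a coedge might otherwise run through one.\<close>

lemma punctured_disc_sphere:
  fixes A :: "('a::t2_space set \<times> ('a \<Rightarrow> complex)) set" and F :: "'a set"
  assumes A: "closed_oriented_surface A" and F: "F homeomorphic ball (0::complex) 1" "open F"
    and v: "v \<notin> F" "open O'" "v \<in> O'" "O' - {v} \<subseteq> F"
  shows "insert v F = UNIV"
proof -
  have "F homeomorphic (UNIV :: complex set)" using F(1) homeomorphic_ball01_UNIV homeomorphic_trans by blast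
  then obtain \<theta> \<psi> where h: "homeomorphism F (UNIV :: complex set) \<theta> \<psi>" by (auto simp: homeomorphic_def)
  have inj\<theta>: "inj_on \<theta> F" using homeomorphism_apply1[OF h] by (intro inj_on_inverseI[where g = \<psi>]) auto
  have \<psi>F: "\<psi> w \<in> F" for w using homeomorphism_image2[OF h] by blast
  have "open (O' - {\<psi> 0})" "v \<in> O' - {\<psi> 0}" using v \<psi>F by auto
  then obtain D and \<kappa> :: "'a \<Rightarrow> complex" and \<phi> \<rho> where D: "open D" "v \<in> D" "D \<subseteq> O' - {\<psi> 0}" "\<rho> > 0"
    and hD: "homeomorphism D (ball (\<kappa> v) \<rho>) \<kappa> \<phi>"
    by (rule surface_disc[OF A])
  let ?B = "ball (\<kappa> v) \<rho>"
  have \<phi>v: "\<phi> (\<kappa> v) = v" using homeomorphism_apply1[OF hD D(2)] .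
  have inj\<phi>: "inj_on \<phi> ?B" using homeomorphism_apply2[OF hD] by (intro inj_on_inverseI[where g = \<kappa>]) auto
  have \<phi>D: "\<phi> w \<in> D" if "w \<in> ?B" for w using homeomorphism_image2[OF hD] that by blast
  have \<phi>F: "\<phi> w \<in> F" if "w \<in> ?B - {\<kappa> v}" for w
  proof -
    have "\<phi> w \<noteq> v" using inj_onD[OF inj\<phi>, of w "\<kappa> v"] that \<phi>v D(4) by auto
    then show ?thesis using \<phi>D[of w] that D(3) v(4) by blast
  qed
  have nz: "\<theta> (\<phi> w) \<noteq> 0" if "w \<in> ?B - {\<kappa> v}" for w
  proof
    assume "\<theta> (\<phi> w) = 0"
    then have "\<phi> w = \<psi> 0" using homeomorphism_apply1[OF h \<phi>F[OF that]] by simp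
    then show False using \<phi>D[of w] that D(3) by blast
  qed
  \<comment> \<open>Near the puncture this is the inverted coordinate of the face, extended by 0 at
    \<open>v\<close>. It is continuous because points of \<open>F\<close> near \<open>v\<close>
    leave every compact subset of \<open>F\<close>, and it is injective, so invariance of domain
    makes its image a neighborhood of 0.\<close>
  define m where "m = (\<lambda>w. if w = \<kappa> v then 0 else inverse (\<theta> (\<phi> w)))"
  have c1: "continuous_on (?B - {\<kappa> v}) (\<lambda>w. inverse (\<theta> (\<phi> w)))"
  proof (intro continuous_intros)
    show "continuous_on (?B - {\<kappa> v}) (\<lambda>w. \<theta> (\<phi> w))"
    proof (rule continuous_on_compose2[OF homeomorphism_cont1[OF h] continuous_on_subset[OF homeomorphism_cont2[OF hD]]])
      show "\<phi> ` (?B - {\<kappa> v}) \<subseteq> F" using \<phi>F by blast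
    qed auto
  qed (use nz in auto)
  have "continuous_on ?B m"
    unfolding continuous_on_eq_continuous_at[OF open_ball]
  proof
    fix w assume w: "w \<in> ?B"
    show "isCont m w"
    proof (cases "w = \<kappa> v")
      case False
      have o: "open (?B - {\<kappa> v})" by auto
      have "continuous_on (?B - {\<kappa> v}) m" using c1 by (rule continuous_on_eq) (auto simp: m_def)
      then show ?thesis using continuous_on_eq_continuous_at[OF o] w False by blast
    next
      case True
      have "\<exists>d>0. \<forall>u. dist u w < d \<longrightarrow> norm (m u) < e" if e: "e > 0" for e
      proof -
        let ?C = "\<psi> ` cball 0 (1 / e)"
        have "compact ?C" by (rule compact_continuous_image[OF continuous_on_subset[OF homeomorphism_cont2[OF h]]]) auto
        then have oC: "open (- ?C)" using compact_imp_closed by blast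
        have "v \<in> - ?C" using \<psi>F v(1) by blast
        have "open (\<phi> -` (- ?C) \<inter> ?B)" using homeomorphism_cont2[OF hD] oC by (simp add: continuous_on_open_vimage)
        moreover have "w \<in> \<phi> -` (- ?C) \<inter> ?B" using \<open>v \<in> - ?C\<close> True \<phi>v w by simp
        ultimately obtain d where d: "d > 0" "ball w d \<subseteq> \<phi> -` (- ?C) \<inter> ?B" using open_contains_ball by blast
        have "norm (m u) < e" if u: "dist u w < d" for u
        proof (cases "u = \<kappa> v")
          case False
          have "u \<in> ball w d" using u by (simp add: dist_commute)
          then have uB: "u \<in> \<phi> -` (- ?C) \<inter> ?B" using d(2) by blast
          then have uF: "\<phi> u \<in> F" using \<phi>F False by blast
          have "\<theta> (\<phi> u) \<notin> cball 0 (1 / e)"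
          proof
            assume "\<theta> (\<phi> u) \<in> cball 0 (1 / e)"
            then have "\<psi> (\<theta> (\<phi> u)) \<in> ?C" by blast
            then show False using uB homeomorphism_apply1[OF h uF] by simp
          qed
          then have "norm (\<theta> (\<phi> u)) > 1 / e" by simp
          then have "inverse (norm (\<theta> (\<phi> u))) < inverse (1 / e)" using e by (intro less_imp_inverse_less) auto
          then show ?thesis using False by (simp add: m_def norm_inverse)
        qed (use e in \<open>simp add: m_def\<close>)
        then show ?thesis using d(1) by blast
      qed
      then show ?thesis unfolding continuous_at_eps_delta using True by (simp add: m_def dist_norm)
    qed
  qed
  then have cm: "continuous_on (ball (\<kappa> v) (\<rho> / 2)) m" by (rule continuous_on_subset) (use D(4) in auto)
  have "inj_on m (ball (\<kappa> v) (\<rho> / 2))"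
  proof (rule inj_onI)
    fix w u assume wu: "w \<in> ball (\<kappa> v) (\<rho> / 2)" "u \<in> ball (\<kappa> v) (\<rho> / 2)" "m w = m u"
    then have B: "w \<in> ?B" "u \<in> ?B" using D(4) by auto
    show "w = u"
    proof (cases "w = \<kappa> v \<or> u = \<kappa> v")
      case True
      then show ?thesis using wu(3) nz[of w] nz[of u] B by (auto simp: m_def split: if_splits)
    next
      case False
      then have "\<theta> (\<phi> w) = \<theta> (\<phi> u)" using wu(3) by (simp add: m_def)
      then have "\<phi> w = \<phi> u" using inj_onD[OF inj\<theta>] \<phi>F B False by blast
      then show ?thesis using inj_onD[OF inj\<phi>] B by blast
    qed
  qed
  then have "open (m ` ball (\<kappa> v) (\<rho> / 2))" by (rule invariance_of_domain[OF cm open_ball])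
  moreover have "0 \<in> m ` ball (\<kappa> v) (\<rho> / 2)" using D(4) by (intro image_eqI[of _ _ "\<kappa> v"]) (auto simp: m_def)
  ultimately obtain e where e: "e > 0" "ball 0 e \<subseteq> m ` ball (\<kappa> v) (\<rho> / 2)" using open_contains_ball by blast
  \<comment> \<open>The points of the face far out in the plane all lie in the disc around
    \<open>v\<close>. Hence \<open>insert v F\<close> is a union of two compact sets; being also
    open, it is everything.\<close>
  have cover: "y \<in> \<phi> ` cball (\<kappa> v) (\<rho> / 2) \<union> \<psi> ` cball 0 (1 / e)" if y: "y \<in> F" for y
  proof (cases "norm (\<theta> y) \<le> 1 / e")
    case True
    then show ?thesis using homeomorphism_apply1[OF h y] by (intro UnI2 image_eqI[of _ _ "\<theta> y"]) auto
  next
    case False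
    then have nz: "\<theta> y \<noteq> 0" using e(1) by auto
    have "inverse (norm (\<theta> y)) < inverse (1 / e)" using False e by (intro less_imp_inverse_less) auto
    then have "inverse (\<theta> y) \<in> ball 0 e" by (simp add: norm_inverse)
    then obtain w where w: "w \<in> ball (\<kappa> v) (\<rho> / 2)" "inverse (\<theta> y) = m w" using e(2) by blast
    then have "w \<noteq> \<kappa> v" using nz by (auto simp: m_def)
    then have "\<theta> y = \<theta> (\<phi> w)" using w(2) by (simp add: m_def)
    moreover have "\<phi> w \<in> F" using \<phi>F[of w] w \<open>w \<noteq> \<kappa> v\<close> D(4) by auto
    ultimately have "y = \<phi> w" using inj_onD[OF inj\<theta>, of y "\<phi> w"] y by simp
    then show ?thesis using w(1) by (intro UnI1 image_eqI[of _ _ w]) auto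
  qed
  have sub: "cball (\<kappa> v) (\<rho> / 2) \<subseteq> ?B" using D(4) by auto
  have "insert v F = \<phi> ` cball (\<kappa> v) (\<rho> / 2) \<union> \<psi> ` cball 0 (1 / e)"
  proof
    have "v \<in> \<phi> ` cball (\<kappa> v) (\<rho> / 2)" using \<phi>v D(4) by (intro image_eqI[of _ _ "\<kappa> v"]) auto
    then show "insert v F \<subseteq> \<phi> ` cball (\<kappa> v) (\<rho> / 2) \<union> \<psi> ` cball 0 (1 / e)" using cover by blast
    have "\<phi> ` cball (\<kappa> v) (\<rho> / 2) \<subseteq> D" using sub \<phi>D by blast
    then show "\<phi> ` cball (\<kappa> v) (\<rho> / 2) \<union> \<psi> ` cball 0 (1 / e) \<subseteq> insert v F" using D(3) v(4) \<psi>F by blast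
  qed
  moreover have "compact (\<phi> ` cball (\<kappa> v) (\<rho> / 2) \<union> \<psi> ` cball 0 (1 / e))"
    by (intro compact_Un compact_continuous_image continuous_on_subset[OF homeomorphism_cont2[OF h]]
        continuous_on_subset[OF homeomorphism_cont2[OF hD] sub]) auto
  ultimately have "closed (insert v F)" using compact_imp_closed by metis
  moreover have "insert v F = F \<union> O'" using v by blast
  then have "open (insert v F)" using open_Un[OF F(2) v(2)] by simp
  ultimately have co: "open (insert v F)" "closed (insert v F)" by auto
  have "connected (UNIV :: 'a set)" using A by (simp add: closed_oriented_surface_def)
  then have "\<forall>T. open T \<and> closed T \<longrightarrow> T = {} \<or> T = (UNIV :: 'a set)" unfolding connected_clopen by simp
  from spec[OF this, of "insert v F"] co show ?thesis by simp
qed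

lemma connected_component_openin_frontier:
  assumes "K \<in> components U" "\<And>K'. K' \<in> components U \<Longrightarrow> open K'"
  shows "frontier K \<inter> U = {}"
proof (rule ccontr)
  assume "frontier K \<inter> U \<noteq> {}"
  then obtain y where y: "y \<in> frontier K" "y \<in> U" by blast
  let ?K = "connected_component_set U y"
  have K': "?K \<in> components U" using y by (simp add: componentsI)
  have yK: "y \<in> ?K" using y by simp
  have "open ?K" using assms(2) K' by blast
  moreover have "y \<in> closure K" using y by (simp add: frontier_def)
  ultimately have "?K \<inter> K \<noteq> {}" using yK open_Int_closure_eq_empty by blast
  then have "?K = K" using components_nonoverlap[OF K' assms(1)] by blast
  then have "y \<in> interior K" using assms yK by (metis interior_open)
  then show False using y by (simp add: frontier_def)
qed

text \<open>Halves of \<open>[0, 1]\<close>: \<open>\<tau> = 1\<close> for the head half, \<open>\<tau> = - 1\<close> for the tail half.\<close>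

definition half_int :: "real \<Rightarrow> real set" where
  "half_int \<tau> = (if \<tau> = 1 then {1/2<..<1} else {0<..<1/2})"

lemma half_int: "connected (half_int \<tau>)" "half_int \<tau> \<subseteq> {0<..<1}" "1/2 \<notin> half_int \<tau>"
  by (auto simp: half_int_def)

lemma half_int_nonempty: "\<exists>s. s \<in> half_int \<tau>"
  by (rule exI[of _ "if \<tau> = 1 then 3/4 else 1/4"]) (auto simp: half_int_def)

lemma half_int_near: "\<tau> \<in> {1, -1} \<Longrightarrow> 0 < \<delta> \<Longrightarrow> \<exists>u \<in> half_int \<tau>. 0 < \<tau> * (u - 1/2) \<and> \<tau> * (u - 1/2) < \<delta>"
  by (rule bexI[of _ "1/2 + \<tau> * min (\<delta> / 2) (1/4)"]) (auto simp: half_int_def)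

lemma half_int_cases: "s \<in> {0<..<1} \<Longrightarrow> s \<noteq> 1/2 \<Longrightarrow> \<exists>\<tau> \<in> {1, -1}. s \<in> half_int \<tau>"
  by (auto simp: half_int_def)

section \<open>Regions of a ribbon graph: components of the complement of the graph and its
  dual\<close>

locale ribbon_surface =
  fixes G :: "('a::t2_space, 'e) ribbon"
  assumes ribbon: "ribbon_graph G" and edges_nonempty: "edges G \<noteq> {}"
begin

abbreviation "A \<equiv> atlas G"
abbreviation "E \<equiv> edges G"
abbreviation "\<gamma> \<equiv> curve G"
definition "VV = verts G \<union> coverts G"
definition "W = - (VV \<union> points G (elts G))"

lemma W_eq: "W = - (graph_points G \<union> dual_graph_points G)"
  by (auto simp: W_def VV_def graph_points_def dual_graph_points_def points_def elts_def)

lemma surface: "closed_oriented_surface A" using ribbon by (simp add: ribbon_graph_def)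
lemma finite_VV: "finite VV" using ribbon by (auto simp: ribbon_graph_def embedded_graph_def VV_def)
lemma finite_E: "finite E" using ribbon by (auto simp: ribbon_graph_def embedded_graph_def)
lemma finite_elts: "finite (elts G)" using finite_E by (simp add: elts_def)

lemma edge_props:
  assumes "e \<in> E"
  shows "simple_path (\<gamma> (Edge e))" "\<gamma> (Edge e) 0 \<in> verts G" "\<gamma> (Edge e) 1 \<in> verts G"
    "\<gamma> (Edge e) ` {0<..<1} \<inter> verts G = {}" "\<And>t. t \<in> {0<..<1} \<Longrightarrow> \<exists>D \<zeta>. flat_disc A (\<gamma> (Edge e)) t D \<zeta>"
  using ribbon assms by (auto simp: ribbon_graph_def embedded_graph_def)

lemma coedge_props:
  assumes "e \<in> E"
  shows "simple_path (\<gamma> (Coedge e))" "\<gamma> (Coedge e) 0 \<in> coverts G" "\<gamma> (Coedge e) 1 \<in> coverts G"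
    "\<gamma> (Coedge e) ` {0<..<1} \<inter> coverts G = {}" "\<And>t. t \<in> {0<..<1} \<Longrightarrow> \<exists>D \<zeta>. flat_disc A (\<gamma> (Coedge e)) t D \<zeta>"
  using ribbon assms by (auto simp: ribbon_graph_def embedded_graph_def)

lemma elts_cases: "x \<in> elts G \<Longrightarrow> (\<And>e. e \<in> E \<Longrightarrow> x = Edge e \<Longrightarrow> P) \<Longrightarrow> (\<And>e. e \<in> E \<Longrightarrow> x = Coedge e \<Longrightarrow> P) \<Longrightarrow> P"
  by (auto simp: elts_def)

lemma simple: "x \<in> elts G \<Longrightarrow> simple_path (\<gamma> x)"
  by (erule elts_cases) (simp_all add: edge_props coedge_props)

lemma ends: "x \<in> elts G \<Longrightarrow> \<gamma> x 0 \<in> VV" "x \<in> elts G \<Longrightarrow> \<gamma> x 1 \<in> VV"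
  by (erule elts_cases; simp add: edge_props coedge_props VV_def)+

lemma flat: "x \<in> elts G \<Longrightarrow> t \<in> {0<..<1} \<Longrightarrow> \<exists>D \<zeta>. flat_disc A (\<gamma> x) t D \<zeta>"
  by (erule elts_cases) (simp_all add: edge_props coedge_props)

lemma path: "x \<in> elts G \<Longrightarrow> path (\<gamma> x)" using simple simple_path_imp_path by blast

lemma closed_points: "finite X \<Longrightarrow> X \<subseteq> elts G \<Longrightarrow> closed (points G X)"
  unfolding points_def using path by (intro closed_UN) (auto intro!: compact_imp_closed compact_path_image)

lemma closed_points': "X \<subseteq> elts G \<Longrightarrow> closed (points G X)"
  using closed_points finite_elts finite_subset by blast

lemma closed_VV: "closed VV" using finite_VV finite_imp_closed by blast

lemma closed_graph: "closed (graph_points G)"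
  unfolding graph_points_def using finite_VV
  by (intro closed_Un closed_points' finite_imp_closed) (auto simp: elts_def VV_def)

lemma open_W: "open W" unfolding W_def using closed_VV closed_points' by auto

lemma open_compW: "K \<in> components W \<Longrightarrow> open K"
  using surface_component_open[OF surface open_W] by blast

lemma path_infinite: "x \<in> elts G \<Longrightarrow> infinite (\<gamma> x ` half_int \<tau>)"
proof
  assume x: "x \<in> elts G" and "finite (\<gamma> x ` half_int \<tau>)"
  moreover have "inj_on (\<gamma> x) (half_int \<tau>)"
    using simple_path_inner_unique[OF simple[OF x]] half_int(2)[of \<tau>] by (intro inj_onI) force
  ultimately have "finite (half_int \<tau>)" using finite_imageD by blast
  moreover have "infinite (half_int \<tau>)" unfolding half_int_def using infinite_Ioo[of "1/2::real" 1] infinite_Ioo[of "0::real" "1/2"] by simp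
  ultimately show False by simp
qed

lemma coedge_edge:
  assumes "e \<in> E" "e' \<in> E" "y \<in> path_image (\<gamma> (Coedge e))" "y \<in> path_image (\<gamma> (Edge e'))"
  shows "e = e'" "y = \<gamma> (Edge e) (1/2)"
proof -
  have "path_image (\<gamma> (Coedge e)) \<inter> path_image (\<gamma> (Edge e')) = (if e = e' then {\<gamma> (Edge e) (1/2)} else {})"
    using ribbon assms by (simp add: ribbon_graph_def)
  then show "e = e'" "y = \<gamma> (Edge e) (1/2)" using assms by (auto split: if_splits)
qed

lemma face_open: "F \<in> components (- graph_points G) \<Longrightarrow> open F"
  using surface_component_open[OF surface, of "- graph_points G"] closed_graph by auto

text \<open>Around an isolated vertex a punctured disc lies in a single face. By
  \<open>punctured_disc_sphere\<close> that face and the vertex fill the surface, which leaves no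
  room for an edge.\<close>

lemma vertex_on_edge:
  assumes "v \<in> verts G"
  shows "v \<in> points G (Edge ` E)"
proof (rule ccontr)
  assume n: "v \<notin> points G (Edge ` E)"
  let ?O = "- ((verts G - {v}) \<union> points G (Edge ` E))"
  have "open ?O" using finite_VV
    by (intro open_Compl closed_Un closed_points' finite_imp_closed) (auto simp: elts_def VV_def)
  moreover have "v \<in> ?O" using n by blast
  ultimately obtain D where D: "open D" "v \<in> D" "D \<subseteq> ?O" "connected (D - {v})" "infinite D"
    by (rule surface_disc_connected[OF surface]) (rule that)
  have sub: "D - {v} \<subseteq> - graph_points G" using D(3) by (auto simp: graph_points_def)
  have "D - {v} \<noteq> {}" using D(5) by (metis finite.emptyI infinite_remove)
  then obtain F where F: "F \<in> components (- graph_points G)" "D - {v} \<subseteq> F"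
    using exists_component_superset[OF sub _ D(4)] sub by blast
  have "v \<notin> F" using in_components_subset[OF F(1)] assms by (auto simp: graph_points_def)
  moreover have "F homeomorphic ball (0::complex) 1" using ribbon F by (simp add: ribbon_graph_def)
  ultimately have U: "insert v F = UNIV" using punctured_disc_sphere[OF surface _ face_open[OF F(1)] _ D(1,2) F(2)] by blast
  obtain e where e: "e \<in> E" using edges_nonempty by blast
  then have "Edge e \<in> elts G" by (simp add: elts_def)
  then have inf: "infinite (\<gamma> (Edge e) ` half_int 1)" by (rule path_infinite)
  have "\<gamma> (Edge e) ` half_int 1 \<subseteq> path_image (\<gamma> (Edge e))" using half_int(2)[of 1] by (force simp: path_image_def)
  then have "\<gamma> (Edge e) ` half_int 1 \<subseteq> graph_points G"
    unfolding graph_points_def points_def using e by blast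
  moreover have "graph_points G \<subseteq> {v}" using U in_components_subset[OF F(1)] by blast
  ultimately show False using inf by (meson finite.emptyI finite.insertI finite_subset subset_trans)
qed

text \<open>The delicate case is a coedge through a vertex. The vertex lies on some edge, and a
  coedge meets edges only at its crossing point, an inner point of its edge and so not a
  vertex.\<close>

lemma inner_not_VV:
  assumes x: "x \<in> elts G" and t: "t \<in> {0<..<1}"
  shows "\<gamma> x t \<notin> VV"
  using x
proof (rule elts_cases)
  fix e assume e: "e \<in> E" "x = Edge e"
  have "\<gamma> x t \<in> path_image (\<gamma> x)" using t by (force simp: path_image_def)
  then have "\<gamma> x t \<in> graph_points G" using e by (auto simp: graph_points_def points_def)
  moreover have "coverts G \<inter> graph_points G = {}" using ribbon by (simp add: ribbon_graph_def)
  moreover have "\<gamma> x t \<notin> verts G" using edge_props(4)[OF e(1)] e t by blast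
  ultimately show ?thesis by (auto simp: VV_def)
next
  fix e assume e: "e \<in> E" "x = Coedge e"
  have p: "\<gamma> x t \<in> path_image (\<gamma> x)" using t by (force simp: path_image_def)
  have "\<gamma> x t \<notin> verts G"
  proof
    assume v: "\<gamma> x t \<in> verts G"
    then obtain e' where e': "e' \<in> E" "\<gamma> x t \<in> path_image (\<gamma> (Edge e'))"
      using vertex_on_edge by (auto simp: points_def)
    then have "\<gamma> x t = \<gamma> (Edge e) (1/2)" using coedge_edge[OF e(1) e'(1)] p e by simp
    then show False using edge_props(4)[OF e(1)] v by force
  qed
  moreover have "\<gamma> x t \<notin> coverts G" using coedge_props(4)[OF e(1)] e(2) t by blast
  ultimately show ?thesis by (simp add: VV_def)
qed

lemma crossing_centre:
  assumes "e \<in> E"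
  obtains D \<zeta> where "flat_disc A (\<gamma> (Edge e)) (1/2) D \<zeta>" "flat_disc A (\<gamma> (Coedge e)) (1/2) D (\<lambda>y. - \<i> * \<zeta> y)"
proof -
  have "crosses_right_to_left A (\<gamma> (Coedge e)) (1/2) (\<gamma> (Edge e)) (1/2)" using ribbon assms by (simp add: ribbon_graph_def)
  then show ?thesis unfolding crosses_right_to_left_def using that by blast
qed

lemma same_centre: "e \<in> E \<Longrightarrow> \<gamma> (Edge e) (1/2) = \<gamma> (Coedge e) (1/2)"
proof -
  assume "e \<in> E"
  then obtain D \<zeta> where "flat_disc A (\<gamma> (Edge e)) (1/2) D \<zeta>" "flat_disc A (\<gamma> (Coedge e)) (1/2) D (\<lambda>y. - \<i> * \<zeta> y)"
    by (rule crossing_centre)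
  then show ?thesis by (rule flat_disc_pair_same_point) auto
qed

lemma elt_meet:
  assumes x: "x \<in> elts G" "y \<in> elts G" "x \<noteq> y" and s: "s \<in> {0<..<1}" "t \<in> {0..1}" and eq: "\<gamma> x s = \<gamma> y t"
  shows "y = dual x \<and> s = 1/2 \<and> t = 1/2"
proof -
  have nV: "\<gamma> y t \<notin> VV" using inner_not_VV[OF x(1) s(1)] eq by simp
  then have "t \<noteq> 0" "t \<noteq> 1" using ends[OF x(2)] by metis+
  then have t: "t \<in> {0<..<1}" using s by auto
  have px: "\<gamma> x s \<in> path_image (\<gamma> x)" "\<gamma> x s \<in> path_image (\<gamma> y)"
    using s unfolding path_image_def by (force, simp add: eq)
  have half: "u = 1/2" if "z \<in> elts G" "u \<in> {0<..<1}" "\<gamma> z u = \<gamma> z (1/2)" for z u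
    using simple_path_inner_unique[OF simple[OF that(1)], of "1/2" u] that by auto
  have emb: "\<forall>e \<in> E. \<forall>e' \<in> E. e \<noteq> e' \<longrightarrow> \<gamma> (Edge e) ` {0<..<1} \<inter> \<gamma> (Edge e') ` {0<..<1} = {}"
     "\<forall>e \<in> E. \<forall>e' \<in> E. e \<noteq> e' \<longrightarrow> \<gamma> (Coedge e) ` {0<..<1} \<inter> \<gamma> (Coedge e') ` {0<..<1} = {}"
    using ribbon by (simp_all add: ribbon_graph_def embedded_graph_def)
  have im: "\<gamma> x s \<in> \<gamma> x ` {0<..<1}" "\<gamma> x s \<in> \<gamma> y ` {0<..<1}"
    using imageI[OF s(1), of "\<gamma> x"] imageI[OF t, of "\<gamma> y"] eq by simp_all
  obtain e where e: "e \<in> E" "x = Edge e \<or> x = Coedge e" using x(1) by (auto simp: elts_def)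
  obtain e' where e': "e' \<in> E" "y = Edge e' \<or> y = Coedge e'" using x(2) by (auto simp: elts_def)
  consider (ee) "x = Edge e" "y = Edge e'" | (cc) "x = Coedge e" "y = Coedge e'" | (ec) "x = Edge e" "y = Coedge e'" | (ce) "x = Coedge e" "y = Edge e'"
    using e e' by blast
  then show ?thesis
  proof cases
    case ee then show ?thesis using emb(1) e(1) e'(1) im x(3) by blast
  next
    case cc then show ?thesis using emb(2) e(1) e'(1) im x(3) by blast
  next
    case ec
    then have "e' = e" "\<gamma> x s = \<gamma> (Edge e') (1/2)" using coedge_edge[OF e'(1) e(1)] px by auto
    then show ?thesis using ec half[OF x(1) s(1)] half[OF x(2) t] eq same_centre[OF e(1)] by auto
  next
    case ce
    then have "e = e'" "\<gamma> x s = \<gamma> (Edge e) (1/2)" using coedge_edge[OF e(1) e'(1)] px by auto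
    then show ?thesis using ce half[OF x(1) s(1)] half[OF x(2) t] eq same_centre[OF e(1)] by auto
  qed
qed

lemma elt_meet_path:
  assumes "x \<in> elts G" "y \<in> elts G" "x \<noteq> y" "s \<in> {0<..<1}" "\<gamma> x s \<in> path_image (\<gamma> y)"
  shows "y = dual x \<and> s = 1/2"
proof -
  obtain t where "t \<in> {0..1}" "\<gamma> x s = \<gamma> y t" using assms(5) unfolding path_image_def by blast
  then show ?thesis using elt_meet[OF assms(1-4)] by blast
qed

lemma dual_dual [simp]: "dual (dual x) = x" by (cases x) auto
lemma dual_neq [simp]: "dual x \<noteq> x" by (cases x) auto
lemma dual_elts [simp]: "dual x \<in> elts G \<longleftrightarrow> x \<in> elts G" by (cases x) (auto simp: elts_def)

lemma half_nbhd:
  assumes x: "x \<in> elts G" and s: "s \<in> {0<..<1}" "s \<noteq> 1/2"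
  shows "\<exists>O'. open O' \<and> \<gamma> x s \<in> O' \<and> O' - path_image (\<gamma> x) \<subseteq> W"
proof (intro exI conjI)
  let ?O = "- (VV \<union> points G (elts G - {x}))"
  show "open ?O" using closed_VV closed_points'[of "elts G - {x}"] by auto
  have "\<gamma> x s \<notin> path_image (\<gamma> y)" if "y \<in> elts G - {x}" for y
    using elt_meet_path[OF x, of y s] s that by auto
  then show "\<gamma> x s \<in> ?O" using inner_not_VV[OF x s(1)] by (auto simp: points_def)
  show "?O - path_image (\<gamma> x) \<subseteq> W" by (auto simp: W_def points_def)
qed

lemma W_path: "x \<in> elts G \<Longrightarrow> W \<inter> path_image (\<gamma> x) = {}"
  by (auto simp: W_def points_def)

lemma reg_exists:
  assumes x: "x \<in> elts G" and \<sigma>: "\<sigma> \<in> {1, -1}"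
  shows "\<exists>K \<in> components W. \<forall>s \<in> half_int \<tau>. side A (\<gamma> x) s \<sigma> K"
proof -
  obtain s where s: "s \<in> half_int \<tau>" using half_int_nonempty by blast
  have hi: "u \<in> {0<..<1}" "u \<noteq> 1/2" if "u \<in> half_int \<tau>" for u using half_int(2,3)[of \<tau>] that by blast+
  obtain O' where O': "open O'" "\<gamma> x s \<in> O'" "O' - path_image (\<gamma> x) \<subseteq> W" using half_nbhd[OF x hi[OF s]] by blast
  obtain D \<zeta> where f: "flat_disc A (\<gamma> x) s D \<zeta>" using flat[OF x hi(1)[OF s]] by blast
  have s01: "s \<in> {0..1}" using hi(1)[OF s] by auto
  have s0: "\<sigma> \<noteq> 0" using \<sigma> by auto
  obtain K where K: "K \<in> components W" "side A (\<gamma> x) s \<sigma> K" by (rule side_component[OF surface f s01 s0 O'])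
  have "side A (\<gamma> x) u \<sigma> K" if "u \<in> half_int \<tau>" for u
    by (rule side_component_const[OF surface simple[OF x] half_int(1,2) \<sigma> flat[OF x hi(1)] half_nbhd[OF x hi] K(1) s K(2) that])
  then show ?thesis using K(1) by blast
qed

text \<open>The component of \<open>W\<close> along the side \<open>\<sigma>\<close> of the half \<open>\<tau>\<close> of \<open>x\<close>.\<close>

definition reg :: "'e elt \<Rightarrow> real \<Rightarrow> real \<Rightarrow> 'a set" where
  "reg x \<tau> \<sigma> = (SOME K. K \<in> components W \<and> (\<forall>s \<in> half_int \<tau>. side A (\<gamma> x) s \<sigma> K))"

lemma reg:
  assumes "x \<in> elts G" "\<sigma> \<in> {1, -1}"
  shows "reg x \<tau> \<sigma> \<in> components W" "\<And>s. s \<in> half_int \<tau> \<Longrightarrow> side A (\<gamma> x) s \<sigma> (reg x \<tau> \<sigma>)"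
  using someI_ex[of "\<lambda>K. K \<in> components W \<and> (\<forall>s \<in> half_int \<tau>. side A (\<gamma> x) s \<sigma> K)"] reg_exists[OF assms, of \<tau>]
  unfolding reg_def by blast+

lemma reg_unique:
  assumes "x \<in> elts G" "\<sigma> \<in> {1, -1}" "s \<in> half_int \<tau>" "side A (\<gamma> x) s \<sigma> S" "K \<in> components W" "S \<subseteq> K"
  shows "K = reg x \<tau> \<sigma>"
proof -
  have "s \<in> {0..1}" using assms(3) half_int(2)[of \<tau>] by force
  then have "S \<inter> reg x \<tau> \<sigma> \<noteq> {}" using side_meet[OF surface _ assms(2,4) reg(2)[OF assms(1-3)]] by blast
  then have "K \<inter> reg x \<tau> \<sigma> \<noteq> {}" using assms(6) by blast
  then show ?thesis using components_nonoverlap[OF assms(5) reg(1)[OF assms(1,2)], of \<tau>] by blast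
qed

text \<open>The signs of the real and imaginary part select one of the four corners at the crossing
  point. Seen from the edge, \<sigma>1 is the half and \<sigma>2 the side. The coedge is the
  imaginary axis traversed upwards, so for it \<sigma>2 is the half and, its left being the negative
  real part, -\<sigma>1 the side.\<close>

lemma quadrant:
  assumes e: "e \<in> E"
  obtains D \<zeta> where "flat_disc A (\<gamma> (Edge e)) (1/2) D \<zeta>" "open D"
    "\<And>y. y \<in> D \<Longrightarrow> y \<in> path_image (\<gamma> (Edge e)) \<longleftrightarrow> Im (\<zeta> y) = 0"
    "\<And>y. y \<in> D \<Longrightarrow> y \<in> path_image (\<gamma> (Coedge e)) \<longleftrightarrow> Re (\<zeta> y) = 0"
    "\<And>\<sigma>1 \<sigma>2. \<sigma>1 \<in> {1, -1} \<Longrightarrow> \<sigma>2 \<in> {1, -1} \<Longrightarrow> reg (Edge e) \<sigma>1 \<sigma>2 = reg (Coedge e) \<sigma>2 (- \<sigma>1) \<and>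
      {y \<in> D. 0 < \<sigma>1 * Re (\<zeta> y) \<and> 0 < \<sigma>2 * Im (\<zeta> y)} \<subseteq> reg (Edge e) \<sigma>1 \<sigma>2"
proof -
  have el: "Edge e \<in> elts G" "Coedge e \<in> elts G" using e by (auto simp: elts_def)
  obtain D0 \<zeta>0 where f0: "flat_disc A (\<gamma> (Edge e)) (1/2) D0 \<zeta>0" "flat_disc A (\<gamma> (Coedge e)) (1/2) D0 (\<lambda>y. - \<i> * \<zeta>0 y)"
    by (rule crossing_centre[OF e])
  let ?O = "- (VV \<union> points G (elts G - {Edge e, Coedge e}))"
  have oO: "open ?O" using closed_VV closed_points'[of "elts G - {Edge e, Coedge e}"] by auto
  have "\<gamma> (Edge e) (1/2) \<notin> path_image (\<gamma> y)" if "y \<in> elts G - {Edge e, Coedge e}" for y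
    using elt_meet_path[OF el(1), of y "1/2"] that by auto
  then have inO: "\<gamma> (Edge e) (1/2) \<in> ?O" using inner_not_VV[OF el(1), of "1/2"] by (auto simp: points_def)
  have h01: "(1/2::real) \<in> {0..1}" by simp
  obtain D \<zeta> where f: "flat_disc A (\<gamma> (Edge e)) (1/2) D \<zeta>" "flat_disc A (\<gamma> (Coedge e)) (1/2) D (\<lambda>y. - \<i> * \<zeta> y)"
      and D: "D \<subseteq> ?O" "open D"
    by (rule flat_disc_pair_into[OF surface f0 h01 h01 oO inO])
  have on: "y \<in> path_image (\<gamma> (Edge e)) \<longleftrightarrow> Im (\<zeta> y) = 0" "y \<in> path_image (\<gamma> (Coedge e)) \<longleftrightarrow> Re (\<zeta> y) = 0" if "y \<in> D" for y
    using flat_disc_on_path[OF f(1) that] flat_disc_on_path[OF f(2) that] by simp_all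
  obtain \<psi> where h: "homeomorphism D (ball 0 1) \<zeta> \<psi>" "open D" "inj_on \<zeta> D" by (rule flat_disc_homeo[OF f(1)])
  have main: "reg (Edge e) \<sigma>1 \<sigma>2 = reg (Coedge e) \<sigma>2 (- \<sigma>1) \<and>
      {y \<in> D. 0 < \<sigma>1 * Re (\<zeta> y) \<and> 0 < \<sigma>2 * Im (\<zeta> y)} \<subseteq> reg (Edge e) \<sigma>1 \<sigma>2"
    if \<sigma>: "\<sigma>1 \<in> {1, -1}" "\<sigma>2 \<in> {1, -1}" for \<sigma>1 \<sigma>2
  proof -
    let ?q = "{y \<in> D. 0 < \<sigma>1 * Re (\<zeta> y) \<and> 0 < \<sigma>2 * Im (\<zeta> y)}"
    have "?q \<subseteq> W"
    proof
      fix y assume y: "y \<in> ?q"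
      then have "y \<notin> path_image (\<gamma> (Edge e))" "y \<notin> path_image (\<gamma> (Coedge e))" "y \<in> ?O" using on[of y] D by auto
      then show "y \<in> W" by (auto simp: W_def points_def)
    qed
    moreover have "connected ?q"
    proof -
      let ?S = "ball 0 1 \<inter> {w. 0 < \<sigma>1 * Re w} \<inter> {w. 0 < \<sigma>2 * Im w}"
      have "?q = \<psi> ` ?S"
      proof (intro set_eqI iffI)
        fix y assume y: "y \<in> ?q"
        then have "\<zeta> y \<in> ?S" using homeomorphism_image1[OF h(1)] by auto
        moreover have "\<psi> (\<zeta> y) = y" using homeomorphism_apply1[OF h(1)] y by simp
        ultimately show "y \<in> \<psi> ` ?S" by (metis imageI)
      next
        fix y assume "y \<in> \<psi> ` ?S"
        then obtain w where w: "w \<in> ?S" "y = \<psi> w" by blast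
        then have "\<zeta> y = w" "y \<in> D" using homeomorphism_apply2[OF h(1)] homeomorphism_image2[OF h(1)] by auto
        then show "y \<in> ?q" using w by simp
      qed
      moreover have "convex ?S"
      proof -
        have "{w. 0 < \<sigma>2 * Im w} = {w. inner (of_real \<sigma>2 * \<i>) w > 0}" "{w. 0 < \<sigma>1 * Re w} = {w. inner (of_real \<sigma>1) w > 0}"
          by (auto simp: inner_complex_def)
        then show ?thesis by (simp add: convex_Int convex_halfspace_gt)
      qed
      moreover have "continuous_on ?S \<psi>" by (rule continuous_on_subset[OF homeomorphism_cont2[OF h(1)]]) auto
      ultimately show ?thesis by (simp add: connected_continuous_image convex_connected)
    qed
    moreover have "?q \<noteq> {}"
    proof -
      define w where "w = Complex (\<sigma>1 / 2) (\<sigma>2 / 2)"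
      have "norm w < 1" using \<sigma> by (auto simp: w_def cmod_def power_divide real_less_lsqrt real_sqrt_divide)
      then have "w \<in> \<zeta> ` D" using homeomorphism_image1[OF h(1)] by simp
      then obtain y where "y \<in> D" "\<zeta> y = w" by blast
      moreover have "0 < \<sigma>1 * Re w" "0 < \<sigma>2 * Im w" using \<sigma> by (auto simp: w_def)
      ultimately show ?thesis by blast
    qed
    ultimately obtain K where K: "K \<in> components W" "?q \<subseteq> K" using exists_component_superset[of ?q W] by blast
    obtain \<delta> where d: "\<delta> > 0" "\<forall>u. 0 < \<sigma>1 * (u - 1/2) \<and> \<sigma>1 * (u - 1/2) < \<delta> \<longrightarrow> side A (\<gamma> (Edge e)) u \<sigma>2 ?q"
      using half_side[OF surface simple[OF el(1)] _ _ f(1) \<sigma>(1), of \<sigma>2] by auto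
    obtain u where u: "u \<in> half_int \<sigma>1" "0 < \<sigma>1 * (u - 1/2)" "\<sigma>1 * (u - 1/2) < \<delta>"
      using half_int_near[OF \<sigma>(1) d(1)] by blast
    then have "side A (\<gamma> (Edge e)) u \<sigma>2 ?q" using d(2) by blast
    then have K1: "K = reg (Edge e) \<sigma>1 \<sigma>2" by (rule reg_unique[OF el(1) \<sigma>(2) u(1) _ K])
    obtain \<delta>' where d': "\<delta>' > 0" "\<forall>u. 0 < \<sigma>2 * (u - 1/2) \<and> \<sigma>2 * (u - 1/2) < \<delta>' \<longrightarrow>
       side A (\<gamma> (Coedge e)) u (- \<sigma>1) {y \<in> D. 0 < \<sigma>2 * Re (- \<i> * \<zeta> y) \<and> 0 < - \<sigma>1 * Im (- \<i> * \<zeta> y)}"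
      using half_side[OF surface simple[OF el(2)] _ _ f(2) \<sigma>(2), of "- \<sigma>1"] by auto
    have q': "{y \<in> D. 0 < \<sigma>2 * Re (- \<i> * \<zeta> y) \<and> 0 < - \<sigma>1 * Im (- \<i> * \<zeta> y)} = ?q" by auto
    obtain u' where u': "u' \<in> half_int \<sigma>2" "0 < \<sigma>2 * (u' - 1/2)" "\<sigma>2 * (u' - 1/2) < \<delta>'"
      using half_int_near[OF \<sigma>(2) d'(1)] by blast
    then have s: "side A (\<gamma> (Coedge e)) u' (- \<sigma>1) ?q" using d'(2) unfolding q' by blast
    have "- \<sigma>1 \<in> {1, -1}" using \<sigma>(1) by auto
    then have "K = reg (Coedge e) \<sigma>2 (- \<sigma>1)" by (rule reg_unique[OF el(2) _ u'(1) s K])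
    then show ?thesis using K1 K(2) by simp
  qed
  show ?thesis by (rule that[OF f(1) D(2) on main])
qed

lemma reg_Edge_Coedge:
  assumes "e \<in> E" "\<sigma>1 \<in> {1, -1}" "\<sigma>2 \<in> {1, -1}"
  shows "reg (Edge e) \<sigma>1 \<sigma>2 = reg (Coedge e) \<sigma>2 (- \<sigma>1)"
  by (rule quadrant[OF assms(1)]) (use assms in blast)

text \<open>If the frontier of a region consisted of (co)vertices only, its complement would be
  finite by \<open>surface_cofinite_frontier\<close>, yet it contains a whole edge. So the region
  touches an inner point of some element; at a crossing point the quadrants identify it.\<close>

lemma component_is_reg:
  assumes K: "K \<in> components W"
  obtains x \<tau> \<sigma> where "x \<in> elts G" "\<tau> \<in> {1, -1}" "\<sigma> \<in> {1, -1}" "K = reg x \<tau> \<sigma>"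
proof -
  have oK: "open K" and KW: "K \<subseteq> W" and Kne: "K \<noteq> {}"
    using open_compW[OF K] in_components_subset[OF K] in_components_nonempty[OF K] by auto
  have fr: "frontier K \<inter> W = {}" using connected_component_openin_frontier[OF K open_compW] .
  have "\<exists>x \<in> elts G. \<exists>s \<in> {0<..<1}. \<gamma> x s \<in> frontier K"
  proof (rule ccontr)
    assume n: "\<not> ?thesis"
    have "frontier K \<subseteq> VV"
    proof
      fix y assume y: "y \<in> frontier K"
      show "y \<in> VV"
      proof (rule ccontr)
        assume nV: "y \<notin> VV"
        then obtain x where x: "x \<in> elts G" "y \<in> path_image (\<gamma> x)" using fr y by (auto simp: W_def points_def)
        then obtain s where s: "s \<in> {0..1}" "y = \<gamma> x s" by (auto simp: path_image_def)
        then have "s \<noteq> 0" "s \<noteq> 1" using ends[OF x(1)] nV by auto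
        then show False using n x(1) s y by auto
      qed
    qed
    then have "finite (- K)" using surface_cofinite_frontier[OF surface oK Kne] finite_VV finite_subset by blast
    moreover obtain e where "e \<in> E" using edges_nonempty by blast
    then have el: "Edge e \<in> elts G" by (simp add: elts_def)
    have "\<gamma> (Edge e) ` half_int 1 \<subseteq> path_image (\<gamma> (Edge e))" using half_int(2)[of 1] by (force simp: path_image_def)
    then have "\<gamma> (Edge e) ` half_int 1 \<subseteq> - K" using KW W_path[OF el] by blast
    ultimately show False using path_infinite[OF el] finite_subset by blast
  qed
  then obtain x s where x: "x \<in> elts G" and s: "s \<in> {0<..<1}" "\<gamma> x s \<in> closure K" by (auto simp: frontier_def)
  show ?thesis
  proof (cases "s = 1/2")
    case False
    obtain \<tau> where \<tau>: "\<tau> \<in> {1, -1}" "s \<in> half_int \<tau>" using half_int_cases[OF s(1) False] by blast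
    obtain O' where O': "open O'" "\<gamma> x s \<in> O'" "O' - path_image (\<gamma> x) \<subseteq> W" using half_nbhd[OF x s(1) False] by blast
    obtain D \<zeta> where f: "flat_disc A (\<gamma> x) s D \<zeta>" using flat[OF x s(1)] by blast
    have s01: "s \<in> {0..1}" using s by auto
    have "\<exists>\<sigma> \<in> {1, -1}. \<exists>K' \<in> components W. K' \<subseteq> K \<and> side A (\<gamma> x) s \<sigma> K'"
    proof (rule touch_side[OF surface f s01 O' W_path[OF x] KW _ s(2)])
      fix K' assume "K' \<in> components W" "K' \<inter> K \<noteq> {}"
      then show "K' \<subseteq> K" using components_nonoverlap[OF _ K] by blast
    qed
    then obtain \<sigma> K' where "\<sigma> \<in> {1, -1}" "K' \<subseteq> K" "side A (\<gamma> x) s \<sigma> K'" by blast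
    then show ?thesis using that[OF x \<tau>(1)] reg_unique[OF x _ \<tau>(2) _ K] by blast
  next
    case True
    obtain e where e: "e \<in> E" "x = Edge e \<or> x = Coedge e" using x by (auto simp: elts_def)
    then have cl: "\<gamma> (Edge e) (1/2) \<in> closure K" using s(2) True same_centre[OF e(1)] by auto
    obtain D \<zeta> where f: "flat_disc A (\<gamma> (Edge e)) (1/2) D \<zeta>" "open D"
      and on: "\<And>y. y \<in> D \<Longrightarrow> y \<in> path_image (\<gamma> (Edge e)) \<longleftrightarrow> Im (\<zeta> y) = 0"
        "\<And>y. y \<in> D \<Longrightarrow> y \<in> path_image (\<gamma> (Coedge e)) \<longleftrightarrow> Re (\<zeta> y) = 0"
      and q: "\<And>\<sigma>1 \<sigma>2. \<sigma>1 \<in> {1, -1} \<Longrightarrow> \<sigma>2 \<in> {1, -1} \<Longrightarrow> reg (Edge e) \<sigma>1 \<sigma>2 = reg (Coedge e) \<sigma>2 (- \<sigma>1) \<and>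
      {y \<in> D. 0 < \<sigma>1 * Re (\<zeta> y) \<and> 0 < \<sigma>2 * Im (\<zeta> y)} \<subseteq> reg (Edge e) \<sigma>1 \<sigma>2"
      by (rule quadrant[OF e(1)]) (rule that)
    have el: "Edge e \<in> elts G" "Coedge e \<in> elts G" using e(1) by (auto simp: elts_def)
    have "\<gamma> (Edge e) (1/2) \<in> D" using flat_disc_centre(2)[OF f(1)] by simp
    then obtain y where y: "y \<in> D" "y \<in> K" using cl f(2) open_Int_closure_eq_empty by blast
    then have "y \<notin> path_image (\<gamma> (Edge e))" "y \<notin> path_image (\<gamma> (Coedge e))" using W_path[OF el(1)] W_path[OF el(2)] KW by auto
    then have nz: "Im (\<zeta> y) \<noteq> 0" "Re (\<zeta> y) \<noteq> 0" using on[OF y(1)] by auto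
    define \<sigma>1 where "\<sigma>1 = sgn (Re (\<zeta> y))"
    define \<sigma>2 where "\<sigma>2 = sgn (Im (\<zeta> y))"
    have \<sigma>: "\<sigma>1 \<in> {1, -1}" "\<sigma>2 \<in> {1, -1}" "0 < \<sigma>1 * Re (\<zeta> y)" "0 < \<sigma>2 * Im (\<zeta> y)"
      using nz by (auto simp: \<sigma>1_def \<sigma>2_def sgn_if)
    then have "y \<in> reg (Edge e) \<sigma>1 \<sigma>2" using q[OF \<sigma>(1,2)] y by blast
    then have "K = reg (Edge e) \<sigma>1 \<sigma>2" using components_nonoverlap[OF K reg(1)[OF el(1) \<sigma>(2)]] y by blast
    then show ?thesis using that[OF el(1) \<sigma>(1,2)] by blast
  qed
qed

end

lemma path_near:
  fixes c :: "real \<Rightarrow> 'a::topological_space"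
  assumes "path c" "0 < s" "s < 1" "open O'" "c s \<in> O'"
  shows "\<exists>\<delta>>0. \<forall>u. \<bar>u - s\<bar> < \<delta> \<longrightarrow> 0 < u \<and> u < 1 \<and> c u \<in> O'"
proof -
  have "continuous_on {0<..<1} c" using assms(1) by (auto simp: path_def intro: continuous_on_subset)
  then have "open (c -` O' \<inter> {0<..<1})" using assms(4) by (simp add: continuous_on_open_vimage)
  moreover have "s \<in> c -` O' \<inter> {0<..<1}" using assms by simp
  ultimately obtain \<delta> where d: "\<delta> > 0" "ball s \<delta> \<subseteq> c -` O' \<inter> {0<..<1}" using open_contains_ball by blast
  have "0 < u \<and> u < 1 \<and> c u \<in> O'" if "\<bar>u - s\<bar> < \<delta>" for u
  proof -
    have "u \<in> ball s \<delta>" using that by (simp add: dist_real_def abs_minus_commute)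
    then have "u \<in> c -` O' \<inter> {0<..<1}" using d(2) by blast
    then show ?thesis by simp
  qed
  then show ?thesis using d(1) by blast
qed

definition halves :: "'e elt set \<Rightarrow> 'e half set" where "halves S = {g. elt_of g \<in> S}"

lemma halves_eq: "halves S = Tail ` S \<union> Head ` S"
proof -
  have "g \<in> Tail ` S \<union> Head ` S" if "elt_of g \<in> S" for g using that by (cases g) auto
  then show ?thesis by (auto simp: halves_def)
qed

lemma card_halves: "finite S \<Longrightarrow> finite (halves S) \<and> card (halves S) = 2 * card S"
  unfolding halves_eq by (subst card_Un_disjoint) (auto simp: card_image inj_on_def)

section \<open>Half-(co)edges as rays, and the lower bound on the number of regions\<close>

context ribbon_surface begin

lemma dense_W:
  assumes "open O'" "O' \<noteq> {}"
  shows "O' \<inter> W \<noteq> {}"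
proof
  assume n: "O' \<inter> W = {}"
  have "infinite O'" by (rule surface_infinite_open[OF surface assms])
  then have "\<not> O' \<subseteq> VV" using finite_VV finite_subset by blast
  then obtain y where y: "y \<in> O'" "y \<notin> VV" by blast
  then obtain x where x: "x \<in> elts G" "y \<in> path_image (\<gamma> x)" using n by (auto simp: W_def points_def)
  then obtain s where s: "s \<in> {0..1}" "y = \<gamma> x s" by (auto simp: path_image_def)
  then have "s \<noteq> 0" "s \<noteq> 1" using ends[OF x(1)] y by auto
  then have s01: "0 < s" "s < 1" using s(1) by auto
  obtain \<delta> where d: "\<delta> > 0" "\<forall>u. \<bar>u - s\<bar> < \<delta> \<longrightarrow> 0 < u \<and> u < 1 \<and> \<gamma> x u \<in> O'"
    using path_near[OF path[OF x(1)] s01 assms(1)] s(2) y(1) by blast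
  \<comment> \<open>\<open>half_nbhd\<close> excludes the crossing point, so the time is moved
    slightly along the element if it happens to be 1/2.\<close>
  obtain u where u: "\<bar>u - s\<bar> < \<delta>" "u \<noteq> 1/2"
  proof (cases "s = 1/2")
    case True then show ?thesis using that[of "s + \<delta> / 2"] d(1) by auto
  next
    case False then show ?thesis using that[of s] d(1) by auto
  qed
  then have u': "u \<in> {0<..<1}" "\<gamma> x u \<in> O'" using d(2) by auto
  obtain O1 where O1: "open O1" "\<gamma> x u \<in> O1" "O1 - path_image (\<gamma> x) \<subseteq> W" using half_nbhd[OF x(1) u'(1) u(2)] by blast
  obtain D \<zeta> where f: "flat_disc A (\<gamma> x) u D \<zeta>" using flat[OF x(1) u'(1)] by blast
  have o: "open (O' \<inter> O1)" "\<gamma> x u \<in> O' \<inter> O1" using assms(1) O1 u' by auto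
  have u01: "u \<in> {0..1}" using u' by auto
  obtain D' \<zeta>' where f': "flat_disc A (\<gamma> x) u D' \<zeta>'" "D' \<subseteq> O' \<inter> O1" by (rule flat_disc_into[OF surface f u01 o])
  obtain z where z: "z \<in> D'" "0 < 1 * Im (\<zeta>' z)" using flat_disc_half_nonempty[OF f'(1), of 1] by auto
  then have "z \<notin> path_image (\<gamma> x)" using flat_disc_on_path[OF f'(1) z(1)] by simp
  then show False using z(1) f'(2) O1(3) n by blast
qed

text \<open>Runs from the (co)vertex at time 0 to the crossing point at time 1, whichever half it
  is. A half-coedge thus stays in its face on \<open>{0..<1}\<close> and leaves it at time 1, as
  \<open>two_rays_separate\<close> requires.\<close>

definition ray :: "'e half \<Rightarrow> real \<Rightarrow> 'a" where
  "ray g u = (case g of Tail x \<Rightarrow> \<gamma> x (u / 2) | Head x \<Rightarrow> \<gamma> x (1 - u / 2))"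

lemma ray_param:
  obtains f where "\<And>u. ray g u = \<gamma> (elt_of g) (f u)" "inj f" "continuous_on {0..1} f" "f ` {0..1} \<subseteq> {0..1}"
    "f 1 = 1/2" "f 0 \<in> {0, 1}" "\<And>u. u \<in> {0<..<1} \<Longrightarrow> f u \<in> {0<..<1} \<and> f u \<noteq> 1/2"
    "f ` {0<..<1} = half_int (case g of Tail x \<Rightarrow> -1 | Head x \<Rightarrow> 1)"
proof (cases g)
  case (Tail x)
  have "(\<lambda>u. u / 2) ` {0<..<1} = {0<..<1/2::real}"
    by (auto simp: image_iff intro!: bexI[of _ "2 * _"])
  moreover have "continuous_on {0..1} (\<lambda>u::real. u / 2)" by (intro continuous_intros) auto
  ultimately show ?thesis using that[of "\<lambda>u. u / 2"] Tail
    by (auto simp: ray_def inj_def half_int_def)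
next
  case (Head x)
  have "(\<lambda>u. 1 - u / 2) ` {0<..<1} = {1/2<..<1::real}"
  proof (intro set_eqI iffI)
    fix w :: real assume "w \<in> {1/2<..<1}"
    then show "w \<in> (\<lambda>u. 1 - u / 2) ` {0<..<1}" by (intro image_eqI[of _ _ "2 * (1 - w)"]) (auto simp: field_simps)
  qed auto
  moreover have "continuous_on {0..1} (\<lambda>u::real. 1 - u / 2)" by (intro continuous_intros) auto
  moreover have "(\<lambda>u. 1 - u / 2) ` {0..1} \<subseteq> {0..1::real}" by auto
  ultimately show ?thesis using that[of "\<lambda>u. 1 - u / 2"] Head
    by (auto simp: ray_def inj_def half_int_def)
qed

lemma ray_half_points: "ray g ` {0<..<1} = half_points G g"
proof -
  obtain f where f: "\<And>u. ray g u = \<gamma> (elt_of g) (f u)" "f ` {0<..<1} = half_int (case g of Tail x \<Rightarrow> -1 | Head x \<Rightarrow> 1)"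
    by (rule ray_param) (rule that)
  have "ray g ` {0<..<1} = \<gamma> (elt_of g) ` f ` {0<..<1}" by (auto simp: f(1))
  then show ?thesis unfolding f(2) by (cases g) (auto simp: half_points_def half_int_def)
qed

lemma ray_inj:
  assumes "elt_of g \<in> elts G"
  shows "inj_on (ray g) {0..1}"
proof -
  obtain f where f: "\<And>u. ray g u = \<gamma> (elt_of g) (f u)" "inj f" "f ` {0..1} \<subseteq> {0..1}" "f 1 = 1/2"
     "\<And>u. u \<in> {0<..<1} \<Longrightarrow> f u \<in> {0<..<1} \<and> f u \<noteq> 1/2" by (rule ray_param) (rule that)
  have key: "u = v" if "u \<in> {0..1}" "v \<in> {0..1}" "v > 0" "ray g u = ray g v" for u v
  proof -
    have "0 < f v" "f v < 1" using f(4) f(5)[of v] that by (cases "v = 1"; auto)+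
    moreover have "f u \<in> {0..1}" using f(3) that(1) by blast
    ultimately have "f u = f v" using simple_path_inner_unique[OF simple[OF assms], of "f v" "f u"] that(4) by (simp add: f(1))
    then show ?thesis using f(2) by (simp add: inj_def)
  qed
  show ?thesis
  proof (rule inj_onI)
    fix u v :: real assume uv: "u \<in> {0..1}" "v \<in> {0..1}" "ray g u = ray g v"
    show "u = v"
    proof (cases "v > 0")
      case True then show ?thesis using key uv by blast
    next
      case v: False
      show ?thesis
      proof (cases "u > 0")
        case True then show ?thesis using key[OF uv(2,1) True uv(3)[symmetric]] by simp
      next
        case False then show ?thesis using v uv(1,2) by simp
      qed
    qed
  qed
qed

lemma ray_path:
  assumes "elt_of g \<in> elts G"
  shows "path (ray g)" "path_image (ray g) \<subseteq> path_image (\<gamma> (elt_of g))"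
proof -
  obtain f where f: "\<And>u. ray g u = \<gamma> (elt_of g) (f u)" "continuous_on {0..1} f" "f ` {0..1} \<subseteq> {0..1}" by (rule ray_param) (rule that)
  have "continuous_on {0..1} (\<gamma> (elt_of g))" using path[OF assms] by (simp add: path_def)
  then have "continuous_on {0..1} (\<lambda>u. \<gamma> (elt_of g) (f u))" by (rule continuous_on_compose2[OF _ f(2,3)])
  then show "path (ray g)" by (simp add: path_def f(1)[abs_def])
  show "path_image (ray g) \<subseteq> path_image (\<gamma> (elt_of g))" using f(3) by (auto simp: path_image_def f(1))
qed

lemma ray_inner:
  assumes "elt_of g \<in> elts G" "u \<in> {0<..<1}"
  shows "ray g u \<notin> VV" "\<And>y. y \<in> elts G \<Longrightarrow> y \<noteq> elt_of g \<Longrightarrow> ray g u \<notin> path_image (\<gamma> y)"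
proof -
  obtain f where f: "\<And>u. ray g u = \<gamma> (elt_of g) (f u)" "\<And>u. u \<in> {0<..<1} \<Longrightarrow> f u \<in> {0<..<1} \<and> f u \<noteq> 1/2"
    by (rule ray_param) (rule that)
  show "ray g u \<notin> VV" using inner_not_VV[OF assms(1), of "f u"] f(1)[of u] f(2)[OF assms(2)] by simp
  show "ray g u \<notin> path_image (\<gamma> y)" if "y \<in> elts G" "y \<noteq> elt_of g" for y
    using elt_meet_path[OF assms(1) that(1), of "f u"] that(2) f(1)[of u] f(2)[OF assms(2)] by auto
qed

lemma half_points_disjoint:
  assumes "elt_of g \<in> elts G" "elt_of g' \<in> elts G" "g \<noteq> g'"
  shows "half_points G g \<inter> half_points G g' = {}"
proof (cases "elt_of g = elt_of g'")
  case True
  have inj: "s = t" if "s \<in> {0<..<1}" "t \<in> {0<..<1}" "\<gamma> (elt_of g) s = \<gamma> (elt_of g) t" for s t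
    using simple_path_inner_unique[OF simple[OF assms(1)], of t s] that by auto
  obtain x where x: "(g = Tail x \<and> g' = Head x) \<or> (g = Head x \<and> g' = Tail x)"
    using True assms(3) by (cases g; cases g') auto
  have "\<gamma> x s \<noteq> \<gamma> x t" if "s \<in> {0<..<1/2}" "t \<in> {1/2<..<1}" for s t
    using inj[of s t] x that by auto
  then have "\<gamma> x ` {0<..<1/2} \<inter> \<gamma> x ` {1/2<..<1} = {}" by blast
  then show ?thesis using x by (auto simp: half_points_def)
next
  case False
  have "half_points G g' \<subseteq> path_image (\<gamma> (elt_of g'))"
  proof -
    have "ray g' ` {0<..<1} \<subseteq> path_image (ray g')" by (auto simp: path_image_def)
    then show ?thesis using ray_path(2)[OF assms(2)] by (simp add: ray_half_points)
  qed
  moreover have "y \<notin> path_image (\<gamma> (elt_of g'))" if "y \<in> half_points G g" for y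
  proof -
    from that obtain u where "u \<in> {0<..<1}" "y = ray g u" unfolding ray_half_points[symmetric] by blast
    then show ?thesis using ray_inner(2)[OF assms(1) _ assms(2)] False by auto
  qed
  ultimately show ?thesis by blast
qed

abbreviation "chalves \<equiv> halves (Coedge ` E)"

lemma chalves: "g \<in> chalves \<Longrightarrow> \<exists>e \<in> E. elt_of g = Coedge e" "g \<in> chalves \<Longrightarrow> elt_of g \<in> elts G"
  by (auto simp: halves_def elts_def)

lemma Edge_elts: "e \<in> E \<Longrightarrow> Edge e \<in> elts G" and Coedge_elts: "e \<in> E \<Longrightarrow> Coedge e \<in> elts G"
  by (auto simp: elts_def)

lemma coray:
  assumes g: "g \<in> chalves"
  shows "ray g 0 \<in> coverts G" "ray g 1 \<in> graph_points G" "ray g ` {0..<1} \<inter> graph_points G = {}"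
proof -
  obtain e where e: "e \<in> E" "elt_of g = Coedge e" using chalves[OF g] by blast
  obtain f where f: "\<And>u. ray g u = \<gamma> (elt_of g) (f u)" "f 1 = 1/2" "f 0 \<in> {0, 1}" by (rule ray_param) (rule that)
  show s: "ray g 0 \<in> coverts G" using f(1)[of 0] f(3) e coedge_props(2,3)[OF e(1)] by auto
  have "ray g 1 = \<gamma> (Edge e) (1/2)" using f(1)[of 1] f(2) e same_centre[OF e(1)] by simp
  then have "ray g 1 \<in> path_image (\<gamma> (Edge e))" by (auto simp: path_image_def)
  then show "ray g 1 \<in> graph_points G" using e by (auto simp: graph_points_def points_def)
  have "ray g u \<notin> graph_points G" if u: "u \<in> {0..<1}" for u
  proof (cases "u = 0")
    case True
    have "coverts G \<inter> graph_points G = {}" using ribbon by (simp add: ribbon_graph_def)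
    then show ?thesis using s True by auto
  next
    case False
    then have u': "u \<in> {0<..<1}" using u by auto
    have "ray g u \<notin> path_image (\<gamma> (Edge e'))" if "e' \<in> E" for e'
      using ray_inner(2)[OF chalves(2)[OF g] u' Edge_elts[OF that]] e(2) by simp
    then show ?thesis using ray_inner(1)[OF chalves(2)[OF g] u'] by (auto simp: graph_points_def points_def VV_def)
  qed
  then show "ray g ` {0..<1} \<inter> graph_points G = {}" by blast
qed

lemma covert_unique: "F \<in> components (- graph_points G) \<Longrightarrow> \<exists>!f. f \<in> coverts G \<inter> F"
  using ribbon unfolding ribbon_graph_def by (elim conjE) (erule (1) bspec)

lemma face_disc: "F \<in> components (- graph_points G) \<Longrightarrow> F homeomorphic ball (0::complex) 1"
  using ribbon by (simp add: ribbon_graph_def)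

definition cut :: "'e half set \<Rightarrow> 'a set" where
  "cut H = - (graph_points G \<union> (\<Union>g \<in> H. ray g ` {0..<1}))"

lemma cut_eq:
  assumes "H \<subseteq> chalves"
  shows "cut H = - (graph_points G \<union> (\<Union>g \<in> H. path_image (ray g)))"
proof -
  have "path_image (ray g) = insert (ray g 1) (ray g ` {0..<1})" for g
  proof -
    have "{0..1} = insert 1 {0..<1::real}" by auto
    then show ?thesis by (simp add: path_image_def)
  qed
  then show ?thesis using assms coray(2) by (auto simp: cut_def)
qed

lemma open_cut: "finite H \<Longrightarrow> H \<subseteq> chalves \<Longrightarrow> open (cut H)"
  unfolding cut_eq using ray_path(1) chalves(2)
  by (intro open_Compl closed_Un closed_graph closed_UN) (auto intro!: compact_imp_closed compact_path_image)

text \<open>The quantity on the left counts the half-coedges already cut plus the covertices not yet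
  reached. Initially it is the number of covertices, one per face. A cut from a fresh covertex
  leaves it unchanged and a cut from a reached one raises it by 1, and in the second case a region
  splits. Once all half-coedges are cut, their number alone is a lower bound.\<close>

lemma cut_count:
  assumes "finite H" "H \<subseteq> chalves"
  shows "\<exists>\<K> \<subseteq> components (cut H). finite \<K> \<and> card H + card (coverts G - (\<lambda>g. ray g 0) ` H) \<le> card \<K>"
  using assms
proof (induction H rule: finite_induct)
  case empty
  let ?\<kappa> = "connected_component_set (- graph_points G)"
  have cov: "f \<in> - graph_points G" if "f \<in> coverts G" for f
    using ribbon that by (auto simp: ribbon_graph_def)
  have "inj_on ?\<kappa> (coverts G)"
  proof (rule inj_onI)
    fix f f' assume f: "f \<in> coverts G" "f' \<in> coverts G" "?\<kappa> f = ?\<kappa> f'"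
    have "?\<kappa> f \<in> components (- graph_points G)" using cov[OF f(1)] by (rule componentsI)
    then have "\<exists>!k. k \<in> coverts G \<inter> ?\<kappa> f" by (rule covert_unique)
    moreover have "f \<in> ?\<kappa> f" using cov[OF f(1)] by simp
    moreover have "f' \<in> ?\<kappa> f" unfolding f(3) using cov[OF f(2)] by simp
    ultimately show "f = f'" using f(1,2) by blast
  qed
  then have "card (?\<kappa> ` coverts G) = card (coverts G)" by (rule card_image)
  moreover have "?\<kappa> ` coverts G \<subseteq> components (- graph_points G)" using cov by (auto intro: componentsI)
  moreover have "finite (coverts G)" using finite_VV by (simp add: VV_def)
  ultimately show ?case by (intro exI[of _ "?\<kappa> ` coverts G"]) (auto simp: cut_def)
next
  case (insert g H)
  then have g: "g \<in> chalves" and H: "H \<subseteq> chalves" by auto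
  obtain \<K> where \<K>: "\<K> \<subseteq> components (cut H)" "finite \<K>" "card H + card (coverts G - (\<lambda>g. ray g 0) ` H) \<le> card \<K>"
    using insert.IH[OF H] by blast
  let ?C = "ray g ` {0..<1}"
  have cutI: "cut (insert g H) = cut H - ?C" by (auto simp: cut_def)
  have gel: "elt_of g \<in> elts G" using chalves(2)[OF g] .
  have oH: "open (cut H)" by (rule open_cut[OF insert.hyps(1) H])
  have CW: "?C \<inter> W = {}"
  proof -
    have "?C \<subseteq> path_image (ray g)" by (auto simp: path_image_def)
    then show ?thesis using ray_path(2)[OF gel] W_path[OF gel] by blast
  qed
  have finC: "finite (coverts G)" using finite_VV by (simp add: VV_def)
  show ?case
  proof (cases "ray g 0 \<in> (\<lambda>g. ray g 0) ` H")
    \<comment> \<open>A fresh covertex: one more half-coedge is paid for by one covertex fewer, so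
      it suffices that no region is lost. None is, because the ray misses the dense set
      \<open>W\<close>.\<close>
    case False
    have "\<exists>\<K>' \<subseteq> components (cut (insert g H)). finite \<K>' \<and> card \<K>' = card \<K>"
      unfolding cutI
    proof (rule components_survive[OF Diff_subset _ \<K>(1,2)])
      fix K assume K: "K \<in> components (cut H)"
      have "open K" by (rule surface_component_open[OF surface oH K])
      then have "K \<inter> W \<noteq> {}" using dense_W in_components_nonempty[OF K] by blast
      then show "K \<inter> (cut H - ?C) \<noteq> {}" using CW in_components_subset[OF K] by blast
    qed
    moreover have "card (insert g H) + card (coverts G - (\<lambda>g. ray g 0) ` insert g H) \<le> card \<K>"
    proof -
      have "coverts G - (\<lambda>g. ray g 0) ` insert g H = (coverts G - (\<lambda>g. ray g 0) ` H) - {ray g 0}" by auto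
      moreover have "ray g 0 \<in> coverts G - (\<lambda>g. ray g 0) ` H" using False coray(1)[OF g] by blast
      ultimately have "card (coverts G - (\<lambda>g. ray g 0) ` H) = Suc (card (coverts G - (\<lambda>g. ray g 0) ` insert g H))"
        using finC by (metis card.remove finite_Diff)
      then show ?thesis using \<K>(3) insert.hyps by simp
    qed
    ultimately show ?thesis by metis
  next
    case True
    \<comment> \<open>A ray \<open>g'\<close> cut earlier starts at the same covertex. It lies in
      the same face as \<open>g\<close>, and the two form the Jordan curve that splits the region
      containing the interior of \<open>g\<close>.\<close>
    then obtain g' where g': "g' \<in> H" "ray g 0 = ray g' 0" by blast
    have g'c: "g' \<in> chalves" "elt_of g' \<in> elts G" using g' H chalves(2) by auto
    have gg': "g \<noteq> g'" using g' insert.hyps by auto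
    have inner: "ray g ` {0<..<1} \<subseteq> cut H"
    proof
      fix y assume "y \<in> ray g ` {0<..<1}"
      then obtain u where u: "u \<in> {0<..<1}" "y = ray g u" by blast
      have "y \<notin> graph_points G" using coray(3)[OF g] u by force
      moreover have "y \<notin> ray k ` {0..<1}" if k: "k \<in> H" for k
      proof
        assume "y \<in> ray k ` {0..<1}"
        then obtain v where v: "v \<in> {0..<1}" "y = ray k v" by blast
        have kc: "k \<in> chalves" "k \<noteq> g" using k H insert.hyps by auto
        show False
        proof (cases "v = 0")
          case True
          then have "y \<in> VV" using v coray(1)[OF kc(1)] by (auto simp: VV_def)
          then show False using ray_inner(1)[OF gel u(1)] u(2) by simp
        next
          case False
          then have "v \<in> {0<..<1}" using v by auto
          then have "y \<in> half_points G k" "y \<in> half_points G g" using u v unfolding ray_half_points[symmetric] by blast+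
          then show False using half_points_disjoint[OF gel chalves(2)[OF kc(1)]] kc(2) by blast
        qed
      qed
      ultimately show "y \<in> cut H" by (auto simp: cut_def)
    qed
    have cont: "continuous_on {0..1} (ray g)" "continuous_on {0..1} (ray g')"
      using ray_path(1)[OF gel] ray_path(1)[OF g'c(2)] by (auto simp: path_def)
    have "connected (ray g ` {0<..<1})"
      by (rule connected_continuous_image[OF continuous_on_subset[OF cont(1)]]) auto
    moreover have "cut H \<noteq> {}" using inner by auto
    ultimately obtain K where K: "K \<in> components (cut H)" "ray g ` {0<..<1} \<subseteq> K"
      using exists_component_superset[OF inner] by meson
    have KU: "K \<subseteq> cut H" using in_components_subset[OF K(1)] .
    have oK: "open K" by (rule surface_component_open[OF surface oH K(1)])
    have Kgp: "K \<subseteq> - graph_points G" using KU by (auto simp: cut_def)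
    moreover have "- graph_points G \<noteq> {}" using Kgp in_components_nonempty[OF K(1)] by auto
    ultimately obtain F where F: "F \<in> components (- graph_points G)" "K \<subseteq> F"
      using exists_component_superset[OF Kgp _ in_components_connected[OF K(1)]] by meson
    have gF: "ray g ` {0..<1} \<subseteq> F"
    proof (rule components_maximal[OF F(1)])
      show "connected (ray g ` {0..<1})" by (rule connected_continuous_image[OF continuous_on_subset[OF cont(1)]]) auto
      show "ray g ` {0..<1} \<subseteq> - graph_points G" using coray(3)[OF g] by blast
      have "ray g (1/2) \<in> F" by (rule subsetD[OF subset_trans[OF K(2) F(2)]]) auto
      moreover have "ray g (1/2) \<in> ray g ` {0..<1}" by (rule imageI) auto
      ultimately show "F \<inter> ray g ` {0..<1} \<noteq> {}" by blast
    qed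
    have g'F: "ray g' ` {0..<1} \<subseteq> F"
    proof (rule components_maximal[OF F(1)])
      show "connected (ray g' ` {0..<1})" by (rule connected_continuous_image[OF continuous_on_subset[OF cont(2)]]) auto
      show "ray g' ` {0..<1} \<subseteq> - graph_points G" using coray(3)[OF g'c(1)] by blast
      have "ray g 0 \<in> ray g' ` {0..<1}" unfolding g'(2) by auto
      moreover have "ray g 0 \<in> F" by (rule subsetD[OF gF]) auto
      ultimately show "F \<inter> ray g' ` {0..<1} \<noteq> {}" by blast
    qed
    have F1: "ray g 1 \<notin> F" "ray g' 1 \<notin> F" using in_components_subset[OF F(1)] coray(2)[OF g] coray(2)[OF g'c(1)] by auto
    have Fne: "F \<noteq> {}" and oF: "open F" using in_components_nonempty[OF F(1)] face_open[OF F(1)] by auto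
    \<comment> \<open>The centre of the inversion must avoid both rays; density of \<open>W\<close>
      provides one in the face.\<close>
    obtain y0 where y0: "y0 \<in> F" "y0 \<in> W" using dense_W[OF oF Fne] by blast
    have y0': "y0 \<notin> ray k ` {0..<1}" if "elt_of k \<in> elts G" for k
    proof -
      have "ray k ` {0..<1} \<subseteq> path_image (ray k)" by (auto simp: path_image_def)
      then show ?thesis using y0(2) W_path[OF that] ray_path(2)[OF that] by blast
    qed
    have Kg': "K \<inter> ray g' ` {0..<1} = {}" using KU g'(1) by (auto simp: cut_def)
    have "K - ?C = K - path_image (ray g)"
    proof -
      have "{0..1} = insert 1 {0..<1::real}" by auto
      then have "path_image (ray g) = insert (ray g 1) ?C" by (simp add: path_image_def)
      then show ?thesis using F1(1) F(2) by auto
    qed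
    then have oKC: "open (K - ?C)"
      using oK compact_imp_closed[OF compact_path_image[OF ray_path(1)[OF gel]]] by (simp add: open_Diff)
    have Fb: "F homeomorphic ball (0::complex) 1" by (rule face_disc[OF F(1)])
    have injs: "inj_on (ray k) {0..<1}" if "elt_of k \<in> elts G" for k
      by (rule inj_on_subset[OF ray_inj[OF that]]) auto
    have dis: "ray g ` {0<..<1} \<inter> ray g' ` {0<..<1} = {}"
      unfolding ray_half_points by (rule half_points_disjoint[OF gel g'c(2) gg'])
    have nc: "\<not> connected (K - ?C)"
      by (rule two_rays_separate[OF Fb oF ray_path(1)[OF gel] gF F1(1) injs[OF gel] ray_path(1)[OF g'c(2)] g'F F1(2) injs[OF g'c(2)]
          g'(2) dis y0(1) y0'[OF gel] y0'[OF g'c(2)] oK F(2) K(2) Kg' oKC])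
    have "?C \<inter> cut H \<subseteq> K"
    proof
      fix y assume y: "y \<in> ?C \<inter> cut H"
      then obtain u where u: "u \<in> {0..<1}" "y = ray g u" by blast
      have "u \<noteq> 0"
      proof
        assume "u = 0"
        then have "y \<in> ray g' ` {0..<1}" using u g'(2) by auto
        then show False using y g'(1) by (auto simp: cut_def)
      qed
      then show "y \<in> K" using K(2) u by auto
    qed
    then obtain \<K>' where \<K>': "\<K>' \<subseteq> components (cut H - ?C)" "finite \<K>'" "card \<K> + 1 \<le> card \<K>'"
      using components_split[OF K(1) _ nc \<K>(1,2)] by meson
    have "(\<lambda>g. ray g 0) ` insert g H = (\<lambda>g. ray g 0) ` H" using True by auto
    then have "card (insert g H) + card (coverts G - (\<lambda>g. ray g 0) ` insert g H) \<le> card \<K>'"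
      using \<K>'(3) \<K>(3) insert.hyps by simp
    then show ?thesis unfolding cutI using \<K>'(1,2) by meson
  qed
qed

text \<open>The fully cut surface may still contain covertices that lie on no coedge. Passing to
  \<open>W\<close> deletes them but loses no region, since \<open>W\<close> is dense.\<close>

lemma many_components:
  obtains \<K> where "\<K> \<subseteq> components W" "finite \<K>" "2 * card E \<le> card \<K>"
proof -
  have c: "finite (Coedge ` E)" "card (Coedge ` E) = card E" using finite_E by (auto simp: card_image inj_on_def)
  have H: "finite chalves" "card chalves = 2 * card E" using card_halves[OF c(1)] c(2) by auto
  obtain \<K> where \<K>: "\<K> \<subseteq> components (cut chalves)" "finite \<K>" "card chalves \<le> card \<K>"
    using cut_count[OF H(1) subset_refl] by auto
  have W: "W \<subseteq> cut chalves"
  proof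
    fix y assume y: "y \<in> W"
    have "y \<notin> ray g ` {0..<1}" if "g \<in> chalves" for g
    proof -
      have "ray g ` {0..<1} \<subseteq> path_image (ray g)" by (auto simp: path_image_def)
      then show ?thesis using y ray_path(2)[OF chalves(2)[OF that]] W_path[OF chalves(2)[OF that]] by blast
    qed
    then show "y \<in> cut chalves" using y by (auto simp: cut_def W_eq)
  qed
  have "\<exists>\<K>' \<subseteq> components W. finite \<K>' \<and> card \<K>' = card \<K>"
  proof (rule components_survive[OF W _ \<K>(1,2)])
    fix K assume K: "K \<in> components (cut chalves)"
    have "open K" by (rule surface_component_open[OF surface open_cut[OF H(1) subset_refl] K])
    then show "K \<inter> W \<noteq> {}" using dense_W in_components_nonempty[OF K] by blast
  qed
  then show ?thesis using that \<K>(3) H(2) by metis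
qed

end

section \<open>The boundary tour\<close>

definition hf :: "'e elt \<Rightarrow> real \<Rightarrow> 'e half" where "hf x \<tau> = (if \<tau> = 1 then Head x else Tail x)"

lemma elt_of_hf [simp]: "elt_of (hf x \<tau>) = x" by (simp add: hf_def)

lemma half_points_hf: "half_points G (hf x \<tau>) = curve G x ` half_int \<tau>"
  by (simp add: hf_def half_points_def half_int_def)

lemma hf_cases: "\<exists>\<tau> \<in> {1, -1}. g = hf (elt_of g) \<tau>"
  by (cases g) (auto simp: hf_def)

text \<open>The sign of the direction in which the half \<open>\<tau>\<close> of \<open>x\<close> crosses the boundary tour:
  \<open>1\<close> if from the right of the tour to its left, that is, into \<open>N\<close>.\<close>

fun kap :: "'e elt \<Rightarrow> real \<Rightarrow> real" where
  "kap (Edge e) \<tau> = \<tau>"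
| "kap (Coedge e) \<tau> = - \<tau>"

lemma kap_sign: "\<tau> \<in> {1, -1} \<Longrightarrow> kap x \<tau> \<in> {1, -1}" by (cases x) auto

locale ribbon_tour = ribbon_surface G for G :: "('a::t2_space, 'e) ribbon" +
  fixes h :: "'e half" and B :: "'e elt set" and N :: "'a set" and c :: "real \<Rightarrow> 'a"
  assumes h: "elt_of h \<in> Edge ` edges G" and basis: "basis G B"
    and tour: "boundary_tour G h (edges_of G B) N c"
begin

definition "Q = edges_of G B"
text \<open>The elements outside \<open>B\<close>.\<close>

definition "Tr = Coedge ` Q \<union> Edge ` (E - Q)"

text \<open>A transversal has |E| elements and at most one from each dual pair, so by counting
  exactly one from each.\<close>

lemma B_eq: "B = Edge ` Q \<union> Coedge ` (E - Q)"
proof -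
  have tr: "B \<subseteq> elts G" "card B = card E" "\<And>e. \<not> {Edge e, Coedge e} \<subseteq> B"
    using basis by (auto simp: basis_def transversal_def)
  have finB: "finite B" using tr(1) finite_elts finite_subset by blast
  have "inj_on underlying B"
  proof (rule inj_onI)
    fix x y assume xy: "x \<in> B" "y \<in> B" "underlying x = underlying y"
    then show "x = y" using tr(3)[of "underlying x"] by (cases x; cases y) auto
  qed
  then have "card (underlying ` B) = card E" using tr(2) card_image by metis
  moreover have "underlying ` B \<subseteq> E" using tr(1) by (auto simp: elts_def)
  ultimately have im: "underlying ` B = E" using finite_E card_subset_eq by blast
  have one: "Edge e \<in> B \<or> Coedge e \<in> B" if "e \<in> E" for e
  proof -
    have "e \<in> underlying ` B" using im that by simp
    then obtain b where "b \<in> B" "underlying b = e" by auto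
    then show ?thesis by (cases b) auto
  qed
  have Q: "e \<in> Q \<longleftrightarrow> e \<in> E \<and> Edge e \<in> B" for e by (auto simp: Q_def edges_of_def)
  show ?thesis
  proof (intro set_eqI iffI)
    fix x assume x: "x \<in> B"
    then have "x \<in> elts G" using tr(1) by blast
    then show "x \<in> Edge ` Q \<union> Coedge ` (E - Q)"
    proof (rule elts_cases)
      fix e assume "e \<in> E" "x = Edge e"
      then show ?thesis using x Q[of e] by blast
    next
      fix e assume "e \<in> E" "x = Coedge e"
      then show ?thesis using x Q[of e] tr(3)[of e] by blast
    qed
  next
    fix x assume "x \<in> Edge ` Q \<union> Coedge ` (E - Q)"
    then show "x \<in> B" using Q one by blast
  qed
qed

lemma in_B: "Edge e \<in> B \<longleftrightarrow> e \<in> Q" "Coedge e \<in> B \<longleftrightarrow> e \<in> E - Q"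
  using arg_cong[OF B_eq, of "\<lambda>S. Edge e \<in> S"] arg_cong[OF B_eq, of "\<lambda>S. Coedge e \<in> S"] by auto

lemma Q_sub: "Q \<subseteq> E" by (auto simp: Q_def edges_of_def)
lemma Tr_elts: "x \<in> Tr \<Longrightarrow> x \<in> elts G" using Q_sub by (auto simp: Tr_def elts_def)
lemma B_elts: "x \<in> B \<Longrightarrow> x \<in> elts G" using Q_sub by (cases x) (auto simp: in_B elts_def)
lemma Tr_iff: "x \<in> elts G \<Longrightarrow> x \<in> Tr \<longleftrightarrow> x \<notin> B"
  by (erule elts_cases) (auto simp: in_B Tr_def)
lemma dual_B_iff: "x \<in> elts G \<Longrightarrow> dual x \<in> B \<longleftrightarrow> x \<notin> B"
  by (erule elts_cases) (auto simp: in_B)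

lemma card_Tr: "finite Tr" "card Tr = card E"
proof -
  have f: "finite Q" "finite (E - Q)" using finite_E Q_sub finite_subset by auto
  then show "finite Tr" by (simp add: Tr_def)
  have "card Tr = card (Coedge ` Q) + card (Edge ` (E - Q))"
    unfolding Tr_def by (rule card_Un_disjoint) (use f in auto)
  also have "\<dots> = card Q + card (E - Q)" by (simp add: card_image inj_on_def)
  finally show "card Tr = card E" using card_Diff_subset[OF f(1) Q_sub] card_mono[OF finite_E Q_sub] by simp
qed

lemma toured: "toured_halves G Q = halves Tr"
  by (auto simp: toured_halves_def halves_def Tr_def)

lemma tour_props:
  shows "simple_path c" "c 1 = c 0" "path_image c = frontier N" "lies_left A N c"
    "c 0 \<notin> graph_points G \<union> dual_graph_points G"
    "closed N" "verts G \<union> points G (Edge ` Q) \<subseteq> interior N"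
    "N \<inter> (coverts G \<union> points G (Coedge ` (E - Q))) = {}"
  using tour unfolding boundary_tour_def small_neighborhood_def Q_def pathstart_def pathfinish_def
  by - (elim conjE, assumption)+

lemma tour_once: "g \<in> halves Tr \<Longrightarrow> \<exists>!y. y \<in> half_points G g \<inter> frontier N"
proof -
  have "\<forall>g \<in> halves Tr. \<exists>!y. y \<in> half_points G g \<inter> frontier N"
    using tour unfolding boundary_tour_def small_neighborhood_def toured[unfolded Q_def] by (elim conjE) assumption
  then show "g \<in> halves Tr \<Longrightarrow> \<exists>!y. y \<in> half_points G g \<inter> frontier N" by (rule bspec)
qed

lemma tour_crosses:
  "x \<in> Tr \<Longrightarrow> s \<in> {0..1} \<Longrightarrow> t \<in> {0..1} \<Longrightarrow> \<gamma> x s = c t \<Longrightarrow> crosses A (\<gamma> x) s c t"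
proof -
  have "\<forall>x \<in> Tr. \<forall>s \<in> {0..1}. \<forall>t \<in> {0..1}. \<gamma> x s = c t \<longrightarrow> crosses A (\<gamma> x) s c t"
    using tour unfolding boundary_tour_def Tr_def Q_def by (elim conjE) assumption
  then show "x \<in> Tr \<Longrightarrow> s \<in> {0..1} \<Longrightarrow> t \<in> {0..1} \<Longrightarrow> \<gamma> x s = c t \<Longrightarrow> crosses A (\<gamma> x) s c t" by simp
qed

lemma tour_first: "k \<in> {h, dual_half h} \<inter> halves Tr \<Longrightarrow> g \<in> halves Tr \<Longrightarrow> crossing_time G c k \<le> crossing_time G c g"
proof -
  have "\<forall>k \<in> {h, dual_half h} \<inter> halves Tr. \<forall>g \<in> halves Tr. crossing_time G c k \<le> crossing_time G c g"
    using tour unfolding boundary_tour_def toured[unfolded Q_def] by (elim conjE) assumption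
  then show "k \<in> {h, dual_half h} \<inter> halves Tr \<Longrightarrow> g \<in> halves Tr \<Longrightarrow> crossing_time G c k \<le> crossing_time G c g" by blast
qed

lemma tour_path: "path c" using tour_props(1) simple_path_imp_path by blast

lemma tour_side: "t \<in> {0<..<1} \<Longrightarrow> side A c t 1 N"
  using tour_props(4) by (simp add: lies_left_side)

lemma frontier_avoids:
  assumes y: "y \<in> frontier N"
  shows "y \<notin> VV" "y \<notin> points G B"
proof -
  have 1: "y \<notin> interior N" using y by (simp add: frontier_def)
  have 2: "y \<in> N" using y frontier_subset_closed[OF tour_props(6)] by blast
  have 3: "y \<notin> verts G \<union> points G (Edge ` Q)" using 1 tour_props(7) by blast
  have 4: "y \<notin> coverts G \<union> points G (Coedge ` (E - Q))" using 2 tour_props(8) by blast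
  show "y \<notin> VV" using 3 4 by (simp add: VV_def)
  have "points G B = points G (Edge ` Q) \<union> points G (Coedge ` (E - Q))"
    using arg_cong[OF B_eq, of "points G"] unfolding points_def by (simp only: UN_Un)
  then show "y \<notin> points G B" using 3 4 by simp
qed

lemma tour_avoids:
  assumes "t \<in> {0..1}"
  shows "c t \<in> frontier N" "c t \<notin> VV" "c t \<notin> points G B"
proof -
  show 1: "c t \<in> frontier N" using assms tour_props(3) by (auto simp: path_image_def)
  show "c t \<notin> VV" "c t \<notin> points G B" using frontier_avoids[OF 1] by auto
qed

text \<open>The crossing point lies on both the edge and its coedge, one of which is in
  \<open>B\<close>. A tour that avoids \<open>B\<close> therefore meets every element in the
  interior of one of its halves.\<close>

lemma centre_in_B: "e \<in> E \<Longrightarrow> \<gamma> (Edge e) (1/2) \<in> points G B"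
proof -
  assume e: "e \<in> E"
  have p: "\<gamma> x (1/2) \<in> path_image (\<gamma> x)" for x
    unfolding path_image_def by (rule imageI) simp
  have "\<gamma> (Edge e) (1/2) \<in> path_image (\<gamma> (Edge e))" "\<gamma> (Edge e) (1/2) \<in> path_image (\<gamma> (Coedge e))"
    using p[of "Edge e"] p[of "Coedge e"] same_centre[OF e] by simp_all
  moreover have "Edge e \<in> B \<or> Coedge e \<in> B" using e by (auto simp: in_B)
  ultimately show ?thesis by (auto simp: points_def)
qed

lemma tour_in_half:
  assumes t: "t \<in> {0..1}" and "c t \<notin> W"
  shows "\<exists>g \<in> halves Tr. c t \<in> half_points G g"
proof -
  obtain x where x: "x \<in> elts G" "c t \<in> path_image (\<gamma> x)"
    using assms tour_avoids(2)[OF t] by (auto simp: W_def points_def)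
  then have xB: "x \<notin> B" using tour_avoids(3)[OF t] by (auto simp: points_def)
  then have xT: "x \<in> Tr" using Tr_iff x by blast
  obtain s where s: "s \<in> {0..1}" "c t = \<gamma> x s" using x(2) by (auto simp: path_image_def)
  then have "s \<noteq> 0" "s \<noteq> 1" using tour_avoids(2)[OF t] ends[OF x(1)] by auto
  moreover have "s \<noteq> 1/2"
  proof
    assume "s = 1/2"
    then have "c t = \<gamma> x (1/2)" using s(2) by (simp only:)
    moreover obtain e where e: "e \<in> E" "x = Edge e \<or> x = Coedge e" using x(1) by (auto simp: elts_def)
    ultimately have "c t = \<gamma> (Edge e) (1/2)" using same_centre[OF e(1)] by auto
    then have "c t \<in> points G B" using centre_in_B[OF e(1)] by simp
    then show False using tour_avoids(3)[OF t] by blast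
  qed
  ultimately obtain \<tau> where "\<tau> \<in> {1, -1}" "s \<in> half_int \<tau>" using half_int_cases[of s] s(1) by auto
  then have "c t \<in> half_points G (hf x \<tau>)" using s(2) by (auto simp: half_points_hf)
  then show ?thesis using xT by (intro bexI[of _ "hf x \<tau>"]) (auto simp: halves_def)
qed

abbreviation "T \<equiv> crossing_time G c"

lemma half_not_W: "elt_of g \<in> elts G \<Longrightarrow> half_points G g \<inter> W = {}"
proof -
  assume g: "elt_of g \<in> elts G"
  have "half_points G g \<subseteq> path_image (\<gamma> (elt_of g))"
    unfolding ray_half_points[symmetric] using ray_path(2)[OF g] by (auto simp: path_image_def)
  then show ?thesis using W_path[OF g] by blast
qed

lemma halvesD: "g \<in> halves Tr \<Longrightarrow> elt_of g \<in> Tr" "g \<in> halves Tr \<Longrightarrow> elt_of g \<in> elts G"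
  using Tr_elts by (auto simp: halves_def)

lemma crossing_time:
  assumes g: "g \<in> halves Tr"
  shows "0 < T g" "T g < 1" "c (T g) \<in> half_points G g"
    "\<And>t. t \<in> {0..1} \<Longrightarrow> c t \<in> half_points G g \<Longrightarrow> t = T g"
proof -
  obtain y where y: "y \<in> half_points G g" "y \<in> frontier N" "\<And>z. z \<in> half_points G g \<Longrightarrow> z \<in> frontier N \<Longrightarrow> z = y"
    using tour_once[OF g] by blast
  then obtain t where t: "t \<in> {0..1}" "y = c t" using tour_props(3) unfolding path_image_def by blast
  have "y \<notin> W" using half_not_W[OF halvesD(2)[OF g]] y(1) by blast
  moreover have "c 0 \<in> W" using tour_props(5) by (simp add: W_eq)
  \<comment> \<open>The base point of the closed tour is off the graph and its dual, so crossings
    happen strictly inside the time interval.\<close>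
  ultimately have "t \<noteq> 0" "t \<noteq> 1" using t tour_props(2) by auto
  then have t': "0 < t" "t < 1" using t(1) by auto
  have uniq: "u = t" if "u \<in> {0..1}" "c u \<in> half_points G g" for u
  proof -
    have "c u = c t" using y(3)[OF that(2) tour_avoids(1)[OF that(1)]] t(2) by simp
    then show ?thesis using simple_path_inner_unique[OF tour_props(1) t' that(1)] by simp
  qed
  have Tg: "T g = t" unfolding crossing_time_def
  proof (rule the_equality)
    show "t \<in> {0..1} \<and> c t \<in> half_points G g" using t y(1) by simp
  qed (use uniq in blast)
  show "0 < T g" "T g < 1" "c (T g) \<in> half_points G g" unfolding Tg using t' y(1) t(2) by simp_all
  show "u = T g" if "u \<in> {0..1}" "c u \<in> half_points G g" for u unfolding Tg by (rule uniq[OF that])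
qed

definition "X = T ` halves Tr"

lemma T_inj: "inj_on T (halves Tr)"
proof (rule inj_onI)
  fix g g' assume g: "g \<in> halves Tr" "g' \<in> halves Tr" "T g = T g'"
  then have "c (T g) \<in> half_points G g \<inter> half_points G g'" using crossing_time(3)[OF g(1)] crossing_time(3)[OF g(2)] by simp
  then show "g = g'" using half_points_disjoint[OF halvesD(2)[OF g(1)] halvesD(2)[OF g(2)]] by blast
qed

lemma crossing_times: "finite X" "card X = 2 * card E" "X \<subseteq> {0<..<1}" "X \<noteq> {}"
proof -
  show "finite X" "card X = 2 * card E"
    unfolding X_def using card_halves[OF card_Tr(1)] card_Tr(2) card_image[OF T_inj] by simp_all
  show "X \<subseteq> {0<..<1}" using crossing_time(1,2) by (auto simp: X_def)
  have "card E > 0" using finite_E edges_nonempty by (simp add: card_gt_0_iff)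
  then show "X \<noteq> {}" using \<open>card X = 2 * card E\<close> by auto
qed

lemma tour_W_iff: "t \<in> {0..1} \<Longrightarrow> c t \<in> W \<longleftrightarrow> t \<notin> X"
proof
  assume t: "t \<in> {0..1}" and "c t \<in> W"
  then show "t \<notin> X" using crossing_time(3) half_not_W halvesD(2) unfolding X_def by blast
next
  assume t: "t \<in> {0..1}" and n: "t \<notin> X"
  show "c t \<in> W"
  proof (rule ccontr)
    assume "c t \<notin> W"
    then obtain g where "g \<in> halves Tr" "c t \<in> half_points G g" using tour_in_half[OF t] by blast
    then show False using crossing_time(4) t n unfolding X_def by blast
  qed
qed

lemma crossing_param:
  assumes x: "x \<in> Tr"
  obtains s where "s \<in> half_int \<tau>" "\<gamma> x s = c (T (hf x \<tau>))"
    "\<And>u. u \<in> half_int \<tau> \<Longrightarrow> \<gamma> x u \<in> frontier N \<Longrightarrow> u = s"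
proof -
  have g: "hf x \<tau> \<in> halves Tr" using x by (simp add: halves_def)
  obtain s where s: "s \<in> half_int \<tau>" "\<gamma> x s = c (T (hf x \<tau>))"
    using crossing_time(3)[OF g] unfolding half_points_hf by force
  have T01: "T (hf x \<tau>) \<in> {0..1}" using crossing_time(1,2)[OF g] by auto
  have "u = s" if u: "u \<in> half_int \<tau>" "\<gamma> x u \<in> frontier N" for u
  proof -
    have "\<gamma> x u \<in> half_points G (hf x \<tau>)" "\<gamma> x s \<in> half_points G (hf x \<tau>)"
      using u s unfolding half_points_hf by blast+
    moreover have "\<gamma> x s \<in> frontier N" using tour_avoids(1)[OF T01] s(2) by simp
    ultimately have "\<gamma> x u = \<gamma> x s" using tour_once[OF g] u(2) by blast
    moreover have "0 < s" "s < 1" "u \<in> {0..1}" using s(1) u(1) half_int(2)[of \<tau>] by force+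
    ultimately show ?thesis using simple_path_inner_unique[OF simple[OF Tr_elts[OF x]]] by blast
  qed
  then show ?thesis using that s by blast
qed

text \<open>Beyond its single crossing, a half meets the frontier of \<open>N\<close> no more until
  its end. The end of an edge is a vertex, inside \<open>N\<close>; the end of a coedge is a
  covertex, outside \<open>N\<close>. Comparing with \<open>crossing_into\<close> gives the
  direction recorded by \<open>kap\<close>.\<close>

lemma crossing_direction:
  assumes x: "x \<in> Tr" and \<tau>: "\<tau> \<in> {1, -1}" and s: "s \<in> half_int \<tau>" "\<gamma> x s = c (T (hf x \<tau>))"
  shows "if kap x \<tau> = 1 then crosses_right_to_left A (\<gamma> x) s c (T (hf x \<tau>))
    else crosses_right_to_left A (reversepath (\<gamma> x)) (1 - s) c (T (hf x \<tau>))"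
proof -
  let ?t = "T (hf x \<tau>)"
  have g: "hf x \<tau> \<in> halves Tr" using x by (simp add: halves_def)
  have t: "0 < ?t" "?t < 1" using crossing_time(1,2)[OF g] by auto
  have xe: "x \<in> elts G" using Tr_elts[OF x] .
  have s01: "0 < s" "s < 1" using s(1) half_int(2)[of \<tau>] by force+
  obtain s' where s': "s' \<in> half_int \<tau>" "\<gamma> x s' = c ?t" "\<And>u. u \<in> half_int \<tau> \<Longrightarrow> \<gamma> x u \<in> frontier N \<Longrightarrow> u = s'"
    by (rule crossing_param[OF x]) (rule that)
  have fr: "\<gamma> x s \<in> frontier N" using tour_avoids(1)[of ?t] s(2) t by auto
  then have "s = s'" using s'(3) s(1) by blast
  \<comment> \<open>The part of the half strictly between the crossing and the (co)vertex, with the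
    (co)vertex at time \<open>s0\<close> included.\<close>
  define R where "R = (if \<tau> = 1 then {s<..1} else {0..<s})"
  define s0 where "s0 = (if \<tau> = 1 then 1 else 0 :: real)"
  have R: "R \<subseteq> insert s0 (half_int \<tau>)" "s \<notin> R" "connected R" "s0 \<in> R" "R \<subseteq> {0..1}"
  proof -
    have "R \<subseteq> insert s0 (half_int \<tau>) \<and> s \<notin> R \<and> connected R \<and> s0 \<in> R \<and> R \<subseteq> {0..1}"
    proof (cases "\<tau> = 1")
      case True
      have "s \<in> {1/2<..<1}" using s(1) True by (simp add: half_int_def)
      then show ?thesis using True by (auto simp: R_def s0_def half_int_def)
    next
      case False
      have "s \<in> {0<..<1/2}" using s(1) False by (simp add: half_int_def)
      then show ?thesis using False by (auto simp: R_def s0_def half_int_def)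
    qed
    then show "R \<subseteq> insert s0 (half_int \<tau>)" "s \<notin> R" "connected R" "s0 \<in> R" "R \<subseteq> {0..1}" by auto
  qed
  have "\<gamma> x ` R \<inter> frontier N = {}"
  proof -
    have "\<gamma> x u \<notin> frontier N" if "u \<in> R" for u
    proof
      assume f: "\<gamma> x u \<in> frontier N"
      have "u \<noteq> s0" using frontier_avoids(1)[OF f] ends[OF xe] by (auto simp: s0_def split: if_splits)
      then have "u \<in> half_int \<tau>" using R(1) that by blast
      then show False using s'(3) f \<open>s = s'\<close> R(2) that by blast
    qed
    then show ?thesis by blast
  qed
  moreover have conR: "connected (\<gamma> x ` R)"
    using path[OF xe] R(3,5) by (intro connected_continuous_image) (auto simp: path_def intro: continuous_on_subset)
  ultimately have dich: "\<gamma> x ` R \<subseteq> N \<or> \<gamma> x ` R \<inter> N = {}" using connected_Int_frontier[OF conR] by blast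
  have inR: "u \<in> R \<Longrightarrow> \<gamma> x u \<in> N \<longleftrightarrow> (\<exists>e. x = Edge e)" for u
  proof -
    assume u: "u \<in> R"
    have "\<gamma> x s0 \<in> N \<longleftrightarrow> (\<exists>e. x = Edge e)"
      using xe
    proof (rule elts_cases)
      fix e assume e: "e \<in> E" "x = Edge e"
      then have "\<gamma> x s0 \<in> verts G" using edge_props(2,3)[OF e(1)] by (auto simp: s0_def)
      then show ?thesis using tour_props(7) interior_subset[of N] e by blast
    next
      fix e assume e: "e \<in> E" "x = Coedge e"
      then have "\<gamma> x s0 \<in> coverts G" using coedge_props(2,3)[OF e(1)] by (auto simp: s0_def)
      then show ?thesis using tour_props(8) e by blast
    qed
    then show ?thesis using dich R(4) u by blast
  qed
  have near: "\<exists>u \<in> R. \<bar>u - s\<bar> < \<delta> \<and> 0 < \<tau> * (u - s)" if "\<delta> > 0" for \<delta>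
  proof (cases "\<tau> = 1")
    case True
    then show ?thesis using that s01 by (intro bexI[of _ "s + min (\<delta> / 2) (1 - s)"]) (auto simp: R_def min_def)
  next
    case False
    then show ?thesis using that s01 \<tau> by (intro bexI[of _ "s - min (\<delta> / 2) s"]) (auto simp: R_def min_def)
  qed
  have crs: "crosses A (\<gamma> x) s c ?t" using tour_crosses[OF x, of s ?t] s01 t s(2) by auto
  have rl: "crosses_right_to_left A (\<gamma> x) s c ?t \<Longrightarrow> (\<exists>e. x = Edge e) \<longleftrightarrow> \<tau> = 1"
  proof -
    assume a: "crosses_right_to_left A (\<gamma> x) s c ?t"
    obtain \<delta> where d: "\<delta> > 0" "\<forall>u. (s - \<delta> < u \<and> u < s \<longrightarrow> \<gamma> x u \<notin> N) \<and> (s < u \<and> u < s + \<delta> \<longrightarrow> \<gamma> x u \<in> N)"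
      using crossing_into[OF surface a path[OF xe] t s01 tour_props(6,3) tour_side] t by auto
    obtain u where u: "u \<in> R" "\<bar>u - s\<bar> < \<delta>" "0 < \<tau> * (u - s)" using near[OF d(1)] by blast
    have "\<gamma> x u \<in> N \<longleftrightarrow> \<tau> = 1"
    proof (cases "\<tau> = 1")
      case True
      then have "s < u" "u < s + \<delta>" using u(2,3) by auto
      then show ?thesis using d(2) True by blast
    next
      case False
      then have "s - \<delta> < u" "u < s" using u(2,3) \<tau> by auto
      then show ?thesis using d(2) False by blast
    qed
    then show ?thesis using inR[OF u(1)] by blast
  qed
  have rev: "crosses_right_to_left A (reversepath (\<gamma> x)) (1 - s) c ?t \<Longrightarrow> (\<exists>e. x = Edge e) \<longleftrightarrow> \<tau> = -1"
  proof -
    assume a: "crosses_right_to_left A (reversepath (\<gamma> x)) (1 - s) c ?t"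
    have s01': "0 < 1 - s" "1 - s < 1" using s01 by auto
    obtain \<delta> where d: "\<delta> > 0" "\<forall>u. (1 - s - \<delta> < u \<and> u < 1 - s \<longrightarrow> reversepath (\<gamma> x) u \<notin> N) \<and> (1 - s < u \<and> u < 1 - s + \<delta> \<longrightarrow> reversepath (\<gamma> x) u \<in> N)"
      using crossing_into[OF surface a path_imp_reversepath[OF path[OF xe]] t s01' tour_props(6,3) tour_side] t by auto
    obtain u where u: "u \<in> R" "\<bar>u - s\<bar> < \<delta>" "0 < \<tau> * (u - s)" using near[OF d(1)] by blast
    have r: "reversepath (\<gamma> x) (1 - u) = \<gamma> x u" by (simp add: reversepath_def)
    have "\<gamma> x u \<in> N \<longleftrightarrow> \<tau> = -1"
    proof (cases "\<tau> = 1")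
      case True
      then have "1 - s - \<delta> < 1 - u" "1 - u < 1 - s" using u(2,3) by auto
      then show ?thesis using d(2)[rule_format, of "1 - u"] True r by simp
    next
      case False
      then have "1 - s < 1 - u" "1 - u < 1 - s + \<delta>" "\<tau> = -1" using u(2,3) \<tau> by auto
      then show ?thesis using d(2)[rule_format, of "1 - u"] r by simp
    qed
    then show ?thesis using inR[OF u(1)] by blast
  qed
  show ?thesis using crs rl rev \<tau> unfolding crosses_def by (cases x) auto
qed

text \<open>\<rho> = 1 is the stretch of tour just before the crossing, \<rho> = -1 the one just
  after. If \<open>x\<close> crosses the tour from right to left, the earlier stretch is on the left
  of \<open>x\<close>; in the other direction the sides swap, hence the factor \<open>kap x\<close>
  \<tau>.\<close>

lemma tour_region:
  assumes x: "x \<in> Tr" and \<tau>: "\<tau> \<in> {1, -1}" and \<rho>: "\<rho> \<in> {1, -1}"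
  shows "\<exists>\<delta>>0. \<forall>u. 0 < \<rho> * (T (hf x \<tau>) - u) \<and> \<rho> * (T (hf x \<tau>) - u) < \<delta> \<longrightarrow> c u \<in> reg x \<tau> (kap x \<tau> * \<rho>)"
proof -
  let ?t = "T (hf x \<tau>)"
  have g: "hf x \<tau> \<in> halves Tr" using x by (simp add: halves_def)
  have t: "0 < ?t" "?t < 1" using crossing_time(1,2)[OF g] by auto
  have xe: "x \<in> elts G" using Tr_elts[OF x] .
  obtain s where s: "s \<in> half_int \<tau>" "\<gamma> x s = c ?t" by (rule crossing_param[OF x]) (rule that)
  have s01: "s \<in> {0<..<1}" "s \<noteq> 1/2" using s(1) half_int(2,3)[of \<tau>] by blast+
  have \<rho>': "- \<rho> \<in> {1, -1}" using \<rho> by auto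
  obtain O' where O': "open O'" "\<gamma> x s \<in> O'" "O' - path_image (\<gamma> x) \<subseteq> W" using half_nbhd[OF xe s01] by blast
  have cO: "c ?t \<in> O'" using O'(2) s(2) by simp
  note dir = crossing_direction[OF x \<tau> s]
  show ?thesis
  proof (cases "kap x \<tau> = 1")
    case True
    then have a: "crosses_right_to_left A (\<gamma> x) s c ?t" using dir by simp
    have s1: "s \<in> {0..1}" using s01 by auto
    obtain K \<delta> where K: "K \<in> components W" "side A (\<gamma> x) s \<rho> K"
      and d: "\<delta> > 0" "\<forall>u. 0 < \<rho> * (?t - u) \<and> \<rho> * (?t - u) < \<delta> \<longrightarrow> c u \<in> K"
      using crossing_after[OF surface a tour_path t s1 \<rho> O'(1) cO O'(3)] by (elim bexE exE conjE) (rule that)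
    have "K = reg x \<tau> \<rho>" by (rule reg_unique[OF xe \<rho> s(1) K(2,1) subset_refl])
    then show ?thesis using d True by (intro exI[of _ \<delta>]) simp
  next
    case False
    then have a: "crosses_right_to_left A (reversepath (\<gamma> x)) (1 - s) c ?t" and k: "kap x \<tau> = -1"
      using dir kap_sign[OF \<tau>, of x] by auto
    have s1: "1 - s \<in> {0..1}" using s01 by auto
    have O3: "O' - path_image (reversepath (\<gamma> x)) \<subseteq> W" using O'(3) by simp
    obtain K \<delta> where K: "K \<in> components W" "side A (reversepath (\<gamma> x)) (1 - s) \<rho> K"
      and d: "\<delta> > 0" "\<forall>u. 0 < \<rho> * (?t - u) \<and> \<rho> * (?t - u) < \<delta> \<longrightarrow> c u \<in> K"
      using crossing_after[OF surface a tour_path t s1 \<rho> O'(1) cO O3] by (elim bexE exE conjE) (rule that)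
    have "side A (\<gamma> x) s (- \<rho>) K" using side_reverse[OF surface K(2)] by simp
    then have "K = reg x \<tau> (- \<rho>)" by (rule reg_unique[OF xe \<rho>' s(1) _ K(1) subset_refl])
    then show ?thesis using d k by (intro exI[of _ \<delta>]) simp
  qed
qed

end

section \<open>Arcs of the tour and components\<close>

lemma connected_hub:
  assumes "connected C" "C \<noteq> {}" "\<And>K. K \<in> \<K> \<Longrightarrow> connected K \<and> K \<inter> C \<noteq> {}"
  shows "connected (C \<union> \<Union>\<K>)"
proof -
  have "connected (\<Union>(insert C ((\<lambda>K. C \<union> K) ` \<K>)))"
  proof (rule connected_Union)
    show "connected S" if "S \<in> insert C ((\<lambda>K. C \<union> K) ` \<K>)" for S
    proof -
      have "connected (C \<union> K)" if "K \<in> \<K>" for K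
        using connected_Un[OF assms(1), of K] assms(3)[OF that] by blast
      then show ?thesis using that assms(1) by blast
    qed
    show "\<Inter>(insert C ((\<lambda>K. C \<union> K) ` \<K>)) \<noteq> {}" using assms(2) by auto
  qed
  moreover have "\<Union>(insert C ((\<lambda>K. C \<union> K) ` \<K>)) = C \<union> \<Union>\<K>" by auto
  ultimately show ?thesis by simp
qed

lemma side_in_closure:
  assumes A: "closed_oriented_surface A" and t: "t \<in> {0..1}" and \<sigma>: "\<sigma> \<in> {1, -1}" and s: "side A c t \<sigma> S"
  shows "c t \<in> closure S"
proof (rule ccontr)
  assume n: "c t \<notin> closure S"
  have "side A c t \<sigma> (S \<inter> - closure S)" by (rule side_small[OF A t s]) (use n in auto)
  then have "S \<inter> - closure S \<noteq> {}" using side_meet[OF A t \<sigma>] by blast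
  then show False using closure_subset by blast
qed

context ribbon_tour begin

lemma near_crossing:
  assumes x: "x \<in> Tr" and \<tau>: "\<tau> \<in> {1, -1}" and \<rho>: "\<rho> \<in> {1, -1}" and \<epsilon>: "0 < \<epsilon>"
  obtains u where "u \<in> {0..1}" "u \<notin> X" "0 < \<rho> * (T (hf x \<tau>) - u)" "\<rho> * (T (hf x \<tau>) - u) < \<epsilon>"
    "c u \<in> reg x \<tau> (kap x \<tau> * \<rho>)"
proof -
  let ?t = "T (hf x \<tau>)"
  have g: "hf x \<tau> \<in> halves Tr" using x by (simp add: halves_def)
  have t: "0 < ?t" "?t < 1" using crossing_time(1,2)[OF g] by auto
  obtain \<delta> where d: "\<delta> > 0" "\<forall>u. 0 < \<rho> * (?t - u) \<and> \<rho> * (?t - u) < \<delta> \<longrightarrow> c u \<in> reg x \<tau> (kap x \<tau> * \<rho>)"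
    using tour_region[OF x \<tau> \<rho>] by blast
  define \<eta> where "\<eta> = min (min \<delta> \<epsilon>) (min ?t (1 - ?t)) / 2"
  have \<eta>: "0 < \<eta>" "\<eta> < \<delta>" "\<eta> < \<epsilon>" "\<eta> < ?t" "\<eta> < 1 - ?t" using d(1) \<epsilon> t by (auto simp: \<eta>_def)
  define u where "u = ?t - \<rho> * \<eta>"
  have \<rho>u: "\<rho> * (?t - u) = \<eta>" using \<rho> by (auto simp: u_def)
  have u01: "u \<in> {0..1}" using \<rho> \<eta> t by (auto simp: u_def)
  have cu: "c u \<in> reg x \<tau> (kap x \<tau> * \<rho>)" using d(2) \<rho>u \<eta> by simp
  have "kap x \<tau> * \<rho> \<in> {1, -1}" using kap_sign[OF \<tau>, of x] \<rho> by auto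
  then have "c u \<in> W" using cu in_components_subset[OF reg(1)[OF Tr_elts[OF x]]] by blast
  then have "u \<notin> X" using tour_W_iff[OF u01] by simp
  then show ?thesis using that[OF u01] \<rho>u \<eta> cu by simp
qed

text \<open>A side of a toured half is visited just before or just after its crossing. If the known
  half lies in \<open>B\<close>, the corner at the crossing point presents the same region as a side
  of a half of the dual element, which is toured.\<close>

lemma component_meets_tour:
  assumes K: "K \<in> components W"
  shows "\<exists>t \<in> {0..1} - X. c t \<in> K"
proof -
  have main: "\<exists>t \<in> {0..1} - X. c t \<in> reg x \<tau> \<sigma>" if x: "x \<in> Tr" "\<tau> \<in> {1, -1}" "\<sigma> \<in> {1, -1}" for x \<tau> \<sigma>
  proof -
    have k: "kap x \<tau> \<in> {1, -1}" using kap_sign[OF x(2)] .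
    then have \<rho>: "kap x \<tau> * \<sigma> \<in> {1, -1}" using x(3) by auto
    obtain u where u: "u \<in> {0..1}" "u \<notin> X" "c u \<in> reg x \<tau> (kap x \<tau> * (kap x \<tau> * \<sigma>))"
      by (rule near_crossing[OF x(1,2) \<rho> zero_less_one]) (rule that)
    moreover have "kap x \<tau> * (kap x \<tau> * \<sigma>) = \<sigma>" using k by auto
    ultimately show ?thesis by auto
  qed
  obtain x \<tau> \<sigma> where x: "x \<in> elts G" "\<tau> \<in> {1, -1}" "\<sigma> \<in> {1, -1}" "K = reg x \<tau> \<sigma>" by (rule component_is_reg[OF K])
  have m\<sigma>: "- \<sigma> \<in> {1, -1}" "- \<tau> \<in> {1, -1}" using x by auto
  show ?thesis
  proof (cases "x \<in> Tr")
    case True then show ?thesis using main x by blast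
  next
    case False
    then have d: "dual x \<in> Tr" using Tr_iff[of x] Tr_iff[of "dual x"] dual_B_iff[OF x(1)] x(1) by simp
    show ?thesis using x(1)
    proof (rule elts_cases)
      fix e assume e: "e \<in> E" "x = Edge e"
      have "K = reg (Coedge e) \<sigma> (- \<tau>)" using reg_Edge_Coedge[OF e(1) x(2,3)] x(4) e(2) by simp
      then show ?thesis using main[of "Coedge e" \<sigma> "- \<tau>"] d e x(3) m\<sigma> by simp
    next
      fix e assume e: "e \<in> E" "x = Coedge e"
      have "K = reg (Edge e) (- \<sigma>) \<tau>" using reg_Edge_Coedge[OF e(1) m\<sigma>(1) x(2)] x(4) e(2) by simp
      then show ?thesis using main[of "Edge e" "- \<sigma>" \<tau>] d e x(2) m\<sigma> by simp
    qed
  qed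
qed

text \<open>The crossing time that opens the arc of the tour through \<open>c t\<close>; the arc through the base point
  is opened by the last crossing.\<close>

definition pr :: "real \<Rightarrow> real" where
  "pr t = (if {r \<in> X. r < t} = {} then Max X else Max {r \<in> X. r < t})"

lemma pr_in: "pr t \<in> X"
proof (cases "{r \<in> X. r < t} = {}")
  case True then show ?thesis using crossing_times(1,4) by (simp add: pr_def)
next
  case False
  then have "Max {r \<in> X. r < t} \<in> {r \<in> X. r < t}" using crossing_times(1) by (intro Max_in) auto
  then show ?thesis using False unfolding pr_def by (simp only: if_False mem_Collect_eq)
qed

lemma pr_nonempty:
  assumes "r \<in> X" "r < t"
  shows "pr t < t" "r \<le> pr t"
proof -
  have ne: "{r \<in> X. r < t} \<noteq> {}" using assms by blast
  have fin: "finite {r \<in> X. r < t}" using crossing_times(1) by simp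
  have "pr t = Max {r \<in> X. r < t}" unfolding pr_def using ne by (simp only: if_False)
  then show "pr t < t" "r \<le> pr t" using Max_in[OF fin ne] Max_ge[OF fin, of r] assms by auto
qed

lemma pr_empty: "(\<And>r. r \<in> X \<Longrightarrow> \<not> r < t) \<Longrightarrow> pr t = Max X"
  by (auto simp: pr_def)

lemma same_arc:
  assumes t: "t \<in> {0..1} - X" "t' \<in> {0..1} - X" and pr: "pr t = pr t'"
  shows "connected_component W (c t) (c t')"
proof -
  have seg: "connected_component W (c s) (c s')" if "0 \<le> s" "s \<le> s'" "s' \<le> 1" "{s..s'} \<inter> X = {}" for s s'
  proof -
    have "connected (c ` {s..s'})"
      using tour_path that by (intro connected_continuous_image) (auto simp: path_def intro: continuous_on_subset)
    moreover have "c ` {s..s'} \<subseteq> W" using tour_W_iff that by fastforce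
    moreover have "c s \<in> c ` {s..s'}" "c s' \<in> c ` {s..s'}" using that by auto
    ultimately show ?thesis unfolding connected_component_def by blast
  qed
  have main: "connected_component W (c t) (c t')" if t: "t \<in> {0..1} - X" "t' \<in> {0..1} - X" "pr t = pr t'" "t \<le> t'" for t t'
  proof (cases "\<exists>r \<in> X. r < t")
    case True
    then obtain r where r: "r \<in> X" "r < t" by blast
    have "{t..t'} \<inter> X = {}"
    proof (rule ccontr)
      assume "{t..t'} \<inter> X \<noteq> {}"
      then obtain q where q: "q \<in> X" "t \<le> q" "q \<le> t'" by auto
      then have "q < t'" using t(2) by (cases "q = t'") auto
      then have "q \<le> pr t'" using pr_nonempty[OF q(1)] by blast
      moreover have "pr t < t" using pr_nonempty[OF r] by blast
      ultimately show False using t(3) q(2) by linarith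
    qed
    then show ?thesis using seg t by auto
  next
    case False
    show ?thesis
    proof (cases "\<exists>r \<in> X. r < t'")
      \<comment> \<open>Here \<open>t\<close> precedes all crossings and \<open>t'\<close> follows
        the last one: both lie on the arc through the base point and are joined via
        \<open>c 0 = c 1\<close>.\<close>
      case True
      then obtain r where r: "r \<in> X" "r < t'" by blast
      have m: "Max X < t'" using pr_nonempty(1)[OF r] pr_empty[of t] False t(3) by auto
      have "{0..t} \<inter> X = {}" using False t(1) by force
      moreover have "{t'..1} \<inter> X = {}" using m Max_ge[OF crossing_times(1)] by fastforce
      ultimately have "connected_component W (c 0) (c t)" "connected_component W (c t') (c 1)"
        using seg t by auto
      then show ?thesis using tour_props(2) by (metis connected_component_sym connected_component_trans)
    next
      case F: False
      have "{t..t'} \<inter> X = {}"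
      proof (rule ccontr)
        assume "{t..t'} \<inter> X \<noteq> {}"
        then obtain q where q: "q \<in> X" "t \<le> q" "q \<le> t'" by auto
        then have "q < t'" using t(2) by (cases "q = t'") auto
        then show False using F q by blast
      qed
      then show ?thesis using seg t by auto
    qed
  qed
  show ?thesis
  proof (cases "t \<le> t'")
    case True then show ?thesis using main t pr by blast
  next
    case False
    then have "connected_component W (c t') (c t)" using main[OF t(2,1) pr[symmetric]] by simp
    then show ?thesis by (rule connected_component_sym)
  qed
qed

text \<open>Counting: at most \<open>2|E|\<close> arcs meet all components of \<open>W\<close>, of which there are at least \<open>2|E|\<close>.\<close>

lemma pr_component:
  assumes t: "t \<in> {0..1} - X" "t' \<in> {0..1} - X" and K: "K \<in> components W" "c t \<in> K" "c t' \<in> K"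
  shows "pr t = pr t'"
proof -
  \<comment> \<open>Assigns to a crossing time the region containing the arc that this crossing
    opens. By \<open>same_arc\<close> the choice of the time on the arc does not matter.\<close>
  define \<Phi> where "\<Phi> = (\<lambda>m. connected_component_set W (c (SOME t. t \<in> {0..1} - X \<and> pr t = m)))"
  have \<Phi>: "K = \<Phi> (pr t)" if "K \<in> components W" "t \<in> {0..1} - X" "c t \<in> K" for K t
  proof -
    define t0 where "t0 = (SOME t'. t' \<in> {0..1} - X \<and> pr t' = pr t)"
    have t0: "t0 \<in> {0..1} - X \<and> pr t0 = pr t" unfolding t0_def by (rule someI[of _ t]) (use that in simp)
    then have cc: "connected_component W (c t0) (c t)" using same_arc[of t0 t] that(2) by simp
    have "c t0 \<in> W" using cc connected_component_in by metis
    then have k: "connected_component_set W (c t0) \<in> components W" by (rule componentsI)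
    have "c t \<in> connected_component_set W (c t0)" using cc by simp
    then have "K = connected_component_set W (c t0)" using components_nonoverlap[OF that(1) k] that(3) by blast
    then show ?thesis by (simp add: \<Phi>_def t0_def)
  qed
  have "components W \<subseteq> \<Phi> ` X"
  proof
    fix K assume k: "K \<in> components W"
    obtain t where "t \<in> {0..1} - X" "c t \<in> K" using component_meets_tour[OF k] by blast
    then show "K \<in> \<Phi> ` X" using \<Phi>[OF k] pr_in by blast
  qed
  moreover obtain \<K> where "\<K> \<subseteq> components W" "finite \<K>" "2 * card E \<le> card \<K>" by (rule many_components)
  \<comment> \<open>The squeeze: 2|E| regions at least, all of them values of \<Phi>, and exactly
    2|E| crossing times. So \<Phi> is injective and a region holds one arc only.\<close>
  ultimately have "card X \<le> card (\<Phi> ` X)" using crossing_times(1,2) card_mono[of "\<Phi> ` X" \<K>] by (metis finite_imageI order_trans)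
  then have "inj_on \<Phi> X" using crossing_times(1) by (metis card_image_le eq_card_imp_inj_on le_antisym)
  moreover have "\<Phi> (pr t) = \<Phi> (pr t')" using \<Phi>[OF K(1) t(1) K(2)] \<Phi>[OF K(1) t(2) K(3)] by simp
  ultimately show ?thesis using pr_in by (meson inj_onD)
qed

text \<open>With \<open>Mo\<close> below, the inner and the outer region belonging to two crossings.
  The outer part of the tour wraps around through the base point, so it consists of the times before
  \<open>t1\<close> and those after \<open>t2\<close>.\<close>

definition Mi :: "real \<Rightarrow> real \<Rightarrow> 'a set" where
  "Mi t1 t2 = \<Union>{K \<in> components W. c ` {t1<..<t2} \<inter> K \<noteq> {}}"

definition Mo :: "real \<Rightarrow> real \<Rightarrow> 'a set" where
  "Mo t1 t2 = \<Union>{K \<in> components W. c ` ({0..<t1} \<union> {t2<..1}) \<inter> K \<noteq> {}}"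

text \<open>The point is disjointness: a region met by both parts of the tour would, by
  \<open>pr_component\<close>, have equal opening times for an inner and an outer time.\<close>

lemma M_props:
  assumes t: "t1 \<in> X" "t2 \<in> X" "t1 < t2"
  shows "open (Mi t1 t2)" "open (Mo t1 t2)" "Mi t1 t2 \<inter> Mo t1 t2 = {}" "Mi t1 t2 \<union> Mo t1 t2 = W"
    "\<And>K. K \<in> components W \<Longrightarrow> K \<inter> Mi t1 t2 \<noteq> {} \<Longrightarrow> K \<subseteq> Mi t1 t2"
    "\<And>K. K \<in> components W \<Longrightarrow> K \<inter> Mo t1 t2 \<noteq> {} \<Longrightarrow> K \<subseteq> Mo t1 t2"
proof -
  show "open (Mi t1 t2)" "open (Mo t1 t2)" unfolding Mi_def Mo_def by (rule open_Union; use open_compW in blast)+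
  have t01: "0 < t1" "t2 < 1" using t crossing_times(3) by auto
  \<comment> \<open>For an inner time the opening crossing lies in \<open>[t1, t2)\<close>. For an
    outer time it is before \<open>t1\<close> or at least \<open>t2\<close>; the wrapped arc is
    opened by the last crossing and so falls in the second case.\<close>
  have notboth: False if K: "K \<in> components W" and u: "u \<in> {t1<..<t2}" "c u \<in> K" and v: "v \<in> {0..<t1} \<union> {t2<..1}" "c v \<in> K" for K u v
  proof -
    have u01: "u \<in> {0..1}" and v01: "v \<in> {0..1}" using u v t01 t(3) by auto
    have uX: "u \<in> {0..1} - X" using tour_W_iff[OF u01] u(2) in_components_subset[OF K] u01 by blast
    have vX: "v \<in> {0..1} - X" using tour_W_iff[OF v01] v(2) in_components_subset[OF K] v01 by blast
    have e: "pr u = pr v" by (rule pr_component[OF uX vX K u(2) v(2)])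
    have pu: "t1 \<le> pr u" "pr u < u" using pr_nonempty[OF t(1)] u(1) by auto
    then have pu2: "pr u < t2" using u(1) by auto
    show False
    proof (cases "v < t1")
      case True
      show False
      proof (cases "\<exists>r \<in> X. r < v")
        case True
        then have "pr v < v" using pr_nonempty by blast
        then show False using e pu \<open>v < t1\<close> by linarith
      next
        case False
        then have "pr v = Max X" using pr_empty by blast
        then show False using e pu2 Max_ge[OF crossing_times(1) t(2)] by linarith
      qed
    next
      case False
      then have "t2 < v" using v(1) by auto
      then have "t2 \<le> pr v" using pr_nonempty[OF t(2)] by blast
      then show False using e pu2 by linarith
    qed
  qed
  have KK: "K = K'" if "K \<in> components W" "K' \<in> components W" "y \<in> K" "y \<in> K'" for K K' y
    using components_nonoverlap[OF that(1,2)] that(3,4) by blast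
  show "Mi t1 t2 \<inter> Mo t1 t2 = {}"
  proof (rule ccontr)
    assume "Mi t1 t2 \<inter> Mo t1 t2 \<noteq> {}"
    then obtain y K K' where K: "K \<in> components W" "c ` {t1<..<t2} \<inter> K \<noteq> {}" "y \<in> K"
      and K': "K' \<in> components W" "c ` ({0..<t1} \<union> {t2<..1}) \<inter> K' \<noteq> {}" "y \<in> K'"
      unfolding Mi_def Mo_def by blast
    have "K' = K" using KK[OF K'(1) K(1) K'(3) K(3)] .
    obtain u where u: "u \<in> {t1<..<t2}" "c u \<in> K" using K(2) by blast
    obtain v where v: "v \<in> {0..<t1} \<union> {t2<..1}" "c v \<in> K" using K'(2) \<open>K' = K\<close> by blast
    show False by (rule notboth[OF K(1) u v])
  qed
  show "Mi t1 t2 \<union> Mo t1 t2 = W"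
  proof
    show "Mi t1 t2 \<union> Mo t1 t2 \<subseteq> W" unfolding Mi_def Mo_def using in_components_subset by blast
    show "W \<subseteq> Mi t1 t2 \<union> Mo t1 t2"
    proof
      fix y assume y: "y \<in> W"
      let ?K = "connected_component_set W y"
      have k: "?K \<in> components W" using y by (rule componentsI)
      have yK: "y \<in> ?K" using y by simp
      obtain u where u: "u \<in> {0..1}" "u \<notin> X" "c u \<in> ?K" using component_meets_tour[OF k] by blast
      have "u \<noteq> t1" "u \<noteq> t2" using u t by auto
      then have "u \<in> {t1<..<t2} \<or> u \<in> {0..<t1} \<union> {t2<..1}" using u(1) by auto
      then show "y \<in> Mi t1 t2 \<union> Mo t1 t2"
      proof
        assume "u \<in> {t1<..<t2}"
        then have "c ` {t1<..<t2} \<inter> ?K \<noteq> {}" using u(3) by blast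
        then show ?thesis unfolding Mi_def using k yK by blast
      next
        assume "u \<in> {0..<t1} \<union> {t2<..1}"
        then have "c ` ({0..<t1} \<union> {t2<..1}) \<inter> ?K \<noteq> {}" using u(3) by blast
        then show ?thesis unfolding Mo_def using k yK by blast
      qed
    qed
  qed
  show "K \<subseteq> Mi t1 t2" if k: "K \<in> components W" "K \<inter> Mi t1 t2 \<noteq> {}" for K
  proof -
    obtain y K' where K': "K' \<in> components W" "c ` {t1<..<t2} \<inter> K' \<noteq> {}" "y \<in> K'" "y \<in> K"
      using k(2) unfolding Mi_def by blast
    have "K' = K" using KK[OF K'(1) k(1) K'(3,4)] .
    then show ?thesis using K' unfolding Mi_def by blast
  qed
  show "K \<subseteq> Mo t1 t2" if k: "K \<in> components W" "K \<inter> Mo t1 t2 \<noteq> {}" for K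
  proof -
    obtain y K' where K': "K' \<in> components W" "c ` ({0..<t1} \<union> {t2<..1}) \<inter> K' \<noteq> {}" "y \<in> K'" "y \<in> K"
      using k(2) unfolding Mo_def by blast
    have "K' = K" using KK[OF K'(1) k(1) K'(3,4)] .
    then show ?thesis using K' unfolding Mo_def by blast
  qed
qed

lemma M_subset:
  "K \<in> components W \<Longrightarrow> u \<in> {t1<..<t2} \<Longrightarrow> c u \<in> K \<Longrightarrow> K \<subseteq> Mi t1 t2"
  "K \<in> components W \<Longrightarrow> u \<in> {0..<t1} \<union> {t2<..1} \<Longrightarrow> c u \<in> K \<Longrightarrow> K \<subseteq> Mo t1 t2"
  unfolding Mi_def Mo_def by blast+

lemma closure_M:
  assumes t: "t1 \<in> X" "t2 \<in> X" "t1 < t2"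
  shows "closure (Mi t1 t2 \<union> Mo t1 t2) = UNIV"
proof (rule ccontr)
  assume n: "closure (Mi t1 t2 \<union> Mo t1 t2) \<noteq> UNIV"
  then have "- closure W \<noteq> {}" unfolding M_props(4)[OF t] by blast
  then have "- closure W \<inter> W \<noteq> {}" using dense_W[of "- closure W"] by auto
  then show False using closure_subset[of W] by blast
qed

text \<open>Each part of the tour is a connected hub meeting all the regions of its union. The outer
  part is connected because the tour is closed.\<close>

lemma tour_arcs_connected:
  assumes t: "t1 \<in> X" "t2 \<in> X" "t1 < t2"
  shows "connected (c ` {t1<..<t2} \<union> Mi t1 t2)" "connected (c ` ({0..<t1} \<union> {t2<..1}) \<union> Mo t1 t2)"
proof -
  have t01: "0 < t1" "t2 < 1" using t crossing_times(3) by auto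
  have cont: "continuous_on {0..1} c" using tour_path by (simp add: path_def)
  have con: "connected (c ` S)" if "connected S" "S \<subseteq> {0..1}" for S
    by (rule connected_continuous_image[OF continuous_on_subset[OF cont that(2)] that(1)])
  have "connected (c ` {t1<..<t2})" by (rule con) (use t01 in auto)
  moreover have "c ` {t1<..<t2} \<noteq> {}" using t(3) by (auto intro: dense)
  ultimately show "connected (c ` {t1<..<t2} \<union> Mi t1 t2)" unfolding Mi_def
    by (rule connected_hub) (use in_components_connected in auto)
  have "connected (c ` {0..<t1} \<union> c ` {t2<..1})"
  proof (rule connected_Un)
    show "connected (c ` {0..<t1})" by (rule con) (use t t01 in auto)
    show "connected (c ` {t2<..1})" by (rule con) (use t t01 in auto)
    have "c 0 \<in> c ` {0..<t1}" "c 1 \<in> c ` {t2<..1}" using t01 by auto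
    then show "c ` {0..<t1} \<inter> c ` {t2<..1} \<noteq> {}" using tour_props(2) by auto
  qed
  then have "connected (c ` ({0..<t1} \<union> {t2<..1}))" by (simp add: image_Un)
  moreover have "c ` ({0..<t1} \<union> {t2<..1}) \<noteq> {}" using t01 by auto
  ultimately show "connected (c ` ({0..<t1} \<union> {t2<..1}) \<union> Mo t1 t2)" unfolding Mo_def
    by (rule connected_hub) (use in_components_connected in auto)
qed

lemma reg_M:
  assumes y: "y \<in> Tr" "\<tau> \<in> {1, -1}" "\<rho> \<in> {1, -1}" and t: "t1 \<in> X" "t2 \<in> X" "t1 < t2"
  shows "(\<exists>\<epsilon>>0. \<forall>u. 0 < \<rho> * (T (hf y \<tau>) - u) \<and> \<rho> * (T (hf y \<tau>) - u) < \<epsilon> \<longrightarrow> u \<in> {t1<..<t2}) \<Longrightarrow> reg y \<tau> (kap y \<tau> * \<rho>) \<subseteq> Mi t1 t2"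
    "(\<exists>\<epsilon>>0. \<forall>u \<in> {0..1}. 0 < \<rho> * (T (hf y \<tau>) - u) \<and> \<rho> * (T (hf y \<tau>) - u) < \<epsilon> \<longrightarrow> u \<in> {0..<t1} \<union> {t2<..1}) \<Longrightarrow> reg y \<tau> (kap y \<tau> * \<rho>) \<subseteq> Mo t1 t2"
proof -
  have "kap y \<tau> * \<rho> \<in> {1, -1}" using kap_sign[OF y(2), of y] y(3) by auto
  then have K: "reg y \<tau> (kap y \<tau> * \<rho>) \<in> components W" using reg(1)[OF Tr_elts[OF y(1)]] by blast
  show "reg y \<tau> (kap y \<tau> * \<rho>) \<subseteq> Mi t1 t2" if "\<exists>\<epsilon>>0. \<forall>u. 0 < \<rho> * (T (hf y \<tau>) - u) \<and> \<rho> * (T (hf y \<tau>) - u) < \<epsilon> \<longrightarrow> u \<in> {t1<..<t2}"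
  proof -
    obtain \<epsilon> where \<epsilon>: "\<epsilon> > 0" "\<forall>u. 0 < \<rho> * (T (hf y \<tau>) - u) \<and> \<rho> * (T (hf y \<tau>) - u) < \<epsilon> \<longrightarrow> u \<in> {t1<..<t2}" using \<open>\<exists>\<epsilon>>0. _ \<epsilon>\<close> by blast
    obtain u where "0 < \<rho> * (T (hf y \<tau>) - u)" "\<rho> * (T (hf y \<tau>) - u) < \<epsilon>" "c u \<in> reg y \<tau> (kap y \<tau> * \<rho>)"
      by (rule near_crossing[OF y \<epsilon>(1)]) (rule that)
    then show ?thesis using M_subset(1)[OF K] \<epsilon>(2) by blast
  qed
  show "reg y \<tau> (kap y \<tau> * \<rho>) \<subseteq> Mo t1 t2" if "\<exists>\<epsilon>>0. \<forall>u \<in> {0..1}. 0 < \<rho> * (T (hf y \<tau>) - u) \<and> \<rho> * (T (hf y \<tau>) - u) < \<epsilon> \<longrightarrow> u \<in> {0..<t1} \<union> {t2<..1}"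
  proof -
    obtain \<epsilon> where \<epsilon>: "\<epsilon> > 0" "\<forall>u \<in> {0..1}. 0 < \<rho> * (T (hf y \<tau>) - u) \<and> \<rho> * (T (hf y \<tau>) - u) < \<epsilon> \<longrightarrow> u \<in> {0..<t1} \<union> {t2<..1}" using \<open>\<exists>\<epsilon>>0. _ \<epsilon>\<close> by blast
    obtain u where "u \<in> {0..1}" "0 < \<rho> * (T (hf y \<tau>) - u)" "\<rho> * (T (hf y \<tau>) - u) < \<epsilon>" "c u \<in> reg y \<tau> (kap y \<tau> * \<rho>)"
      by (rule near_crossing[OF y \<epsilon>(1)]) (rule that)
    then show ?thesis using M_subset(2)[OF K] \<epsilon>(2) by blast
  qed
qed

end

section \<open>The fundamental circuit\<close>

locale ribbon_switch = ribbon_tour G h B N c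
  for G :: "('a::t2_space, 'e) ribbon" and h B N c +
  fixes x :: "'e elt"
  assumes x: "x \<in> Tr"
begin

text \<open>\<open>\<nu>\<close> is the side of \<open>x\<close> along which the inner region \<open>MI\<close> lies.\<close>

definition "tail_time = T (hf x (-1))"
definition "head_time = T (hf x 1)"
definition "t1 = min tail_time head_time"
definition "t2 = max tail_time head_time"
definition "\<nu> = (if tail_time < head_time then kap x 1 else - kap x 1)"
definition "MI = Mi t1 t2"
definition "MO = Mo t1 t2"
definition "TT = sym_diff B {x, dual x}"
text \<open>This will be \<open>FC G B x\<close>. Only inner points of elements are tested, because
  at a (co)vertex the closures of the two regions may meet without the element separating
  them.\<close>

definition "Good = {y \<in> TT. \<gamma> y ` {0<..<1} \<inter> closure MI \<inter> closure MO \<noteq> {}}"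

lemma xe: "x \<in> elts G" using Tr_elts[OF x] .

lemma hx: "hf x \<tau> \<in> halves Tr" using x by (simp add: halves_def)

lemma t12: "t1 \<in> X" "t2 \<in> X" "t1 < t2"
proof -
  have "tail_time \<noteq> head_time" using inj_onD[OF T_inj _ hx hx, of "-1" 1] by (auto simp: tail_time_def head_time_def hf_def)
  then show "t1 < t2" by (auto simp: t1_def t2_def)
  have "tail_time \<in> X" "head_time \<in> X" using hx by (auto simp: tail_time_def head_time_def X_def)
  then show "t1 \<in> X" "t2 \<in> X" by (auto simp: t1_def t2_def min_def max_def)
qed

lemma time_cases: "(tail_time < head_time \<and> t1 = tail_time \<and> t2 = head_time) \<or> (head_time < tail_time \<and> t1 = head_time \<and> t2 = tail_time)"
  using t12(3) by (auto simp: t1_def t2_def)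

lemma \<nu>: "\<nu> \<in> {1, -1}" "- \<nu> \<in> {1, -1}"
  using kap_sign[of 1 x] by (auto simp: \<nu>_def)

lemmas M = M_props[OF t12, folded MI_def MO_def]
lemmas M_closure = closure_M[OF t12, folded MI_def MO_def]

text \<open>The inner stretch lies after one crossing of \<open>x\<close> and before the other, and
  the two halves cross in opposite directions. The two sign changes cancel, so both halves have the
  inner region on the same side.\<close>

lemma x_sides:
  assumes \<tau>: "\<tau> \<in> {1, -1}"
  shows "reg x \<tau> \<nu> \<subseteq> MI" "reg x \<tau> (- \<nu>) \<subseteq> MO"
proof -
  have ins: "reg x \<tau> (kap x \<tau> * \<rho>) \<subseteq> MI" if \<rho>: "\<rho> \<in> {1, -1}" and c: "T (hf x \<tau>) = t1 \<and> \<rho> = -1 \<or> T (hf x \<tau>) = t2 \<and> \<rho> = 1" for \<rho>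
    unfolding MI_def
    by (rule reg_M(1)[OF x \<tau> \<rho> t12], rule exI[of _ "t2 - t1"]) (use c t12(3) in auto)
  \<comment> \<open>Every time in the unit interval before \<open>t1\<close> or after
    \<open>t2\<close> is outer, so any bound works.\<close>
  have out: "reg x \<tau> (kap x \<tau> * \<rho>) \<subseteq> MO" if \<rho>: "\<rho> \<in> {1, -1}" and c: "T (hf x \<tau>) = t1 \<and> \<rho> = 1 \<or> T (hf x \<tau>) = t2 \<and> \<rho> = -1" for \<rho>
    unfolding MO_def
    by (rule reg_M(2)[OF x \<tau> \<rho> t12], rule exI[of _ 1]) (use c in auto)
  have kap: "kap x (-1) = - kap x 1" by (cases x) auto
  consider (a) "tail_time < head_time" "t1 = tail_time" "t2 = head_time" "\<nu> = kap x 1" | (b) "head_time < tail_time" "t1 = head_time" "t2 = tail_time" "\<nu> = - kap x 1"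
    using time_cases by (auto simp: \<nu>_def)
  then have "reg x \<tau> \<nu> \<subseteq> MI \<and> reg x \<tau> (- \<nu>) \<subseteq> MO"
  proof cases
    case a
    consider "\<tau> = 1" | "\<tau> = -1" using \<tau> by auto
    then show ?thesis
    proof cases
      case 1
      then have "T (hf x \<tau>) = t2" using a by (simp add: head_time_def)
      then show ?thesis using ins[of 1] out[of "-1"] 1 a(4) by simp
    next
      case 2
      then have "T (hf x \<tau>) = t1" using a by (simp add: tail_time_def)
      then show ?thesis using ins[of "-1"] out[of 1] 2 a(4) kap by simp
    qed
  next
    case b
    consider "\<tau> = 1" | "\<tau> = -1" using \<tau> by auto
    then show ?thesis
    proof cases
      case 1
      then have "T (hf x \<tau>) = t1" using b by (simp add: head_time_def)
      then show ?thesis using ins[of "-1"] out[of 1] 1 b(4) by simp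
    next
      case 2
      then have "T (hf x \<tau>) = t2" using b by (simp add: tail_time_def)
      then show ?thesis using ins[of 1] out[of "-1"] 2 b(4) kap by simp
    qed
  qed
  then show "reg x \<tau> \<nu> \<subseteq> MI" "reg x \<tau> (- \<nu>) \<subseteq> MO" by auto
qed

lemma xB: "x \<notin> B" "dual x \<in> B" using Tr_iff[OF xe] dual_B_iff[OF xe] x by auto

lemma TT_iff: "y \<in> TT \<longleftrightarrow> y = x \<or> (y \<in> B \<and> y \<noteq> dual x)"
  using xB dual_neq[of x] by (auto simp: TT_def)

lemma TT_elts: "y \<in> TT \<Longrightarrow> y \<in> elts G" using TT_iff[of y] xe B_elts[of y] by auto

lemma dual_TT: "y \<in> elts G \<Longrightarrow> dual y \<in> TT \<longleftrightarrow> y \<notin> TT"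
proof -
  assume y: "y \<in> elts G"
  have "dual y = x \<longleftrightarrow> y = dual x" "dual y = dual x \<longleftrightarrow> y = x" by (metis dual_dual)+
  then show "dual y \<in> TT \<longleftrightarrow> y \<notin> TT"
    using TT_iff[of y] TT_iff[of "dual y"] dual_B_iff[OF y] xB dual_neq[of x] by auto
qed

text \<open>If \<open>y\<close> is not \<open>dual x\<close>, its crossing is neither of the two of
  \<open>x\<close>, so the tour just before and just after it is in the same part. For
  \<open>dual x\<close>, the two sides of one of its halves are, around the crossing point, the same
  side of the two halves of \<open>x\<close>, and \<open>x_sides\<close> applies.\<close>

lemma other_sides:
  assumes y: "y \<in> elts G" "y \<notin> TT" and \<tau>: "\<tau> \<in> {1, -1}"
  shows "(\<forall>\<sigma> \<in> {1, -1}. reg y \<tau> \<sigma> \<subseteq> MI) \<or> (\<forall>\<sigma> \<in> {1, -1}. reg y \<tau> \<sigma> \<subseteq> MO)"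
proof (cases "y = dual x")
  case False
  then have yT: "y \<in> Tr" "y \<noteq> x" using y TT_iff[of y] Tr_iff by auto
  let ?t = "T (hf y \<tau>)"
  have hy: "hf y \<tau> \<in> halves Tr" using yT by (simp add: halves_def)
  have "?t \<noteq> T (hf x \<tau>')" for \<tau>'
  proof
    assume "?t = T (hf x \<tau>')"
    then have "hf y \<tau> = hf x \<tau>'" using inj_onD[OF T_inj _ hy hx] by blast
    then have "elt_of (hf y \<tau>) = elt_of (hf x \<tau>')" by simp
    then show False using yT(2) by simp
  qed
  then have "?t \<noteq> tail_time" "?t \<noteq> head_time" by (simp_all add: tail_time_def head_time_def)
  then have ne: "?t \<noteq> t1" "?t \<noteq> t2" using time_cases by auto
  have k: "kap y \<tau> \<in> {1, -1}" using kap_sign[OF \<tau>] .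
  have ks: "kap y \<tau> * \<sigma> \<in> {1, -1}" "kap y \<tau> * (kap y \<tau> * \<sigma>) = \<sigma>" if "\<sigma> \<in> {1, -1}" for \<sigma>
    using k that by auto
  consider (i) "t1 < ?t" "?t < t2" | (o1) "?t < t1" | (o2) "t2 < ?t" using ne by linarith
  then show ?thesis
  proof cases
    case i
    have "reg y \<tau> (kap y \<tau> * \<rho>) \<subseteq> MI" if \<rho>: "\<rho> \<in> {1, -1}" for \<rho>
      unfolding MI_def
      by (rule reg_M(1)[OF yT(1) \<tau> \<rho> t12], rule exI[of _ "min (?t - t1) (t2 - ?t)"]) (use i \<rho> in auto)
    then show ?thesis using ks by metis
  next
    case o1
    have "reg y \<tau> (kap y \<tau> * \<rho>) \<subseteq> MO" if \<rho>: "\<rho> \<in> {1, -1}" for \<rho>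
      unfolding MO_def
      by (rule reg_M(2)[OF yT(1) \<tau> \<rho> t12], rule exI[of _ "t1 - ?t"]) (use o1 \<rho> in auto)
    then show ?thesis using ks by metis
  next
    case o2
    have "reg y \<tau> (kap y \<tau> * \<rho>) \<subseteq> MO" if \<rho>: "\<rho> \<in> {1, -1}" for \<rho>
      unfolding MO_def
      by (rule reg_M(2)[OF yT(1) \<tau> \<rho> t12], rule exI[of _ "?t - t2"]) (use o2 \<rho> in auto)
    then show ?thesis using ks by metis
  qed
next
  case True
  have both: "(\<forall>\<tau> \<in> {1, -1}. reg x \<tau> \<sigma> \<subseteq> MI) \<or> (\<forall>\<tau> \<in> {1, -1}. reg x \<tau> \<sigma> \<subseteq> MO)" if "\<sigma> \<in> {1, -1}" for \<sigma>
  proof (cases "\<sigma> = \<nu>")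
    case False
    then have "\<sigma> = - \<nu>" using that \<nu> by auto
    then show ?thesis using x_sides(2) by blast
  qed (use x_sides(1) in blast)
  show ?thesis using xe
  proof (rule elts_cases)
    fix e assume e: "e \<in> E" "x = Edge e"
    have "reg y \<tau> \<sigma> = reg x (- \<sigma>) \<tau>" if "\<sigma> \<in> {1, -1}" for \<sigma>
      using reg_Edge_Coedge[OF e(1), of "- \<sigma>" \<tau>] that \<tau> e True by auto
    then show ?thesis using both[OF \<tau>] by auto
  next
    fix e assume e: "e \<in> E" "x = Coedge e"
    have "reg y \<tau> \<sigma> = reg x \<sigma> (- \<tau>)" if "\<sigma> \<in> {1, -1}" for \<sigma>
      using reg_Edge_Coedge[OF e(1), of \<tau> \<sigma>] that \<tau> e True by auto
    moreover have "- \<tau> \<in> {1, -1}" using \<tau> by auto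
    ultimately show ?thesis using both[of "- \<tau>"] by auto
  qed
qed

lemma touch_reg:
  assumes y: "y \<in> elts G" and s: "s \<in> half_int \<tau>"
    and S: "S \<subseteq> W" "\<And>K. K \<in> components W \<Longrightarrow> K \<inter> S \<noteq> {} \<Longrightarrow> K \<subseteq> S" "\<gamma> y s \<in> closure S"
  shows "\<exists>\<sigma> \<in> {1, -1}. reg y \<tau> \<sigma> \<subseteq> S"
proof -
  have s01: "s \<in> {0<..<1}" "s \<noteq> 1/2" using s half_int(2,3)[of \<tau>] by blast+
  obtain O' where O': "open O'" "\<gamma> y s \<in> O'" "O' - path_image (\<gamma> y) \<subseteq> W" using half_nbhd[OF y s01] by blast
  obtain D \<zeta> where f: "flat_disc A (\<gamma> y) s D \<zeta>" using flat[OF y s01(1)] by blast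
  have s1: "s \<in> {0..1}" using s01 by auto
  obtain \<sigma> K where K: "\<sigma> \<in> {1, -1}" "K \<in> components W" "K \<subseteq> S" "side A (\<gamma> y) s \<sigma> K"
    using touch_side[OF surface f s1 O' W_path[OF y] S] by blast
  have "K = reg y \<tau> \<sigma>" by (rule reg_unique[OF y K(1) s K(4,2) subset_refl])
  then show ?thesis using K by blast
qed

lemma not_both:
  assumes y: "y \<in> elts G" "y \<notin> TT" and s: "s \<in> {0<..<1}" "s \<noteq> 1/2"
  shows "\<not> (\<gamma> y s \<in> closure MI \<and> \<gamma> y s \<in> closure MO)"
proof
  assume cl: "\<gamma> y s \<in> closure MI \<and> \<gamma> y s \<in> closure MO"
  obtain \<tau> where \<tau>: "\<tau> \<in> {1, -1}" "s \<in> half_int \<tau>" using half_int_cases[OF s] by blast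
  have W: "MI \<subseteq> W" "MO \<subseteq> W" using M(4) by auto
  obtain \<sigma> where \<sigma>: "\<sigma> \<in> {1, -1}" "reg y \<tau> \<sigma> \<subseteq> MI" using touch_reg[OF y(1) \<tau>(2) W(1) M(5)] cl by blast
  obtain \<sigma>' where \<sigma>': "\<sigma>' \<in> {1, -1}" "reg y \<tau> \<sigma>' \<subseteq> MO" using touch_reg[OF y(1) \<tau>(2) W(2) M(6)] cl by blast
  have ne: "reg y \<tau> \<sigma> \<noteq> {}" "reg y \<tau> \<sigma>' \<noteq> {}"
    using in_components_nonempty[OF reg(1)[OF y(1) \<sigma>(1)]] in_components_nonempty[OF reg(1)[OF y(1) \<sigma>'(1)]] by auto
  from other_sides[OF y \<tau>(1)] show False
  proof
    assume "\<forall>\<sigma> \<in> {1, -1}. reg y \<tau> \<sigma> \<subseteq> MI"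
    then have "reg y \<tau> \<sigma>' \<subseteq> MI" using \<sigma>'(1) by blast
    then show False using \<sigma>'(2) ne(2) M(3) by blast
  next
    assume "\<forall>\<sigma> \<in> {1, -1}. reg y \<tau> \<sigma> \<subseteq> MO"
    then have "reg y \<tau> \<sigma> \<subseteq> MO" using \<sigma>(1) by blast
    then show False using \<sigma>(2) ne(1) M(3) by blast
  qed
qed

lemma centre_dual: "y \<in> elts G \<Longrightarrow> \<gamma> y (1/2) = \<gamma> (dual y) (1/2)"
  by (erule elts_cases) (simp_all only: dual.simps same_centre)

lemma in_points: "y \<in> S \<Longrightarrow> s \<in> {0..1} \<Longrightarrow> \<gamma> y s \<in> points G S"
  unfolding points_def path_image_def by blast

text \<open>An element outside \<open>TT\<close> separates the two regions at no inner point except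
  possibly its crossing point, and there its dual, which is in \<open>TT\<close>, passes
  too.\<close>

lemma common_boundary: "closure MI \<inter> closure MO \<subseteq> points G Good \<union> VV"
proof
  fix z assume z: "z \<in> closure MI \<inter> closure MO"
  have "z \<notin> MI" "z \<notin> MO"
    using z M(1-3) open_Int_closure_eq_empty[OF M(1), of MO] open_Int_closure_eq_empty[OF M(2), of MI] by blast+
  then have "z \<notin> W" using M(4) by blast
  show "z \<in> points G Good \<union> VV"
  proof (rule ccontr)
    assume n: "z \<notin> points G Good \<union> VV"
    then obtain y where y: "y \<in> elts G" "z \<in> path_image (\<gamma> y)" using \<open>z \<notin> W\<close> by (auto simp: W_def points_def)
    then obtain s where s: "s \<in> {0..1}" "z = \<gamma> y s" unfolding path_image_def by blast
    have "s \<noteq> 0" "s \<noteq> 1" using s n ends[OF y(1)] by auto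
    then have s01: "s \<in> {0<..<1}" using s by auto
    have yT: "y \<notin> TT"
    proof
      assume "y \<in> TT"
      then have "y \<in> Good" using z s(2) s01 unfolding Good_def by blast
      then show False using n in_points s by blast
    qed
    \<comment> \<open>The crossing point is the one place that \<open>not_both\<close> leaves open;
      from here on it is regarded as a point of \<open>dual y\<close>.\<close>
    have "s = 1/2" using not_both[OF y(1) yT s01] z s(2) by blast
    then have "z = \<gamma> y (1/2)" using s(2) by (simp only:)
    then have e: "z = \<gamma> (dual y) (1/2)" using centre_dual[OF y(1)] by (rule trans)
    have "dual y \<in> TT" using dual_TT[OF y(1)] yT by blast
    moreover have "(1/2::real) \<in> {0<..<1}" by simp
    ultimately have "dual y \<in> Good" using z e unfolding Good_def by blast
    then have "z \<in> points G Good" unfolding e by (rule in_points) simp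
    then show False using n by blast
  qed
qed

lemma Good_TT: "Good \<subseteq> TT" by (auto simp: Good_def)

abbreviation "Y \<equiv> - points G Good"

lemma open_Y: "open Y"
  using closed_points'[of Good] Good_TT TT_elts by blast

lemma W_Y: "W \<subseteq> Y" using Good_TT TT_elts by (auto simp: W_def points_def)

text \<open>Off \<open>Good\<close> only (co)vertices are left as common boundary points. They are
  finitely many, so \<open>finite_touch\<close> excludes them without any knowledge of the local
  picture there.\<close>

lemma no_common: "closure MI \<inter> closure MO \<inter> Y = {}"
proof (rule finite_touch[OF surface M(1-3) M_closure open_Y])
  have "closure MI \<inter> closure MO \<inter> Y \<subseteq> VV" using common_boundary by blast
  then show "finite (closure MI \<inter> closure MO \<inter> Y)" using finite_VV finite_subset by blast
qed

lemma M_nonempty: "MI \<noteq> {}" "MO \<noteq> {}"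
  using x_sides[of 1] in_components_nonempty[OF reg(1)[OF xe \<nu>(1), of 1]] in_components_nonempty[OF reg(1)[OF xe \<nu>(2), of 1]] by auto

lemma cover: "closure MI \<union> closure MO = UNIV" using M_closure by (simp add: closure_Un)

lemma Y_disconnected: "\<not> connected Y"
proof
  assume con: "connected Y"
  have "MI \<subseteq> Y" "MO \<subseteq> Y" using W_Y M(4) by auto
  then have "closure MI \<inter> Y \<noteq> {}" "closure MO \<inter> Y \<noteq> {}" using M_nonempty closure_subset by blast+
  moreover have "Y \<subseteq> closure MI \<union> closure MO" using cover by simp
  ultimately show False using con no_common connected_closed[of Y] closed_closure by blast
qed

lemma TT_avoid:
  assumes "y \<in> TT" "y' \<in> TT" "y \<noteq> y'" "s \<in> {0<..<1}"
  shows "\<gamma> y s \<notin> path_image (\<gamma> y')"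
  using elt_meet_path[OF TT_elts[OF assms(1)] TT_elts[OF assms(2)] assms(3,4)] dual_TT[OF TT_elts[OF assms(1)]] assms(1,2) by blast

lemma tour_TT:
  assumes t: "t \<in> {0..1}" "t \<noteq> t1" "t \<noteq> t2"
  shows "c t \<notin> points G TT"
proof
  assume "c t \<in> points G TT"
  then obtain y where y: "y \<in> TT" "c t \<in> path_image (\<gamma> y)" by (auto simp: points_def)
  have yx: "y = x"
  proof (rule ccontr)
    assume "y \<noteq> x"
    then have "y \<in> B" using y TT_iff by blast
    then show False using tour_avoids(3)[OF t(1)] y by (auto simp: points_def)
  qed
  obtain s where s: "s \<in> {0..1}" "c t = \<gamma> x s" using y yx unfolding path_image_def by blast
  have "s \<noteq> 0" "s \<noteq> 1" using s tour_avoids(2)[OF t(1)] ends[OF xe] by auto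
  moreover have "s \<noteq> 1/2"
  proof
    assume "s = 1/2"
    then have "c t = \<gamma> x (1/2)" using s(2) by (simp only:)
    then have "c t = \<gamma> (dual x) (1/2)" using centre_dual[OF xe] by (rule trans)
    then have "c t \<in> points G B" using in_points[OF xB(2), of "1/2"] by simp
    then show False using tour_avoids(3)[OF t(1)] by blast
  qed
  ultimately obtain \<tau> where \<tau>: "\<tau> \<in> {1, -1}" "s \<in> half_int \<tau>" using half_int_cases[of s] s(1) by auto
  then have "c t \<in> half_points G (hf x \<tau>)" using s(2) by (auto simp: half_points_hf)
  then have "t = T (hf x \<tau>)" using crossing_time(4)[OF hx t(1)] by blast
  then have "t = tail_time \<or> t = head_time" using \<tau>(1) by (auto simp: tail_time_def head_time_def)
  then show False using time_cases t by auto
qed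

text \<open>With \<open>A2\<close> below, two connected sets off \<open>TT\<close> whose union is
  dense. Whether they fall apart after deleting some subset of \<open>TT\<close> depends only on the
  points that the deletion leaves in place.\<close>

definition "A1 = c ` {t1<..<t2} \<union> MI"
definition "A2 = c ` ({0..<t1} \<union> {t2<..1}) \<union> MO"

lemma arcs_avoid_TT: "connected A1" "connected A2" "A1 \<subseteq> - points G TT" "A2 \<subseteq> - points G TT"
proof -
  show "connected A1" "connected A2" unfolding A1_def A2_def MI_def MO_def by (rule tour_arcs_connected[OF t12])+
  have t01: "0 < t1" "t2 < 1" using t12 crossing_times(3) by auto
  have W: "W \<subseteq> - points G TT" using TT_elts by (auto simp: W_def points_def)
  have "c ` {t1<..<t2} \<subseteq> - points G TT"
  proof
    fix y assume "y \<in> c ` {t1<..<t2}"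
    then obtain t where t: "t \<in> {t1<..<t2}" "y = c t" by blast
    then have "t \<in> {0..1}" "t \<noteq> t1" "t \<noteq> t2" using t01 by auto
    then show "y \<in> - points G TT" using tour_TT t(2) by blast
  qed
  then show "A1 \<subseteq> - points G TT" unfolding A1_def using W M(4) by blast
  have "c ` ({0..<t1} \<union> {t2<..1}) \<subseteq> - points G TT"
  proof
    fix y assume "y \<in> c ` ({0..<t1} \<union> {t2<..1})"
    then obtain t where t: "t \<in> {0..<t1} \<union> {t2<..1}" "y = c t" by blast
    then have "t \<in> {0..1}" "t \<noteq> t1" "t \<noteq> t2" using t01 t12(3) by auto
    then show "y \<in> - points G TT" using tour_TT t(2) by blast
  qed
  then show "A2 \<subseteq> - points G TT" unfolding A2_def using W M(4) by blast
qed

lemma points_mono: "S \<subseteq> S' \<Longrightarrow> points G S \<subseteq> points G S'" by (auto simp: points_def)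

text \<open>A point on both regions, left in place, joins them to a dense connected set.\<close>

lemma Good_needed:
  assumes C: "C \<subseteq> TT" "\<not> connected (- points G C)"
  shows "Good \<subseteq> C"
proof
  fix y assume y: "y \<in> Good"
  show "y \<in> C"
  proof (rule ccontr)
    assume n: "y \<notin> C"
    have yT: "y \<in> TT" using y Good_TT by blast
    obtain s where s: "s \<in> {0<..<1}" "\<gamma> y s \<in> closure MI" "\<gamma> y s \<in> closure MO" using y unfolding Good_def by blast
    let ?z = "\<gamma> y s"
    have z: "?z \<in> - points G C" using TT_avoid[OF yT _ _ s(1)] C(1) n by (auto simp: points_def)
    have cl: "closure MI \<subseteq> closure A1" "closure MO \<subseteq> closure A2" by (rule closure_mono; simp add: A1_def A2_def)+
    have "connected (insert ?z A1)"
      by (rule connected_intermediate_closure[OF arcs_avoid_TT(1)]) (use s(2) cl(1) closure_subset in auto)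
    moreover have "connected (insert ?z A2)"
      by (rule connected_intermediate_closure[OF arcs_avoid_TT(2)]) (use s(3) cl(2) closure_subset in auto)
    ultimately have con: "connected (insert ?z A1 \<union> insert ?z A2)" by (intro connected_Un) auto
    have sub: "insert ?z A1 \<union> insert ?z A2 \<subseteq> - points G C" using arcs_avoid_TT(3,4) points_mono[OF C(1)] z by blast
    have "closure (MI \<union> MO) \<subseteq> closure (insert ?z A1 \<union> insert ?z A2)" by (rule closure_mono) (auto simp: A1_def A2_def)
    then have "- points G C \<subseteq> closure (insert ?z A1 \<union> insert ?z A2)" using M_closure by blast
    then have "connected (- points G C)" by (rule connected_intermediate_closure[OF con sub])
    then show False using C(2) by blast
  qed
qed

lemma TT_transversal: "transversal G TT"
proof -
  have B: "finite B" "card B = card E" "B \<subseteq> elts G"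
    using basis finite_subset[OF _ finite_elts] by (auto simp: basis_def transversal_def)
  have "TT = insert x (B - {dual x})" using TT_iff by auto
  moreover have "card (insert x (B - {dual x})) = Suc (card (B - {dual x}))"
    using B(1) xB(1) by (intro card_insert_disjoint) auto
  ultimately have "card TT = card B" using card_Suc_Diff1[OF B(1) xB(2)] by simp
  moreover have "\<not> {Edge e, Coedge e} \<subseteq> TT" for e
    using dual_TT[of "Edge e"] TT_elts[of "Edge e"] by auto
  ultimately show ?thesis using TT_elts B(2) unfolding transversal_def by auto
qed

lemma Good_circuit: "circuit G Good"
  unfolding circuit_def
proof (intro conjI allI impI)
  show "subtransversal G Good" unfolding subtransversal_def using TT_transversal Good_TT by blast
  show "\<not> connected Y" by (rule Y_disconnected)
  fix C' assume C': "C' \<subset> Good"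
  show "\<not> (subtransversal G C' \<and> \<not> connected (- points G C'))"
  proof
    assume "subtransversal G C' \<and> \<not> connected (- points G C')"
    then have "Good \<subseteq> C'" using Good_needed[of C'] C' Good_TT by blast
    then show False using C' by blast
  qed
qed

text \<open>By \<open>Good_needed\<close> every disconnecting subset of \<open>TT\<close> contains
  \<open>Good\<close>, which gives the uniqueness required by the definite description; minimality
  of a circuit excludes a proper superset.\<close>

lemma FC_eq: "FC G B x = Good"
  unfolding FC_def TT_def[symmetric]
proof (rule the_equality)
  show "circuit G Good \<and> Good \<subseteq> TT" using Good_circuit Good_TT by blast
  fix C assume C: "circuit G C \<and> C \<subseteq> TT"
  then have "Good \<subseteq> C" using Good_needed by (simp add: circuit_def)
  moreover have "\<not> Good \<subset> C"
  proof
    assume "Good \<subset> C"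
    then have "\<not> (subtransversal G Good \<and> \<not> connected Y)" using C by (simp add: circuit_def)
    then show False using Good_circuit by (simp add: circuit_def)
  qed
  ultimately show "C = Good" by blast
qed

lemma x_Good: "x \<in> Good"
proof -
  obtain s where s: "s \<in> half_int 1" using half_int_nonempty by blast
  have s01: "s \<in> {0<..<1}" "s \<in> {0..1}" using s half_int(2)[of 1] by force+
  have "side A (\<gamma> x) s \<nu> MI" by (rule side_mono[OF reg(2)[OF xe \<nu>(1) s] x_sides(1)]) simp
  then have "\<gamma> x s \<in> closure MI" by (rule side_in_closure[OF surface s01(2) \<nu>(1)])
  moreover have "side A (\<gamma> x) s (- \<nu>) MO" by (rule side_mono[OF reg(2)[OF xe \<nu>(2) s] x_sides(2)]) simp
  then have "\<gamma> x s \<in> closure MO" by (rule side_in_closure[OF surface s01(2) \<nu>(2)])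
  moreover have "x \<in> TT" using TT_iff by blast
  ultimately show ?thesis using s01(1) unfolding Good_def by blast
qed

section \<open>The position of the point p and the comparison of signs\<close>

text \<open>The corner of \<open>h\<close> and \<open>dual_half h\<close> is a single region, and
  one of these two halves is toured. The tour visits that region just before crossing this half, and
  no crossing comes earlier, so it is visited before \<open>t1\<close>.\<close>

lemma near_half_MO:
  assumes p: "p \<notin> graph_points G \<union> dual_graph_points G" "near_half G h p"
  shows "p \<in> MO"
proof -
  obtain e where e: "e \<in> E" "elt_of h = Edge e" using h by blast
  have el: "Edge e \<in> elts G" "Coedge e \<in> elts G" using e(1) by (auto simp: elts_def)
  obtain \<tau> where \<tau>: "\<tau> \<in> {1, -1}" "h = hf (Edge e) \<tau>" using hf_cases[of h] e(2) by auto
  have dh: "dual_half h = hf (Coedge e) \<tau>" using \<tau> by (auto simp: hf_def)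
  have ray: "Im (half_ray (dual_half h)) = \<tau>" unfolding dh using \<tau>(1) by (auto simp: hf_def)
  have mid: "half_midpoint h \<in> half_int \<tau>" using \<tau> by (auto simp: hf_def half_midpoint_def half_int_def)
  obtain D \<zeta> where f: "flat_disc A (\<gamma> (Edge e)) (half_midpoint h) D \<zeta>"
    and D: "D \<inter> (graph_points G \<union> dual_graph_points G) \<subseteq> path_image (\<gamma> (Edge e))" "p \<in> D" "sgn (Im (\<zeta> p)) = \<tau>"
    using p(2) unfolding near_half_def e(2) ray by blast
  let ?H = "{y \<in> D. 0 < \<tau> * Im (\<zeta> y)}"
  have pH: "p \<in> ?H" using D(2,3) \<tau>(1) by (auto simp: sgn_if split: if_splits)
  have "?H \<subseteq> W"
  proof
    fix y assume y: "y \<in> ?H"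
    then have "y \<notin> path_image (\<gamma> (Edge e))" using flat_disc_on_path[OF f, of y] by auto
    then show "y \<in> W" using y D(1) unfolding W_eq by blast
  qed
  moreover have "W \<noteq> {}" using pH calculation by blast
  ultimately obtain K where K: "K \<in> components W" "?H \<subseteq> K"
    using exists_component_superset[OF _ _ flat_disc_half_connected[OF f]] by meson
  have "side A (\<gamma> (Edge e)) (half_midpoint h) \<tau> ?H" using f unfolding side_def by blast
  then have KE: "K = reg (Edge e) \<tau> \<tau>" by (rule reg_unique[OF el(1) \<tau>(1) mid _ K])
  then have KC: "K = reg (Coedge e) \<tau> (- \<tau>)" using reg_Edge_Coedge[OF e(1) \<tau>(1,1)] by simp
  define z where "z = (if Edge e \<in> Tr then Edge e else Coedge e)"
  have z: "z \<in> Tr" using Tr_iff[OF el(1)] Tr_iff[OF el(2)] dual_B_iff[OF el(1)] by (auto simp: z_def)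
  \<comment> \<open>The corner is side \<tau> of the edge half and side -\<tau> of the coedge half.
    In both cases this is the side \<open>kap z\<close> \<tau>, the one the tour is on immediately
    before the crossing.\<close>
  have Kz: "K = reg z \<tau> (kap z \<tau> * 1)" using KE KC by (auto simp: z_def)
  have hz: "hf z \<tau> \<in> {h, dual_half h} \<inter> halves Tr"
    using z \<tau>(2) dh by (auto simp: z_def halves_def)
  have first: "T (hf z \<tau>) \<le> t1"
    using tour_first[OF hz hx] time_cases by (auto simp: tail_time_def head_time_def)
  have one: "(1::real) \<in> {1, -1}" by simp
  obtain u where u: "u \<in> {0..1}" "0 < 1 * (T (hf z \<tau>) - u)" "c u \<in> reg z \<tau> (kap z \<tau> * 1)"
    by (rule near_crossing[OF z \<tau>(1) one zero_less_one]) (rule that)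
  have "u \<in> {0..<t1} \<union> {t2<..1}" using u(1,2) first by auto
  then have "K \<subseteq> MO" unfolding MO_def using M_subset(2)[OF K(1)] u(3) Kz by blast
  then show ?thesis using pH K(2) by blast
qed

context
  fixes p :: 'a
  assumes p: "p \<in> MO"
begin

abbreviation "P \<equiv> connected_component_set Y p"

text \<open>The component contains the connected set \<open>A2\<close>, hence the outer region. It
  cannot reach the inner one, because the two closures cover the surface and are disjoint on
  \<open>Y\<close>.\<close>

lemma component_P: "P \<in> components Y" "MO \<subseteq> P" "P \<inter> MI = {}"
proof -
  have pY: "p \<in> Y" using p M(4) W_Y by blast
  then show "P \<in> components Y" by (rule componentsI)
  have "A2 \<subseteq> Y" using arcs_avoid_TT(4) points_mono[OF Good_TT] by blast
  moreover have "p \<in> A2" using p by (simp add: A2_def)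
  ultimately have "A2 \<subseteq> P" by (intro connected_component_maximal arcs_avoid_TT(2))
  then show MOP: "MO \<subseteq> P" by (auto simp: A2_def)
  have PY: "P \<subseteq> Y" by (rule connected_component_subset)
  have "closure MO \<inter> P \<noteq> {}" using MOP p closure_subset by blast
  moreover have "closure MI \<inter> closure MO \<inter> P = {}" using no_common PY by blast
  moreover have "P \<subseteq> closure MI \<union> closure MO" using cover by simp
  ultimately have "closure MI \<inter> P = {}"
    using connected_connected_component[of Y p] connected_closed[of P] closed_closure by blast
  then show "P \<inter> MI = {}" using closure_subset by blast
qed

text \<open>\<open>lies_left\<close> speaks about all inner times, so the side must be carried
  across the crossing point. There \<open>W\<close> splits into corners but \<open>Y\<close> does
  not, since \<open>dual x\<close> is not in \<open>TT\<close>; the side in \<open>Y\<close> is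
  therefore constant along all of \<open>x\<close>.\<close>

lemma x_side_P:
  assumes t: "t \<in> {0<..<1}"
  shows "side A (\<gamma> x) t (- \<nu>) P" "\<not> side A (\<gamma> x) (3/4) \<nu> P" "\<not> side A (\<gamma> x) (1/4) \<nu> P"
proof -
  have nb: "\<exists>O'. open O' \<and> \<gamma> x u \<in> O' \<and> O' - path_image (\<gamma> x) \<subseteq> Y" if "u \<in> {0<..<1}" for u
  proof (intro exI conjI)
    let ?O = "- points G (TT - {x})"
    show "open ?O" using closed_points'[of "TT - {x}"] TT_elts by blast
    show "\<gamma> x u \<in> ?O" using TT_avoid[of x _ u] TT_iff that by (auto simp: points_def)
    show "?O - path_image (\<gamma> x) \<subseteq> Y" using Good_TT by (auto simp: points_def)
  qed
  \<comment> \<open>Sample times, one in the head half and one in the tail half.\<close>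
  have m: "3/4 \<in> half_int 1" "3/4 \<in> {0<..<1::real}" "3/4 \<in> {0..1::real}" "1/4 \<in> half_int (-1)" "1/4 \<in> {0..1::real}" by (auto simp: half_int_def)
  have "MO \<subseteq> P" by (rule component_P(2))
  then have "reg x 1 (- \<nu>) \<subseteq> P" using x_sides(2)[of 1] by auto
  then have s: "side A (\<gamma> x) (3/4) (- \<nu>) P" by (rule side_mono[OF reg(2)[OF xe \<nu>(2) m(1)]])
  have con: "connected {0<..<1::real}" by simp
  show "side A (\<gamma> x) t (- \<nu>) P"
    by (rule side_component_const[OF surface simple[OF xe] con subset_refl \<nu>(2) flat[OF xe] nb component_P(1) m(2) s t])
  have no: "\<not> side A (\<gamma> x) s \<nu> P" if s: "s \<in> {0..1}" "s \<in> half_int \<tau>" "\<tau> \<in> {1, -1}" for s \<tau>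
  proof
    assume "side A (\<gamma> x) s \<nu> P"
    then have "P \<inter> reg x \<tau> \<nu> \<noteq> {}" using side_meet[OF surface s(1) \<nu>(1) _ reg(2)[OF xe \<nu>(1) s(2)]] by blast
    then show False using component_P(3) x_sides(1)[OF s(3)] by blast
  qed
  show "\<not> side A (\<gamma> x) (3/4) \<nu> P" by (rule no[OF m(3,1)]) simp
  show "\<not> side A (\<gamma> x) (1/4) \<nu> P" by (rule no[OF m(5,4)]) simp
qed

text \<open>The component of p lies on the side opposite to \<nu>, hence left of the parametrised
  curve iff \<nu> = -1. A reference orientation against the parametrisation exchanges the
  sides.\<close>

lemma lies_left_iff: "lies_left A P (ref_curve G r x) \<longleftrightarrow> (r (underlying x) \<longleftrightarrow> \<nu> = -1)"
proof (cases "r (underlying x)")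
  case True
  then have rc: "ref_curve G r x = \<gamma> x" by (simp add: ref_curve_def)
  show ?thesis
  proof (cases "\<nu> = -1")
    case n: True
    have "side A (\<gamma> x) t 1 P" if "t \<in> {0<..<1}" for t using x_side_P(1)[OF that] n by simp
    then show ?thesis unfolding rc lies_left_side using True n by simp
  next
    case False
    then have n: "\<nu> = 1" using \<nu> by simp
    then have "\<not> side A (\<gamma> x) (3/4) 1 P" using x_side_P(2)[of "1/2"] by simp
    then have "\<not> lies_left A P (\<gamma> x)" unfolding lies_left_side by (auto intro!: bexI[of _ "3/4"])
    then show ?thesis unfolding rc using True False by simp
  qed
next
  case False
  then have rc: "ref_curve G r x = reversepath (\<gamma> x)" by (simp add: ref_curve_def)
  show ?thesis
  proof (cases "\<nu> = -1")
    case n: True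
    have "\<not> side A (reversepath (\<gamma> x)) (1/4) 1 P"
    proof
      assume "side A (reversepath (\<gamma> x)) (1/4) 1 P"
      then have "side A (\<gamma> x) (3/4) (-1) P" using side_reverse[OF surface, of "reversepath (\<gamma> x)" "1/4" 1 P] by simp
      then show False using x_side_P(2)[of "1/2"] n by simp
    qed
    then have "\<not> lies_left A P (reversepath (\<gamma> x))" unfolding lies_left_side by (auto intro!: bexI[of _ "1/4"])
    then show ?thesis unfolding rc using False n by simp
  next
    case n: False
    then have n1: "\<nu> = 1" using \<nu> by simp
    have "side A (reversepath (\<gamma> x)) t 1 P" if t: "t \<in> {0<..<1}" for t
    proof -
      have "side A (\<gamma> x) (1 - t) (-1) P" using x_side_P(1)[of "1 - t"] t n1 by simp
      then show ?thesis using side_reverse[OF surface, of "\<gamma> x" "1 - t" "-1" P] by simp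
    qed
    then show ?thesis unfolding rc lies_left_side using False n by simp
  qed
qed

lemma beta_p_eq:
  assumes e: "e = underlying x"
  shows "beta_p G r p B e = (if r e \<longleftrightarrow> \<nu> = -1 then 1/2 else - 1/2)"
proof -
  have xd: "{Edge e, Coedge e} = {x, dual x}" using e by (cases x) auto
  have "{Edge e, Coedge e} - B = {x}" unfolding xd using xB by auto
  then have e': "(THE y. y \<in> {Edge e, Coedge e} - B) = x" by simp
  let ?C = "signed_ribbon_cycle G r Good P"
  have supp: "{y. signed_ribbon_cycle G r C S y \<noteq> 0} = C" for C S by (auto simp: signed_ribbon_cycle_def)
  have "(THE C. C \<in> sigma G r p \<and> {y. C y \<noteq> 0} = FC G B x) = ?C"
  proof (rule the_equality)
    show "?C \<in> sigma G r p \<and> {y. ?C y \<noteq> 0} = FC G B x"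
      unfolding supp FC_eq sigma_def using Good_circuit by blast
    fix C assume C: "C \<in> sigma G r p \<and> {y. C y \<noteq> 0} = FC G B x"
    then obtain C0 where "C = signed_ribbon_cycle G r C0 (connected_component_set (- points G C0) p)" "circuit G C0"
      unfolding sigma_def by blast
    moreover from this have "C0 = Good" using C unfolding FC_eq using supp by metis
    ultimately show "C = ?C" by simp
  qed
  moreover have "?C x = (if r e \<longleftrightarrow> \<nu> = -1 then 1 else - 1)"
    using x_Good lies_left_iff[of r] e by (simp add: signed_ribbon_cycle_def)
  ultimately show ?thesis unfolding beta_p_def Let_def e' by simp
qed

end

text \<open>In both cases \<nu> = -1 says that the tour orients the edge along its parametrisation.
  For an edge outside \<open>Q\<close> this happens when the head half is crossed first; for a
  coedge \<open>kap\<close> changes sign and the tour orientation lists the halves in the opposite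
  order.\<close>

lemma bernardi_eq:
  assumes e: "e = underlying x"
  shows "bernardi G r c B e = (if r e \<longleftrightarrow> \<nu> = -1 then 1/2 else - 1/2)"
proof -
  have Q: "edges_of G B = Q" by (simp add: Q_def)
  have times: "tail_time = T (Tail x)" "head_time = T (Head x)" by (simp_all add: tail_time_def head_time_def hf_def)
  show ?thesis
  proof (cases x)
    case (Edge e')
    then have eQ: "e \<notin> Q" "x = Edge e" using xB(1) e by (auto simp: in_B)
    have "kap x 1 = 1" unfolding eQ(2) by simp
    then have n: "\<nu> = -1 \<longleftrightarrow> \<not> T (Tail x) < T (Head x)" unfolding \<nu>_def times by simp
    have o: "tour_orientation G c Q e = (if T (Tail x) < T (Head x) then (Head x, Tail x) else (Tail x, Head x))"
      unfolding tour_orientation_def eQ(2) using eQ(1) by (simp add: Let_def)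
    have d: "ref_direction r e = (if r e then (Tail x, Head x) else (Head x, Tail x))"
      unfolding ref_direction_def eQ(2) by simp
    show ?thesis unfolding bernardi_def Q o d n by simp
  next
    case (Coedge e')
    then have eQ: "e \<in> Q" "x = Coedge e" using xB(2) e by (auto simp: in_B)
    have "kap x 1 = -1" unfolding eQ(2) by simp
    then have n: "\<nu> = -1 \<longleftrightarrow> T (Tail x) < T (Head x)" unfolding \<nu>_def times by simp
    have o: "tour_orientation G c Q e =
        (if T (Tail x) < T (Head x) then (Tail (Edge e), Head (Edge e)) else (Head (Edge e), Tail (Edge e)))"
      unfolding tour_orientation_def eQ(2) using eQ(1) by (simp add: Let_def)
    show ?thesis unfolding bernardi_def Q o n ref_direction_def by simp
  qed
qed

end

theorem theorem5p15:
  fixes G :: "('a::t2_space, 'e) ribbon" and r :: "'e \<Rightarrow> bool"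
    and h :: "'e half" and p :: 'a
  assumes "ribbon_graph G"
    and "elt_of h \<in> Edge ` edges G"
    and "p \<notin> graph_points G \<union> dual_graph_points G"
    and "near_half G h p"
  shows "\<forall>B N c. basis G B \<longrightarrow> boundary_tour G h (edges_of G B) N c \<longrightarrow>
           (\<forall>e \<in> edges G. bernardi G r c B e = beta_p G r p B e)"
proof (intro allI impI ballI)
  fix B N c e
  assume a: "basis G B" "boundary_tour G h (edges_of G B) N c" "e \<in> edges G"
  interpret ribbon_tour G h B N c
    by unfold_locales (use assms a in auto)
  define x where "x = (if Edge e \<in> Tr then Edge e else Coedge e)"
  have el: "Edge e \<in> elts G" "Coedge e \<in> elts G" using a(3) by (auto simp: elts_def)
  have xT: "x \<in> Tr" "e = underlying x"
    using Tr_iff[OF el(1)] Tr_iff[OF el(2)] dual_B_iff[OF el(1)] by (auto simp: x_def)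
  interpret ribbon_switch G h B N c x by unfold_locales (rule xT(1))
  have p: "p \<in> MO" by (rule near_half_MO[OF assms(3,4)])
  show "bernardi G r c B e = beta_p G r p B e"
    unfolding bernardi_eq[OF xT(2)] beta_p_eq[OF p xT(2)] ..
qed

end
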